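(* There exists an algorithm $\mathcal{A}$ such that for every $n$, every XOS function $f:\{0,1\}^n\to[0,1]$ and every $\epsilon>0$, given $\epsilon$ and access to independent random examples $(x,f(x))$ with $x$ uniform on $\{0,1\}^n$, with probability at least $2/3$ the algorithm outputs a function $h$ such that $\|f-h\|_2\le\epsilon$. Moreover, $\mathcal{A}$ runs in time $r^{O(1/\epsilon)}\cdot n$ and uses $r^{O(1/\epsilon)}\log n$ random examples, where $r=\min\{n,2^{1/\epsilon}\}$.
   Context: A function $f:\{0,1\}^n\to\mathbb{R}_+$ is XOS if there is a nonempty finite set $C$ and nonnegative weights $w_{ci}\ge 0$ ($c\in C$, $i\in[n]$) such that $f(x)=\max_{c\in C}\sum_{i=1}^n w_{ci}x_i$ for all $x$. $\|g\|_2=\sqrt{\mathbb{E}_x[g(x)^2]}$ with $x$ uniform on $\{0,1\}^n$. *)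

theory Defs
  imports "HOL-Probability.Probability"
begin

section \<open>XOS functions on the Boolean cube\<close>

text \<open>The cube has to be available for all \<open>n\<close> at once, so a point of \<open>{0,1}\<^sup>n\<close> is a Boolean
  sequence vanishing from index \<open>n\<close> on; coordinates are \<open>0, \<dots>, n - 1\<close>. A function on the cube is
  a total function of which only the values on \<open>cube n\<close> are ever used.\<close>

type_synonym point = "nat \<Rightarrow> bool"

definition cube :: "nat \<Rightarrow> point set" where
  "cube n = {x. \<forall>i\<ge>n. \<not> x i}"

lemma bij_betw_cube: "bij_betw (\<lambda>x. {i. x i}) (cube n) (Pow {..<n})"
  by (rule bij_betw_byWitness[where f' = "\<lambda>S i. i \<in> S"])
     (auto simp: cube_def not_le[symmetric])

lemma card_cube: "card (cube n) = 2 ^ n"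
  using bij_betw_same_card[OF bij_betw_cube] by (simp add: card_Pow)

lemma finite_cube: "finite (cube n)"
  using bij_betw_finite[OF bij_betw_cube] by simp

definition XOS :: "nat \<Rightarrow> (point \<Rightarrow> real) \<Rightarrow> bool" where
  "XOS n f \<longleftrightarrow> (\<exists>(K :: nat set) (w :: nat \<Rightarrow> nat \<Rightarrow> real).
     finite K \<and> K \<noteq> {} \<and> (\<forall>c\<in>K. \<forall>i<n. 0 \<le> w c i) \<and>
     (\<forall>x\<in>cube n. f x = (MAX c\<in>K. \<Sum>i<n. w c i * of_bool (x i))))"

definition uniform :: "nat \<Rightarrow> point measure" where
  "uniform n = measure_pmf (pmf_of_set (cube n))"

definition norm2 :: "nat \<Rightarrow> (point \<Rightarrow> real) \<Rightarrow> real" where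
  "norm2 n g = sqrt (\<integral>x. (g x)\<^sup>2 \<partial>uniform n)"

definition iid_points :: "nat \<Rightarrow> (nat \<Rightarrow> point) measure" where
  "iid_points n = Pi\<^sub>M UNIV (\<lambda>_. uniform n)"


section \<open>Hypotheses: arithmetic circuits\<close>

text \<open>A function output by an algorithm is given by an arithmetic circuit over the coordinates of
  \<open>x\<close>: a list of gates, where \<open>GAdd\<close>, \<open>GMul\<close> and \<open>GMax\<close> refer to earlier gates by position. The
  circuit computes the value of its last gate (and \<open>0\<close> if it has no gate). A dangling reference
  reads \<open>0\<close>.\<close>

datatype ('a, 'b) gate = GConst 'b | GVar 'a | GAdd 'a 'a | GMul 'a 'a | GMax 'a 'a

type_synonym circuit = "(nat, real) gate list"

definition wire :: "real list \<Rightarrow> nat \<Rightarrow> real" where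
  "wire vs j = (if j < length vs then vs ! j else 0)"

fun gate_val :: "point \<Rightarrow> real list \<Rightarrow> (nat, real) gate \<Rightarrow> real" where
  "gate_val x vs (GConst a) = a"
| "gate_val x vs (GVar i) = of_bool (x i)"
| "gate_val x vs (GAdd j k) = wire vs j + wire vs k"
| "gate_val x vs (GMul j k) = wire vs j * wire vs k"
| "gate_val x vs (GMax j k) = max (wire vs j) (wire vs k)"

definition circuit_vals :: "point \<Rightarrow> circuit \<Rightarrow> real list" where
  "circuit_vals x gs = foldl (\<lambda>vs g. vs @ [gate_val x vs g]) [] gs"

definition circuit_fun :: "circuit \<Rightarrow> point \<Rightarrow> real" where
  "circuit_fun gs x = (if gs = [] then 0 else last (circuit_vals x gs))"


section \<open>Algorithms: a real RAM with an example oracle\<close>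

text \<open>Algorithms are programs of a small imperative language over a unit-cost real RAM. A program
  has finitely many named arrays of naturals and of reals. On naturals, which serve as indices and
  counters, only addition and (truncated) subtraction are available, so no information can be
  packed into them by repeated squaring; on reals there is exact field arithmetic (with
  \<open>a / 0 = 0\<close>) and comparison, but no rounding. The only numeric constants of a program are
  naturals. Hence a program is a finite object that cannot depend on \<open>n\<close>, on \<open>\<epsilon>\<close>, or on noncomputable
  reals.

  \<open>Draw\<close> requests one labelled random example \<open>(x, f x)\<close>; as usual for an example oracle this is
  a single step, after which \<open>Bit i\<close> and \<open>Label\<close> give random access to the coordinates of \<open>x\<close>
  and to \<open>f x\<close>, until the next \<open>Draw\<close> replaces the example. \<open>Emit\<close> appends one gate to the circuit
  that is being output.\<close>

type_synonym vname = string

datatype nexp = N nat | NV vname nexp | NAdd nexp nexp | NSub nexp nexp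

datatype rexp = OfNat nexp | RV vname nexp | Label
  | RAdd rexp rexp | RSub rexp rexp | RMul rexp rexp | RDiv rexp rexp

datatype bexp = Bit nexp | NLess nexp nexp | RLess rexp rexp | BNot bexp | BAnd bexp bexp

datatype com = Skip
  | NAssign vname nexp nexp
  | RAssign vname nexp rexp
  | Draw
  | Emit "(nexp, rexp) gate"
  | Seq com com
  | Cond bexp com com
  | While bexp com

record state =
  nmem :: "vname \<Rightarrow> nat \<Rightarrow> nat"
  rmem :: "vname \<Rightarrow> nat \<Rightarrow> real"
  cur_point :: point
  cur_label :: real
  drawn :: nat
  emitted :: circuit

fun nval :: "nexp \<Rightarrow> state \<Rightarrow> nat" where
  "nval (N k) s = k"
| "nval (NV v a) s = nmem s v (nval a s)"
| "nval (NAdd a b) s = nval a s + nval b s"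
| "nval (NSub a b) s = nval a s - nval b s"

fun rval :: "rexp \<Rightarrow> state \<Rightarrow> real" where
  "rval (OfNat a) s = real (nval a s)"
| "rval (RV v a) s = rmem s v (nval a s)"
| "rval Label s = cur_label s"
| "rval (RAdd a b) s = rval a s + rval b s"
| "rval (RSub a b) s = rval a s - rval b s"
| "rval (RMul a b) s = rval a s * rval b s"
| "rval (RDiv a b) s = rval a s / rval b s"

fun bval :: "bexp \<Rightarrow> state \<Rightarrow> bool" where
  "bval (Bit a) s \<longleftrightarrow> cur_point s (nval a s)"
| "bval (NLess a b) s \<longleftrightarrow> nval a s < nval b s"
| "bval (RLess a b) s \<longleftrightarrow> rval a s < rval b s"
| "bval (BNot b) s \<longleftrightarrow> \<not> bval b s"
| "bval (BAnd b c) s \<longleftrightarrow> bval b s \<and> bval c s"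

text \<open>\<open>exec orc c s t s'\<close>: with \<open>orc\<close> the infinite sequence of labelled examples supplied by the
  oracle, \<open>c\<close> started in \<open>s\<close> terminates in \<open>s'\<close> after \<open>t\<close> steps. The expressions occurring
  in a program have bounded size, so charging one step for evaluating an expression loses only a
  constant factor that depends on the program alone.\<close>

inductive exec :: "(nat \<Rightarrow> point \<times> real) \<Rightarrow> com \<Rightarrow> state \<Rightarrow> nat \<Rightarrow> state \<Rightarrow> bool"
  for orc :: "nat \<Rightarrow> point \<times> real" where
  exec_Skip: "exec orc Skip s 1 s"
| exec_NAssign: "exec orc (NAssign v a e) s 1
    (s\<lparr>nmem := (nmem s)(v := (nmem s v)(nval a s := nval e s))\<rparr>)"
| exec_RAssign: "exec orc (RAssign v a e) s 1
    (s\<lparr>rmem := (rmem s)(v := (rmem s v)(nval a s := rval e s))\<rparr>)"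
| exec_Draw: "exec orc Draw s 1
    (s\<lparr>cur_point := fst (orc (drawn s)), cur_label := snd (orc (drawn s)), drawn := drawn s + 1\<rparr>)"
| exec_Emit: "exec orc (Emit g) s 1
    (s\<lparr>emitted := emitted s @ [map_gate (\<lambda>a. nval a s) (\<lambda>e. rval e s) g]\<rparr>)"
| exec_Seq: "exec orc c s t1 s1 \<Longrightarrow> exec orc d s1 t2 s2 \<Longrightarrow> exec orc (Seq c d) s (t1 + t2) s2"
| exec_CondT: "bval b s \<Longrightarrow> exec orc c s t s1 \<Longrightarrow> exec orc (Cond b c d) s (t + 1) s1"
| exec_CondF: "\<not> bval b s \<Longrightarrow> exec orc d s t s1 \<Longrightarrow> exec orc (Cond b c d) s (t + 1) s1"
| exec_WhileF: "\<not> bval b s \<Longrightarrow> exec orc (While b c) s 1 s"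
| exec_WhileT: "bval b s \<Longrightarrow> exec orc c s t1 s1 \<Longrightarrow> exec orc (While b c) s1 t2 s2 \<Longrightarrow>
    exec orc (While b c) s (t1 + t2 + 1) s2"

inductive_cases exec_elims:
  "exec orc Skip s t s'"
  "exec orc (NAssign v a e) s t s'"
  "exec orc (RAssign v a e) s t s'"
  "exec orc Draw s t s'"
  "exec orc (Emit g) s t s'"
  "exec orc (Seq c d) s t s'"
  "exec orc (Cond b c d) s t s'"
inductive_cases exec_WhileE: "exec orc (While b c) s t s'"

lemma exec_deterministic:
  assumes "exec orc c s t s1" and "exec orc c s t' s2"
  shows "t' = t \<and> s2 = s1"
  using assms
proof (induction arbitrary: t' s2 rule: exec.induct)
  case (exec_WhileF b s c)
  from exec_WhileF.prems exec_WhileF.hyps show ?case by (cases rule: exec_WhileE) auto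
next
  case (exec_WhileT b s c t1 s1 t2 s2 t'' s'')
  from exec_WhileT.prems exec_WhileT.hyps(1) obtain u1 r u2
    where "exec orc c s u1 r" "exec orc (While b c) r u2 s''" "t'' = u1 + u2 + 1"
    by (cases rule: exec_WhileE) auto
  with exec_WhileT.IH show ?case by blast
next
  case (exec_Seq c s t1 s1 d t2 s2 t'' s'')
  from exec_Seq.prems obtain u1 r u2
    where "exec orc c s u1 r" "exec orc d r u2 s''" "t'' = u1 + u2"
    by (cases rule: exec_elims(6)) auto
  with exec_Seq.IH show ?case by blast
next
  case (exec_CondT b s c t s1 d t'' s'')
  from exec_CondT.prems exec_CondT.hyps(1) obtain u where "exec orc c s u s''" "t'' = u + 1"
    by (cases rule: exec_elims(7)) auto
  with exec_CondT.IH show ?case by blast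
next
  case (exec_CondF b s d t s1 c t'' s'')
  from exec_CondF.prems exec_CondF.hyps(1) obtain u where "exec orc d s u s''" "t'' = u + 1"
    by (cases rule: exec_elims(7)) auto
  with exec_CondF.IH show ?case by blast
qed (erule exec_elims(1-5); simp)+

definition start :: "nat \<Rightarrow> real \<Rightarrow> state" where
  "start n \<epsilon> =
    \<lparr>nmem = (\<lambda>_ _. 0)(''n'' := (\<lambda>_. 0)(0 := n)),
     rmem = (\<lambda>_ _. 0)(''eps'' := (\<lambda>_. 0)(0 := \<epsilon>)),
     cur_point = (\<lambda>_. False), cur_label = 0, drawn = 0, emitted = []\<rparr>"

text \<open>The algorithm \<open>A\<close>, given \<open>\<epsilon>\<close> and the examples \<open>(X 0, f (X 0)), (X 1, f (X 1)), \<dots>\<close>, halts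
  after \<open>t\<close> steps, having drawn the first \<open>m\<close> of them and having output the circuit \<open>h\<close>.\<close>

definition runs :: "com \<Rightarrow> nat \<Rightarrow> real \<Rightarrow> (point \<Rightarrow> real) \<Rightarrow> (nat \<Rightarrow> point) \<Rightarrow> nat \<Rightarrow> nat \<Rightarrow> circuit \<Rightarrow> bool"
  where "runs A n \<epsilon> f X t m h \<longleftrightarrow>
    (\<exists>s. exec (\<lambda>j. (X j, f (X j))) A (start n \<epsilon>) t s \<and> m = drawn s \<and> h = emitted s)"

end

(*
For an XOS function, a maximizing clause at a point is a tight linear minorant. Comparing the
marginals at the points below z with the minorant at z shows that the sum of all upward marginals
has second moment at most 3, while the sum of the downward marginals is at most f. Hence
sum |S|^2 fhat(S)^2 <= 1, and the Fourier weight above degree d is at most 1/d^2: degree O(1/eps)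
suffices. Since f is monotone, fhat({i}) is the L1-influence of i, and these sum to at most 1; by
Bonami's inequality the coordinates with influence below some 2^-O(1/eps) carry little
low-degree weight, which leaves a junta.

The learner finds the junta by estimating all fhat({i}), and then estimates the low-degree
coefficients inside the junta from fresh examples. Reading all n bits of the O(log n)
examples that a union bound needs would cost n log n, so a coordinate is dropped as soon as its
running estimate is too small; the number of surviving small coordinates decays geometrically, and
the total work is linear in n.
*)

theory Submission
  imports Defs
begin

section \<open>Fourier analysis on the cube\<close>

text \<open>Bounding only the sum of |S| fhat(S)^2, as total influence does, would allow degree
  O(1/\<epsilon>^2); the square on |S| is what the second-moment bound is for. With d =
  ceil(2/\<epsilon>) the weight above d is at most \<epsilon>^2/4. The threshold \<open>thr\<close>
  is tuned so that discarding coordinates costs at most another \<epsilon>^2/4, and sampling is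
  allowed a third quarter. Quantities depending on \<epsilon> alone are 2^O(1/\<epsilon>). They are
  measured in powers of z = r^(1/\<epsilon>), which is at least 2^(1/\<epsilon>) once n >= 2. For n
  = 1 one has r = 1, no growth with 1/\<epsilon> is permitted, and a separate program is needed. The
  time and sample bounds are demanded for every sequence of examples in the cube, while linear
  screening work holds only in expectation. Hence the explicit caps on the work and on the number of
  survivors; runs that hit a cap are charged to the failure probability.\<close>

definition cube_avg :: "nat \<Rightarrow> (point \<Rightarrow> real) \<Rightarrow> real" where
  "cube_avg n g = (\<Sum>x\<in>cube n. g x) / 2 ^ n"

text \<open>\<open>True\<close> becomes 1, so that a monotone function has nonnegative coefficients
  at singletons.\<close>

definition pm :: "bool \<Rightarrow> real" where
  "pm b = (if b then 1 else -1)"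

definition character :: "nat set \<Rightarrow> point \<Rightarrow> real" where
  "character S x = (\<Prod>i\<in>S. pm (x i))"

definition fourier :: "nat \<Rightarrow> (point \<Rightarrow> real) \<Rightarrow> nat set \<Rightarrow> real" where
  "fourier n f S = cube_avg n (\<lambda>x. f x * character S x)"

lemma pm_mult_self [simp]: "pm b * pm b = 1"
  by (simp add: pm_def)

lemma pm_Not [simp]: "pm (\<not> b) = - pm b"
  by (simp add: pm_def)

lemma abs_pm [simp]: "\<bar>pm b\<bar> = 1"
  by (simp add: pm_def)

lemma cube_upd: "x \<in> cube n \<Longrightarrow> i < n \<Longrightarrow> x(i := b) \<in> cube n"
  by (auto simp: cube_def)

lemma cube_upd_False: "x \<in> cube n \<Longrightarrow> x(i := False) \<in> cube n"
  by (auto simp: cube_def)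

lemma cube_nonempty: "cube n \<noteq> {}"
  by (auto simp: cube_def)

lemma cube_avg_cong: "(\<And>x. x \<in> cube n \<Longrightarrow> g x = h x) \<Longrightarrow> cube_avg n g = cube_avg n h"
  by (simp add: cube_avg_def)

lemma cube_avg_mono: "(\<And>x. x \<in> cube n \<Longrightarrow> g x \<le> h x) \<Longrightarrow> cube_avg n g \<le> cube_avg n h"
  by (simp add: cube_avg_def divide_right_mono sum_mono)

lemma cube_avg_nonneg: "(\<And>x. x \<in> cube n \<Longrightarrow> 0 \<le> g x) \<Longrightarrow> 0 \<le> cube_avg n g"
  by (simp add: cube_avg_def sum_nonneg)

lemma cube_avg_const [simp]: "cube_avg n (\<lambda>_. c) = c"
  by (simp add: cube_avg_def card_cube)

lemma cube_avg_add: "cube_avg n (\<lambda>x. g x + h x) = cube_avg n g + cube_avg n h"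
  by (simp add: cube_avg_def sum.distrib add_divide_distrib)

lemma cube_avg_diff: "cube_avg n (\<lambda>x. g x - h x) = cube_avg n g - cube_avg n h"
  by (simp add: cube_avg_def sum_subtractf diff_divide_distrib)

lemma cube_avg_cmult: "cube_avg n (\<lambda>x. c * g x) = c * cube_avg n g"
  by (simp add: cube_avg_def sum_distrib_left)

lemma cube_avg_uminus: "cube_avg n (\<lambda>x. - g x) = - cube_avg n g"
  by (simp add: cube_avg_def sum_negf)

lemma cube_avg_sum: "cube_avg n (\<lambda>x. \<Sum>i\<in>I. g i x) = (\<Sum>i\<in>I. cube_avg n (g i))"
  unfolding cube_avg_def by (subst sum.swap) (simp add: sum_divide_distrib)

lemma integral_uniform: "(\<integral>x. g x \<partial>uniform n) = cube_avg n g"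
  unfolding uniform_def cube_avg_def
  by (subst integral_pmf_of_set) (auto simp: finite_cube cube_nonempty card_cube)

lemma norm2_eq: "norm2 n g = sqrt (cube_avg n (\<lambda>x. (g x)\<^sup>2))"
  by (simp add: norm2_def integral_uniform)

lemma cube_avg_flip:
  assumes "i < n"
  shows "cube_avg n (\<lambda>x. g (x(i := \<not> x i))) = cube_avg n g"
proof -
  have "(\<Sum>x\<in>cube n. g (x(i := \<not> x i))) = (\<Sum>x\<in>cube n. g x)"
    by (rule sum.reindex_bij_witness[of _ "\<lambda>x. x(i := \<not> x i)" "\<lambda>x. x(i := \<not> x i)"])
       (use assms in \<open>auto simp: cube_def\<close>)
  then show ?thesis by (simp add: cube_avg_def)
qed

text \<open>A point vanishes beyond the dimension, so \<open>cube n\<close> is literally the half of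
  \<open>cube (Suc n)\<close> where coordinate \<open>n\<close> is off. The induction on
  \<open>n\<close> in Bonami's inequality rests on this.\<close>

lemma cube_avg_Suc:
  "cube_avg (Suc n) g = cube_avg n (\<lambda>x. (g x + g (x(n := True))) / 2)"
proof -
  have eq: "cube (Suc n) = cube n \<union> (\<lambda>x. x(n := True)) ` cube n" (is "_ = _ \<union> ?h ` _")
  proof (intro set_eqI iffI)
    fix x assume x: "x \<in> cube (Suc n)"
    have *: "\<not> x i" if "i > n" for i using x that by (simp add: cube_def)
    show "x \<in> cube n \<union> ?h ` cube n"
    proof (cases "x n")
      case True
      have "x(n := False) \<in> cube n" using * by (simp add: cube_def)
      moreover have "x = ?h (x(n := False))" using True by (simp add: fun_upd_idem)
      ultimately show ?thesis by blast
    next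
      case False
      then have "x \<in> cube n" using * by (simp add: cube_def) (metis order_le_less)
      then show ?thesis by blast
    qed
  next
    fix x assume "x \<in> cube n \<union> ?h ` cube n"
    then show "x \<in> cube (Suc n)" by (auto simp: cube_def)
  qed
  have inj: "inj_on ?h (cube n)"
    by (rule inj_on_inverseI[where g = "\<lambda>x. x(n := False)"]) (simp add: cube_def fun_upd_idem)
  have "(\<Sum>x\<in>cube (Suc n). g x) = (\<Sum>x\<in>cube n. g x) + (\<Sum>x\<in>?h ` cube n. g x)"
    unfolding eq using finite_cube[of n] by (intro sum.union_disjoint) (auto simp: cube_def)
  also have "\<dots> = (\<Sum>x\<in>cube n. g x + g (x(n := True)))"
    by (subst sum.reindex[OF inj]) (simp add: sum.distrib)
  finally show ?thesis
    by (simp add: cube_avg_def sum_divide_distrib[symmetric] field_simps)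
qed

lemma cube_avg_Cauchy_Schwarz:
  "(cube_avg n (\<lambda>x. g x * h x))\<^sup>2 \<le> cube_avg n (\<lambda>x. (g x)\<^sup>2) * cube_avg n (\<lambda>x. (h x)\<^sup>2)"
  using Cauchy_Schwarz_ineq_sum[of g h "cube n"]
  by (simp add: cube_avg_def power_divide divide_right_mono power2_eq_square)

section \<open>Characters, Parseval and inversion\<close>

lemma abs_character [simp]: "\<bar>character S x\<bar> = 1"
  by (simp add: character_def abs_prod)

lemma character_empty [simp]: "character {} x = 1"
  by (simp add: character_def)

lemma character_insert: "finite S \<Longrightarrow> i \<notin> S \<Longrightarrow> character (insert i S) x = pm (x i) * character S x"
  by (simp add: character_def)

lemma character_self [simp]: "character S x * character S x = 1"
  by (metis abs_character abs_mult_self_eq mult_1)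

lemma character_upd_notin: "i \<notin> S \<Longrightarrow> character S (x(i := b)) = character S x"
  unfolding character_def by (rule prod.cong) auto

lemma character_remove: "finite S \<Longrightarrow> i \<in> S \<Longrightarrow> character S x = pm (x i) * character (S - {i}) x"
  unfolding character_def by (rule prod.remove)

lemma character_mult:
  assumes "finite S" "finite T"
  shows "character S x * character T x = character ((S - T) \<union> (T - S)) x"
proof -
  have "character S x = character (S - T) x * character (S \<inter> T) x"
    unfolding character_def
    by (subst prod.union_disjoint[symmetric]) (use assms in \<open>auto intro!: prod.cong\<close>)
  moreover have "character T x = character (T - S) x * character (S \<inter> T) x"
    unfolding character_def
    by (subst prod.union_disjoint[symmetric]) (use assms in \<open>auto intro!: prod.cong\<close>)
  moreover have "character ((S - T) \<union> (T - S)) x = character (S - T) x * character (T - S) x"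
    unfolding character_def
    by (subst prod.union_disjoint[symmetric]) (use assms in \<open>auto intro!: prod.cong\<close>)
  ultimately show ?thesis
    by (metis (no_types, lifting) character_self mult.assoc mult.commute mult_1)
qed

lemma cube_avg_character:
  assumes "S \<subseteq> {..<n}"
  shows "cube_avg n (character S) = of_bool (S = {})"
proof (cases "S = {}")
  case True
  then show ?thesis
    using cube_avg_cong[of n "character {}" "\<lambda>_. 1"] by simp
next
  case False
  then obtain i where i: "i \<in> S" by blast
  have fin: "finite S" using assms finite_subset by blast
  have "cube_avg n (character S) = cube_avg n (\<lambda>x. character S (x(i := \<not> x i)))"
    using i assms by (intro cube_avg_flip[symmetric]) auto
  also have "\<dots> = cube_avg n (\<lambda>x. - character S x)"
    using i fin by (intro cube_avg_cong) (simp add: character_remove[of S i] character_upd_notin)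
  also have "\<dots> = - cube_avg n (character S)"
    by (rule cube_avg_uminus)
  finally show ?thesis using False by simp
qed

lemma cube_avg_character_mult:
  assumes "S \<subseteq> {..<n}" "T \<subseteq> {..<n}"
  shows "cube_avg n (\<lambda>x. character S x * character T x) = of_bool (S = T)"
proof -
  have "finite S" "finite T" using assms finite_subset by blast+
  then have "cube_avg n (\<lambda>x. character S x * character T x) =
      cube_avg n (character ((S - T) \<union> (T - S)))"
    by (intro cube_avg_cong) (simp add: character_mult)
  also have "\<dots> = of_bool ((S - T) \<union> (T - S) = {})"
    using assms by (intro cube_avg_character) auto
  also have "((S - T) \<union> (T - S) = {}) = (S = T)" by auto
  finally show ?thesis .
qed

text \<open>The sum over all \<open>S\<close> factors over the coordinates, and a coordinate where
  \<open>x\<close> and \<open>y\<close> differ contributes the factor 0. Inversion follows from this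
  dual orthogonality directly, without a dimension count.\<close>

lemma sum_character_mult:
  assumes "x \<in> cube n" "y \<in> cube n"
  shows "(\<Sum>S\<in>Pow {..<n}. character S x * character S y) = (if x = y then 2 ^ n else 0)"
proof -
  have "(\<Sum>S\<in>Pow A. character S x * character S y) = (\<Prod>i\<in>A. 1 + pm (x i) * pm (y i))"
    if "finite A" for A
    using that
  proof induction
    case (insert a A)
    have inj: "inj_on (insert a) (Pow A)"
      using insert by (intro inj_on_inverseI[where g = "\<lambda>S. S - {a}"]) auto
    have "(\<Sum>S\<in>Pow (insert a A). character S x * character S y) =
        (\<Sum>S\<in>Pow A. character S x * character S y) +
        (\<Sum>S\<in>insert a ` Pow A. character S x * character S y)"
      unfolding Pow_insert using insert by (intro sum.union_disjoint) auto
    also have "(\<Sum>S\<in>insert a ` Pow A. character S x * character S y) =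
        (\<Sum>S\<in>Pow A. (pm (x a) * pm (y a)) * (character S x * character S y))"
    proof (subst sum.reindex[OF inj], rule sum.cong)
      fix S assume "S \<in> Pow A"
      then have "finite S" "a \<notin> S" using insert finite_subset by auto
      then show "((\<lambda>S. character S x * character S y) \<circ> insert a) S =
          (pm (x a) * pm (y a)) * (character S x * character S y)"
        by (simp add: character_insert)
    qed simp
    finally show ?case
      using insert by (simp add: sum_distrib_left[symmetric] distrib_right del: mult_minus_left)
  qed simp
  then have eq: "(\<Sum>S\<in>Pow {..<n}. character S x * character S y) =
      (\<Prod>i<n. 1 + pm (x i) * pm (y i))" by simp
  show ?thesis
  proof (cases "x = y")
    case True
    then show ?thesis unfolding eq by simp
  next
    case False
    then obtain i where i: "x i \<noteq> y i" by auto
    then have "i < n" using assms by (auto simp: cube_def not_le[symmetric])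
    moreover have "1 + pm (x i) * pm (y i) = 0" using i by (cases "x i") (auto simp: pm_def)
    ultimately show ?thesis using False unfolding eq by (auto intro!: prod_zero)
  qed
qed

lemma fourier_inversion:
  assumes "x \<in> cube n"
  shows "f x = (\<Sum>S\<in>Pow {..<n}. fourier n f S * character S x)"
proof -
  have "(\<Sum>S\<in>Pow {..<n}. fourier n f S * character S x) =
      (\<Sum>S\<in>Pow {..<n}. \<Sum>y\<in>cube n. f y * (character S y * character S x)) / 2 ^ n"
    by (simp add: fourier_def cube_avg_def sum_divide_distrib sum_distrib_right mult.assoc)
  also have "\<dots> = (\<Sum>y\<in>cube n. f y * (\<Sum>S\<in>Pow {..<n}. character S y * character S x)) / 2 ^ n"
    by (subst sum.swap) (simp add: sum_distrib_left)
  also have "\<dots> = (\<Sum>y\<in>cube n. if y = x then f x * 2 ^ n else 0) / 2 ^ n"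
    using assms by (intro arg_cong2[of _ _ _ _ "(/)"] sum.cong refl) (simp add: sum_character_mult)
  finally show ?thesis
    using assms by (simp add: finite_cube)
qed

lemma cube_avg_square_characters:
  assumes "F \<subseteq> Pow {..<n}"
  shows "cube_avg n (\<lambda>x. (\<Sum>S\<in>F. c S * character S x)\<^sup>2) = (\<Sum>S\<in>F. (c S)\<^sup>2)"
proof -
  have fin: "finite F" using assms finite_subset by blast
  have "cube_avg n (\<lambda>x. (\<Sum>S\<in>F. c S * character S x)\<^sup>2) =
      cube_avg n (\<lambda>x. \<Sum>S\<in>F. \<Sum>T\<in>F. (c S * c T) * (character S x * character T x))"
    by (intro cube_avg_cong) (simp add: power2_eq_square sum_product algebra_simps)
  also have "\<dots> = (\<Sum>S\<in>F. \<Sum>T\<in>F. (c S * c T) * of_bool (S = T))"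
    unfolding cube_avg_sum cube_avg_cmult
    using assms by (intro sum.cong refl) (subst cube_avg_character_mult, auto)
  also have "\<dots> = (\<Sum>S\<in>F. (c S)\<^sup>2)"
    using fin by (simp add: of_bool_def power2_eq_square if_distrib[of "\<lambda>u. _ * u"] cong: if_cong)
  finally show ?thesis .
qed

text \<open>Parseval for \<open>f\<close> minus its approximation: inside \<open>F\<close> only
  errors in the coefficients count, outside \<open>F\<close> all weight is lost. The final error
  analysis starts from this identity.\<close>

lemma cube_avg_square_error:
  assumes "F \<subseteq> Pow {..<n}"
  shows "cube_avg n (\<lambda>x. (f x - (\<Sum>S\<in>F. c S * character S x))\<^sup>2) =
    (\<Sum>S\<in>F. (c S - fourier n f S)\<^sup>2) + (\<Sum>S\<in>Pow {..<n} - F. (fourier n f S)\<^sup>2)"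
proof -
  define b where "b S = fourier n f S - (if S \<in> F then c S else 0)" for S
  have eq: "f x - (\<Sum>S\<in>F. c S * character S x) = (\<Sum>S\<in>Pow {..<n}. b S * character S x)"
    if "x \<in> cube n" for x
  proof -
    have "(\<Sum>S\<in>F. c S * character S x) =
        (\<Sum>S\<in>Pow {..<n}. (if S \<in> F then c S else 0) * character S x)"
      using assms by (intro sum.mono_neutral_cong_left) auto
    then show ?thesis
      by (simp add: b_def left_diff_distrib sum_subtractf fourier_inversion[OF that, symmetric])
  qed
  have "cube_avg n (\<lambda>x. (f x - (\<Sum>S\<in>F. c S * character S x))\<^sup>2) =
      cube_avg n (\<lambda>x. (\<Sum>S\<in>Pow {..<n}. b S * character S x)\<^sup>2)"
    by (intro cube_avg_cong) (simp add: eq)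
  also have "\<dots> = (\<Sum>S\<in>Pow {..<n}. (b S)\<^sup>2)"
    by (rule cube_avg_square_characters) simp
  also have "\<dots> = (\<Sum>S\<in>F. (b S)\<^sup>2) + (\<Sum>S\<in>Pow {..<n} - F. (b S)\<^sup>2)"
    using assms by (simp add: sum.subset_diff[of F])
  also have "(\<Sum>S\<in>F. (b S)\<^sup>2) = (\<Sum>S\<in>F. (c S - fourier n f S)\<^sup>2)"
    by (intro sum.cong refl) (simp add: b_def power2_commute)
  also have "(\<Sum>S\<in>Pow {..<n} - F. (b S)\<^sup>2) = (\<Sum>S\<in>Pow {..<n} - F. (fourier n f S)\<^sup>2)"
    by (intro sum.cong refl) (simp add: b_def)
  finally show ?thesis .
qed

section \<open>Derivatives and the number operator\<close>

lemma discrete_derivative: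
  assumes "x \<in> cube n" "i < n"
  shows "(f (x(i := True)) - f (x(i := False))) / 2 =
    (\<Sum>S | S \<subseteq> {..<n} \<and> i \<in> S. fourier n f S * character (S - {i}) x)"
proof -
  have "f (x(i := True)) - f (x(i := False)) = (\<Sum>S\<in>Pow {..<n}.
      fourier n f S * (character S (x(i := True)) - character S (x(i := False))))"
    using assms by (simp add: fourier_inversion[of _ n f, OF cube_upd] right_diff_distrib sum_subtractf)
  also have "\<dots> = (\<Sum>S | S \<subseteq> {..<n} \<and> i \<in> S. 2 * (fourier n f S * character (S - {i}) x))"
  proof (rule sum.mono_neutral_cong_right)
    fix S assume S: "S \<in> {S. S \<subseteq> {..<n} \<and> i \<in> S}"
    then have "finite S" using finite_subset by auto
    then show "fourier n f S * (character S (x(i := True)) - character S (x(i := False))) =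
        2 * (fourier n f S * character (S - {i}) x)"
      using S by (simp add: character_remove[of S i] character_upd_notin pm_def)
  qed (auto simp: character_upd_notin)
  finally show ?thesis by (simp add: sum_distrib_left[symmetric])
qed

text \<open>Differentiating in direction \<open>i\<close> and multiplying the sign of
  \<open>x i\<close> back in keeps exactly the characters that contain \<open>i\<close>. Summed over
  \<open>i\<close>, each \<open>S\<close> is counted \<open>card S\<close> times, so the second
  moment of the left side is the Fourier weight with factor |S|^2.\<close>

lemma number_operator:
  assumes "x \<in> cube n"
  shows "(\<Sum>i<n. pm (x i) * ((f (x(i := True)) - f (x(i := False))) / 2)) =
    (\<Sum>S\<in>Pow {..<n}. (real (card S) * fourier n f S) * character S x)"
proof -
  have "(\<Sum>i<n. pm (x i) * ((f (x(i := True)) - f (x(i := False))) / 2)) =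
      (\<Sum>i<n. \<Sum>S | S \<subseteq> {..<n} \<and> i \<in> S. fourier n f S * character S x)"
  proof (rule sum.cong)
    fix i assume i: "i \<in> {..<n}"
    have "pm (x i) * ((f (x(i := True)) - f (x(i := False))) / 2) =
        (\<Sum>S | S \<subseteq> {..<n} \<and> i \<in> S. pm (x i) * (fourier n f S * character (S - {i}) x))"
      using i assms by (simp add: discrete_derivative sum_distrib_left)
    also have "\<dots> = (\<Sum>S | S \<subseteq> {..<n} \<and> i \<in> S. fourier n f S * character S x)"
    proof (rule sum.cong)
      fix S assume "S \<in> {S. S \<subseteq> {..<n} \<and> i \<in> S}"
      then have "finite S" "i \<in> S" using finite_subset by auto
      then show "pm (x i) * (fourier n f S * character (S - {i}) x) = fourier n f S * character S x"
        by (simp add: character_remove[of S i])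
    qed simp
    finally show "pm (x i) * ((f (x(i := True)) - f (x(i := False))) / 2) =
        (\<Sum>S | S \<subseteq> {..<n} \<and> i \<in> S. fourier n f S * character S x)" .
  qed simp
  also have "\<dots> = (\<Sum>i<n. \<Sum>S\<in>Pow {..<n}. if i \<in> S then fourier n f S * character S x else 0)"
    by (intro sum.cong refl sum.mono_neutral_cong_left) auto
  also have "\<dots> = (\<Sum>S\<in>Pow {..<n}. \<Sum>i<n. if i \<in> S then fourier n f S * character S x else 0)"
    by (rule sum.swap)
  also have "\<dots> = (\<Sum>S\<in>Pow {..<n}. (real (card S) * fourier n f S) * character S x)"
  proof (rule sum.cong)
    fix S assume "S \<in> Pow {..<n}"
    then have "{..<n} \<inter> S = S" by auto
    then show "(\<Sum>i<n. if i \<in> S then fourier n f S * character S x else 0) =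
        (real (card S) * fourier n f S) * character S x"
      by (simp add: sum.inter_restrict[symmetric])
  qed simp
  finally show ?thesis .
qed

section \<open>Hypercontractivity\<close>

lemma subsets_card_insert:
  assumes "finite A" "a \<notin> A"
  shows "{S. S \<subseteq> insert a A \<and> card S \<le> d} =
    {S. S \<subseteq> A \<and> card S \<le> d} \<union> insert a ` {S. S \<subseteq> A \<and> card S < d}"
proof (intro set_eqI iffI)
  fix S assume S: "S \<in> {S. S \<subseteq> insert a A \<and> card S \<le> d}"
  then have fin: "finite S" using assms finite_subset by auto
  show "S \<in> {S. S \<subseteq> A \<and> card S \<le> d} \<union> insert a ` {S. S \<subseteq> A \<and> card S < d}"
  proof (cases "a \<in> S")
    case True
    then have "S = insert a (S - {a})" by auto
    moreover have "S - {a} \<subseteq> A" using S by auto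
    moreover have "card (S - {a}) < d"
      using True fin S card_Diff1_less[of S a] by (auto simp del: card_Diff_insert)
    ultimately show ?thesis by blast
  qed (use S in auto)
next
  fix S assume "S \<in> {S. S \<subseteq> A \<and> card S \<le> d} \<union> insert a ` {S. S \<subseteq> A \<and> card S < d}"
  then show "S \<in> {S. S \<subseteq> insert a A \<and> card S \<le> d}"
  proof
    assume "S \<in> insert a ` {S. S \<subseteq> A \<and> card S < d}"
    then obtain T where "S = insert a T" "T \<subseteq> A" "card T < d" by auto
    then show ?thesis using card_insert_le_m1[of d T a] by auto
  qed auto
qed

text \<open>Split off the last variable: the polynomial is \<open>a\<close> plus a sign times
  \<open>b\<close>, where \<open>b\<close> has degree below \<open>d\<close>. Averaging over the
  sign kills the odd terms of the fourth power; Cauchy-Schwarz and the induction hypothesis at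
  \<open>d\<close> and \<open>d - 1\<close> bound the mixed term.\<close>

lemma Bonami:
  "cube_avg n (\<lambda>x. (\<Sum>S | S \<subseteq> {..<n} \<and> card S \<le> d. c S * character S x) ^ 4) \<le>
    9 ^ d * (\<Sum>S | S \<subseteq> {..<n} \<and> card S \<le> d. (c S)\<^sup>2)\<^sup>2"
proof (induction n arbitrary: c d)
  case 0
  have "{S. S \<subseteq> {} \<and> card S \<le> d} = {{}::nat set}" by auto
  moreover have "(c {})^4 \<le> 9 ^ d * ((c {})\<^sup>2)\<^sup>2"
    using mult_right_mono[of 1 "9^d" "(c {})^4"] by (simp flip: power_mult)
  ultimately show ?case by simp
next
  case (Suc n)
  have split: "(\<Sum>S | S \<subseteq> {..<Suc n} \<and> card S \<le> d. h S) =
     (\<Sum>S | S \<subseteq> {..<n} \<and> card S \<le> d. h S) +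
     (\<Sum>S | S \<subseteq> {..<n} \<and> card S < d. h (insert n S))" for h :: "nat set \<Rightarrow> real"
  proof -
    have inj: "inj_on (insert n) {S. S \<subseteq> {..<n} \<and> card S < d}"
      by (rule inj_on_inverseI[where g = "\<lambda>S. S - {n}"]) auto
    have "{S. S \<subseteq> {..<Suc n} \<and> card S \<le> d} =
        {S. S \<subseteq> {..<n} \<and> card S \<le> d} \<union> insert n ` {S. S \<subseteq> {..<n} \<and> card S < d}"
      unfolding lessThan_Suc by (rule subsets_card_insert) auto
    then have "(\<Sum>S | S \<subseteq> {..<Suc n} \<and> card S \<le> d. h S) =
        (\<Sum>S | S \<subseteq> {..<n} \<and> card S \<le> d. h S) +
        (\<Sum>S\<in>insert n ` {S. S \<subseteq> {..<n} \<and> card S < d}. h S)"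
      by (simp, intro sum.union_disjoint) auto
    then show ?thesis by (simp add: sum.reindex[OF inj])
  qed
  define a where "a x = (\<Sum>S | S \<subseteq> {..<n} \<and> card S \<le> d. c S * character S x)" for x
  define b where "b x = (\<Sum>S | S \<subseteq> {..<n} \<and> card S < d. c (insert n S) * character S x)" for x
  define A where "A = (\<Sum>S | S \<subseteq> {..<n} \<and> card S \<le> d. (c S)\<^sup>2)"
  define B where "B = (\<Sum>S | S \<subseteq> {..<n} \<and> card S < d. (c (insert n S))\<^sup>2)"
  have AB: "A \<ge> 0" "B \<ge> 0" by (auto simp: A_def B_def sum_nonneg)
  have g: "(\<Sum>S | S \<subseteq> {..<Suc n} \<and> card S \<le> d. c S * character S (x(n := v))) = a x + pm v * b x"
    for x v
  proof -
    have 1: "(\<Sum>S | S \<subseteq> {..<n} \<and> card S \<le> d. c S * character S (x(n := v))) = a x"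
      unfolding a_def by (intro sum.cong refl) (subst character_upd_notin, auto)
    have 2: "(\<Sum>S | S \<subseteq> {..<n} \<and> card S < d. c (insert n S) * character (insert n S) (x(n := v))) =
        pm v * b x"
      unfolding b_def sum_distrib_left
    proof (intro sum.cong refl)
      fix S assume "S \<in> {S. S \<subseteq> {..<n} \<and> card S < d}"
      then have "finite S" "n \<notin> S" using finite_subset by auto
      then show "c (insert n S) * character (insert n S) (x(n := v)) =
          pm v * (c (insert n S) * character S x)"
        by (simp add: character_insert character_upd_notin)
    qed
    show ?thesis unfolding split 1 2 ..
  qed
  have "cube_avg (Suc n) (\<lambda>x. (\<Sum>S | S \<subseteq> {..<Suc n} \<and> card S \<le> d. c S * character S x) ^ 4) =
      cube_avg n (\<lambda>x. ((a x - b x) ^ 4 + (a x + b x) ^ 4) / 2)"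
    unfolding cube_avg_Suc
  proof (intro cube_avg_cong)
    fix x assume "x \<in> cube n"
    then have "x = x(n := False)" by (simp add: cube_def fun_upd_idem)
    then show "((\<Sum>S | S \<subseteq> {..<Suc n} \<and> card S \<le> d. c S * character S x) ^ 4 +
       (\<Sum>S | S \<subseteq> {..<Suc n} \<and> card S \<le> d. c S * character S (x(n := True))) ^ 4) / 2 =
       ((a x - b x) ^ 4 + (a x + b x) ^ 4) / 2"
      using g[of x False] g[of x True] by (simp add: pm_def)
  qed
  also have "\<dots> = cube_avg n (\<lambda>x. a x ^ 4 + (6 * ((a x)\<^sup>2 * (b x)\<^sup>2) + b x ^ 4))"
    by (intro cube_avg_cong) (simp add: power4_eq_xxxx power2_eq_square, algebra)
  also have "\<dots> = cube_avg n (\<lambda>x. a x ^ 4) +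
      (6 * cube_avg n (\<lambda>x. (a x)\<^sup>2 * (b x)\<^sup>2) + cube_avg n (\<lambda>x. b x ^ 4))"
    by (simp only: cube_avg_add cube_avg_cmult)
  also have "\<dots> \<le> 9 ^ d * (A + B)\<^sup>2"
  proof -
    have a4: "cube_avg n (\<lambda>x. a x ^ 4) \<le> 9 ^ d * A\<^sup>2"
      unfolding a_def A_def by (rule Suc.IH)
    show ?thesis
    proof (cases d)
      case 0
      then have "b x = 0" for x by (simp add: b_def)
      then show ?thesis using a4 0 AB by (simp add: B_def)
    next
      case (Suc e)
      have b4: "cube_avg n (\<lambda>x. b x ^ 4) \<le> 9 ^ e * B\<^sup>2"
        using Suc.IH[of "\<lambda>S. c (insert n S)" e]
        unfolding b_def B_def Suc less_Suc_eq_le .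
      have "(cube_avg n (\<lambda>x. (a x)\<^sup>2 * (b x)\<^sup>2))\<^sup>2 \<le>
          cube_avg n (\<lambda>x. a x ^ 4) * cube_avg n (\<lambda>x. b x ^ 4)"
        using cube_avg_Cauchy_Schwarz[of n "\<lambda>x. (a x)\<^sup>2" "\<lambda>x. (b x)\<^sup>2"] by (simp flip: power_mult)
      also have "\<dots> \<le> (9 ^ d * A\<^sup>2) * (9 ^ e * B\<^sup>2)"
        using a4 b4 by (intro mult_mono) (auto intro!: cube_avg_nonneg)
      also have "\<dots> = (3 * 9 ^ e * (A * B))\<^sup>2"
        by (simp add: Suc power_mult_distrib power2_eq_square[of "9^e"])
      finally have ab: "cube_avg n (\<lambda>x. (a x)\<^sup>2 * (b x)\<^sup>2) \<le> 3 * 9 ^ e * (A * B)"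
        by (rule power2_le_imp_le) (use AB in simp)
      \<comment> \<open>Six times the bound \<open>ab\<close> exhausts the cross term
        \<open>18 * 9 ^ e * (A * B)\<close> exactly; the base 9 is what makes this balance.\<close>
      have "9 ^ d * (A + B)\<^sup>2 = 9 ^ d * A\<^sup>2 + 18 * 9 ^ e * (A * B) + 9 * (9 ^ e * B\<^sup>2)"
        unfolding Suc power_Suc power2_sum by (simp add: field_simps power2_eq_square)
      moreover have "0 \<le> 9 ^ e * B\<^sup>2" by simp
      ultimately show ?thesis using a4 b4 ab by linarith
    qed
  qed
  finally show ?case unfolding split A_def B_def .
qed

text \<open>With \<open>p\<close> the low-degree part of \<open>g\<close>, the weight
  \<open>W\<close> is the mean of g p. Two Cauchy-Schwarz steps (in effect Hoelder with exponents
  4/3 and 4) and Bonami give W^2 <= 3^d a^(3/2) W. The gain over the trivial bound \<open>a\<close>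
  is the factor sqrt a, which is small for a coordinate of small influence.\<close>

lemma low_degree_hypercontractive:
  assumes bound: "\<And>x. x \<in> cube n \<Longrightarrow> \<bar>g x\<bar> \<le> 1"
  shows "(\<Sum>S | S \<subseteq> {..<n} \<and> card S \<le> d. (fourier n g S)\<^sup>2) \<le>
    3 ^ d * cube_avg n (\<lambda>x. \<bar>g x\<bar>) * sqrt (cube_avg n (\<lambda>x. \<bar>g x\<bar>))"
proof -
  define F where "F = {S. S \<subseteq> {..<n} \<and> card S \<le> d}"
  define p where "p x = (\<Sum>S\<in>F. fourier n g S * character S x)" for x
  define W where "W = (\<Sum>S\<in>F. (fourier n g S)\<^sup>2)"
  define a where "a = cube_avg n (\<lambda>x. \<bar>g x\<bar>)"
  have nn: "W \<ge> 0" "a \<ge> 0" by (auto simp: W_def a_def sum_nonneg intro: cube_avg_nonneg)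
  have p4: "cube_avg n (\<lambda>x. p x ^ 4) \<le> 9 ^ d * W\<^sup>2"
    unfolding p_def W_def F_def by (rule Bonami)
  have W: "W = cube_avg n (\<lambda>x. g x * p x)"
  proof -
    have "cube_avg n (\<lambda>x. g x * p x) =
        cube_avg n (\<lambda>x. \<Sum>S\<in>F. fourier n g S * (g x * character S x))"
      by (intro cube_avg_cong) (simp add: p_def sum_distrib_left algebra_simps)
    also have "\<dots> = W"
      by (simp add: cube_avg_sum cube_avg_cmult W_def power2_eq_square fourier_def)
    finally show ?thesis by simp
  qed
  have gg: "cube_avg n (\<lambda>x. (g x)\<^sup>2) \<le> a"
    unfolding a_def
  proof (rule cube_avg_mono)
    fix x assume "x \<in> cube n"
    then have "\<bar>g x\<bar> * \<bar>g x\<bar> \<le> \<bar>g x\<bar> * 1" using bound by (intro mult_left_mono) auto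
    then show "(g x)\<^sup>2 \<le> \<bar>g x\<bar>" by (simp add: power2_eq_square abs_mult_self_eq)
  qed
  define q where "q = cube_avg n (\<lambda>x. \<bar>g x\<bar> * (p x)\<^sup>2)"
  have q0: "q \<ge> 0" unfolding q_def by (intro cube_avg_nonneg) auto
  have q2: "q\<^sup>2 \<le> a * (9 ^ d * W\<^sup>2)"
  proof -
    have "q\<^sup>2 \<le> cube_avg n (\<lambda>x. (g x)\<^sup>2) * cube_avg n (\<lambda>x. p x ^ 4)"
      using cube_avg_Cauchy_Schwarz[of n "\<lambda>x. \<bar>g x\<bar>" "\<lambda>x. (p x)\<^sup>2"]
      unfolding q_def by (simp flip: power_mult)
    also have "\<dots> \<le> a * (9 ^ d * W\<^sup>2)"
      using gg p4 nn by (intro mult_mono) (auto intro!: cube_avg_nonneg)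
    finally show ?thesis .
  qed
  have "W\<^sup>2 \<le> a * q"
  proof -
    have "cube_avg n (\<lambda>x. g x * p x) \<le> cube_avg n (\<lambda>x. sqrt \<bar>g x\<bar> * (sqrt \<bar>g x\<bar> * \<bar>p x\<bar>))"
      by (intro cube_avg_mono) (simp add: mult.assoc[symmetric] abs_mult[symmetric])
    then have "W\<^sup>2 \<le> (cube_avg n (\<lambda>x. sqrt \<bar>g x\<bar> * (sqrt \<bar>g x\<bar> * \<bar>p x\<bar>)))\<^sup>2"
      using nn W by (intro power_mono) auto
    also have "\<dots> \<le> a * q"
      using cube_avg_Cauchy_Schwarz[of n "\<lambda>x. sqrt \<bar>g x\<bar>" "\<lambda>x. sqrt \<bar>g x\<bar> * \<bar>p x\<bar>"]
      by (simp add: a_def q_def power_mult_distrib)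
    finally show ?thesis .
  qed
  also have "a * q \<le> a * (sqrt a * 3 ^ d * W)"
  proof (rule mult_left_mono)
    have "(sqrt a * 3 ^ d * W)\<^sup>2 = a * (9 ^ d * W\<^sup>2)"
      using nn by (simp add: power_mult_distrib power_even_eq[symmetric]) (simp add: power_mult)
    with q2 have "q\<^sup>2 \<le> (sqrt a * 3 ^ d * W)\<^sup>2" by (simp only:)
    then show "q \<le> sqrt a * 3 ^ d * W"
      by (rule power2_le_imp_le) (use nn in simp)
  qed (use nn in auto)
  finally have *: "W * W \<le> W * (3 ^ d * a * sqrt a)" by (simp only: power2_eq_square ac_simps)
  have "W \<le> 3 ^ d * a * sqrt a"
  proof (cases "W = 0")
    case False
    then show ?thesis using mult_left_le_imp_le[OF *] nn by simp
  qed (use nn in auto)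
  then show ?thesis by (simp add: W_def F_def a_def)
qed

section \<open>Spectral concentration of XOS functions\<close>

definition marginal :: "(point \<Rightarrow> real) \<Rightarrow> nat \<Rightarrow> point \<Rightarrow> real" where
  "marginal f i x = f (x(i := True)) - f (x(i := False))"

lemma marginal_upd [simp]: "marginal f i (x(i := b)) = marginal f i x"
  by (simp add: marginal_def)

lemma marginal_upd_upd [simp]: "marginal f i (x(i := b, j := c)) = marginal f i (x(j := c))"
  by (cases "i = j") (simp_all add: marginal_def fun_upd_twist[of i j])

text \<open>This moves an average from the points with bit \<open>i\<close> off to those one step
  above. Upward marginals are compared with a certificate at the upper point in this way.\<close>

lemma cube_avg_of_bool_not:
  assumes "i < n" "\<And>x b. x \<in> cube n \<Longrightarrow> h (x(i := b)) = h x"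
  shows "cube_avg n (\<lambda>x. of_bool (\<not> x i) * h x) = cube_avg n (\<lambda>x. of_bool (x i) * h x)"
proof -
  have "cube_avg n (\<lambda>x. of_bool (\<not> x i) * h x) =
      cube_avg n (\<lambda>x. of_bool (\<not> (x(i := \<not> x i)) i) * h (x(i := \<not> x i)))"
    using assms(1) by (rule cube_avg_flip[symmetric])
  also have "\<dots> = cube_avg n (\<lambda>x. of_bool (x i) * h x)"
    by (intro cube_avg_cong) (simp add: assms(2))
  finally show ?thesis .
qed

text \<open>Adding the values at \<open>x\<close> and at \<open>x\<close> with bit \<open>i\<close>
  flipped leaves the marginal times \<open>h\<close>, since the two signs are opposite.\<close>

lemma cube_avg_pm_mult:
  assumes i: "i < n" and h: "\<And>x b. x \<in> cube n \<Longrightarrow> h (x(i := b)) = h x"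
  shows "cube_avg n (\<lambda>x. f x * (pm (x i) * h x)) = cube_avg n (\<lambda>x. marginal f i x / 2 * h x)"
proof -
  let ?g = "\<lambda>x. f x * (pm (x i) * h x)"
  have "2 * cube_avg n ?g = cube_avg n ?g + cube_avg n (\<lambda>x. ?g (x(i := \<not> x i)))"
    using cube_avg_flip[OF i, of ?g] by simp
  also have "\<dots> = cube_avg n (\<lambda>x. 2 * (marginal f i x / 2 * h x))"
    unfolding cube_avg_add[symmetric]
  proof (rule cube_avg_cong)
    fix x assume "x \<in> cube n"
    then show "?g x + ?g (x(i := \<not> x i)) = 2 * (marginal f i x / 2 * h x)"
      by (cases "x i") (simp_all add: h marginal_def pm_def fun_upd_idem algebra_simps)
  qed
  also have "\<dots> = 2 * cube_avg n (\<lambda>x. marginal f i x / 2 * h x)"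
    by (rule cube_avg_cmult)
  finally show ?thesis by simp
qed

lemma fourier_marginal:
  assumes "i < n" "finite S" "i \<notin> S"
  shows "fourier n (\<lambda>x. marginal f i x / 2) S = fourier n f (insert i S)"
  using cube_avg_pm_mult[of i n "character S" f] assms
  by (simp add: fourier_def character_insert character_upd_notin)

lemma fourier_singleton:
  assumes "i < n"
  shows "fourier n f {i} = cube_avg n (\<lambda>x. marginal f i x / 2)"
  using fourier_marginal[of i n "{}" f] assms by (simp add: fourier_def)

text \<open>The form with \<open>of_bool (x i)\<close> sees only downward marginals, which
  self-boundedness controls pointwise.\<close>

lemma fourier_singleton_of_bool:
  assumes "i < n"
  shows "fourier n f {i} = cube_avg n (\<lambda>x. of_bool (x i) * marginal f i x)"
proof -
  let ?T = "cube_avg n (\<lambda>x. of_bool (x i) * marginal f i x)"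
  let ?F = "cube_avg n (\<lambda>x. of_bool (\<not> x i) * marginal f i x)"
  have "2 * fourier n f {i} = cube_avg n (marginal f i)"
    using assms by (simp add: fourier_singleton cube_avg_cmult[symmetric])
  also have "\<dots> = ?T + ?F"
    unfolding cube_avg_add[symmetric] by (intro cube_avg_cong) (simp add: of_bool_def)
  also have "?F = ?T"
    using assms by (intro cube_avg_of_bool_not) auto
  finally show ?thesis by simp
qed

text \<open>A maximizing clause at \<open>x\<close> is a linear minorant of \<open>f\<close> that is tight at \<open>x\<close>.\<close>

lemma XOS_certificate:
  assumes "XOS n f" "x \<in> cube n"
  obtains v where "\<And>i. i < n \<Longrightarrow> 0 \<le> v i" "f x = (\<Sum>i<n. v i * of_bool (x i))"
    "\<And>y. y \<in> cube n \<Longrightarrow> (\<Sum>i<n. v i * of_bool (y i)) \<le> f y"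
proof -
  obtain K w where Kw: "finite (K::nat set)" "K \<noteq> {}" "\<forall>c\<in>K. \<forall>i<n. 0 \<le> w c i"
    "\<forall>x\<in>cube n. f x = (MAX c\<in>K. \<Sum>i<n. w c i * of_bool (x i))"
    using assms(1) unfolding XOS_def by blast
  have "f x \<in> (\<lambda>c. \<Sum>i<n. w c i * of_bool (x i)) ` K"
    using Kw assms(2) by (auto intro!: Max_in)
  then obtain c where c: "c \<in> K" "f x = (\<Sum>i<n. w c i * of_bool (x i))" by auto
  show ?thesis
  proof
    show "0 \<le> w c i" if "i < n" for i using Kw c that by auto
    show "f x = (\<Sum>i<n. w c i * of_bool (x i))" by (rule c)
    show "(\<Sum>i<n. w c i * of_bool (y i)) \<le> f y" if "y \<in> cube n" for y
      using Kw c that by (auto intro!: Max_ge)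
  qed
qed

section \<open>Marginals of XOS functions\<close>

context
  fixes n :: nat and f :: "point \<Rightarrow> real"
  assumes XOS: "XOS n f" and range: "\<And>x. x \<in> cube n \<Longrightarrow> f x \<in> {0..1}"
begin

lemma XOS_mono:
  assumes "x \<in> cube n" "y \<in> cube n" "\<And>i. x i \<Longrightarrow> y i"
  shows "f x \<le> f y"
proof -
  obtain v where v: "\<And>i. i < n \<Longrightarrow> 0 \<le> v i" "f x = (\<Sum>i<n. v i * of_bool (x i))"
    "\<And>y. y \<in> cube n \<Longrightarrow> (\<Sum>i<n. v i * of_bool (y i)) \<le> f y"
    using XOS_certificate[OF XOS assms(1)] by metis
  have "f x \<le> (\<Sum>i<n. v i * of_bool (y i))"
    unfolding v(2) using assms(3) v(1) by (intro sum_mono mult_left_mono) (auto simp: of_bool_def)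
  also have "\<dots> \<le> f y" using assms(2) by (rule v(3))
  finally show ?thesis .
qed

lemma marginal_nonneg: "x \<in> cube n \<Longrightarrow> i < n \<Longrightarrow> 0 \<le> marginal f i x"
  unfolding marginal_def using XOS_mono[of "x(i := False)" "x(i := True)"]
  by (simp add: cube_upd)

lemma marginal_le_1: "x \<in> cube n \<Longrightarrow> i < n \<Longrightarrow> marginal f i x \<le> 1"
  unfolding marginal_def using range[of "x(i := False)"] range[of "x(i := True)"]
  by (simp add: cube_upd)

text \<open>The minorant is tight at \<open>x\<close> and stays below \<open>f\<close> at the
  smaller point \<open>y\<close>, so \<open>f\<close> loses no more than the minorant does.\<close>

lemma minorant_drop:
  assumes v: "f x = (\<Sum>i<n. v i * of_bool (x i))"
    "\<And>y. y \<in> cube n \<Longrightarrow> (\<Sum>i<n. v i * of_bool (y i)) \<le> f y"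
    and x: "x \<in> cube n" and I: "I \<subseteq> {..<n}" "\<And>i. i \<in> I \<Longrightarrow> x i"
    and y: "y = (\<lambda>i. x i \<and> i \<notin> I)"
  shows "f x - f y \<le> (\<Sum>i\<in>I. v i)"
proof -
  have "y \<in> cube n" using x y by (auto simp: cube_def)
  then have "f x - f y \<le> (\<Sum>i<n. v i * of_bool (x i)) - (\<Sum>i<n. v i * of_bool (y i))"
    using v by simp
  also have "\<dots> = (\<Sum>i<n. if i \<in> I then v i else 0)"
    unfolding sum_subtractf[symmetric] using I(2) by (intro sum.cong) (auto simp: y)
  also have "\<dots> = (\<Sum>i\<in>I. v i)"
    using I(1) by (simp add: sum.inter_restrict[symmetric] Int_absorb1)
  finally show ?thesis .
qed

text \<open>Switching off a set bit costs at most its weight in a clause that is maximal at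
  \<open>x\<close>, and these weights add up to \<open>f x\<close>.\<close>

lemma self_bounding:
  assumes x: "x \<in> cube n"
  shows "(\<Sum>i<n. of_bool (x i) * marginal f i x) \<le> f x"
proof -
  obtain v where v: "\<And>i. i < n \<Longrightarrow> 0 \<le> v i" "f x = (\<Sum>i<n. v i * of_bool (x i))"
    "\<And>y. y \<in> cube n \<Longrightarrow> (\<Sum>i<n. v i * of_bool (y i)) \<le> f y"
    using XOS_certificate[OF XOS x] by metis
  have "(\<Sum>i<n. of_bool (x i) * marginal f i x) \<le> (\<Sum>i<n. v i * of_bool (x i))"
  proof (rule sum_mono)
    fix i assume i: "i \<in> {..<n}"
    show "of_bool (x i) * marginal f i x \<le> v i * of_bool (x i)"
    proof (cases "x i")
      case True
      then have "f x - f (x(i := False)) \<le> (\<Sum>j\<in>{i}. v j)"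
        using i True by (intro minorant_drop[OF v(2,3) x]) (auto simp: fun_eq_iff)
      then show ?thesis using True by (simp add: marginal_def fun_upd_idem)
    qed simp
  qed
  then show ?thesis by (simp add: v(2))
qed

lemma sum_fourier_singleton: "(\<Sum>i<n. fourier n f {i}) \<le> 1"
proof -
  have "(\<Sum>i<n. fourier n f {i}) = cube_avg n (\<lambda>x. \<Sum>i<n. of_bool (x i) * marginal f i x)"
    unfolding cube_avg_sum by (intro sum.cong refl fourier_singleton_of_bool) simp
  also have "\<dots> \<le> cube_avg n (\<lambda>_. 1)"
    using self_bounding range by (intro cube_avg_mono) (meson atLeastAtMost_iff order_trans)
  finally show ?thesis by simp
qed

lemma fourier_singleton_nonneg: "i < n \<Longrightarrow> 0 \<le> fourier n f {i}"
  by (simp add: fourier_singleton marginal_nonneg cube_avg_nonneg)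

text \<open>For \<open>z i\<close>, \<open>z j\<close> both marginals below are at most \<open>v i + v j\<close>, where \<open>v\<close> is a certificate
  at \<open>z\<close>; hence their product is at most \<open>v i a + v j b\<close>, and each of the two sums is controlled by
  self-boundedness one step below \<open>z\<close>.\<close>

lemma sum_marginal_products:
  assumes z: "z \<in> cube n"
  shows "(\<Sum>i<n. \<Sum>j\<in>{..<n} - {i}. of_bool (z i) * of_bool (z j) *
      (marginal f i (z(j := False)) * marginal f j (z(i := False)))) \<le> 2"
proof -
  obtain v where v: "\<And>i. i < n \<Longrightarrow> 0 \<le> v i" "f z = (\<Sum>i<n. v i * of_bool (z i))"
    "\<And>y. y \<in> cube n \<Longrightarrow> (\<Sum>i<n. v i * of_bool (y i)) \<le> f y"
    using XOS_certificate[OF XOS z] by metis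
  define q where "q i j = of_bool (z i) * of_bool (z j) * (v i * marginal f j (z(i := False)))" for i j
  have q0: "q i j \<ge> 0" if "i < n" "j < n" for i j
    using that v z by (simp add: q_def marginal_nonneg cube_upd)
  have "of_bool (z i) * of_bool (z j) * (marginal f i (z(j := False)) * marginal f j (z(i := False)))
      \<le> q i j + q j i" if ij: "i < n" "j < n" "i \<noteq> j" for i j
  proof (cases "z i \<and> z j")
    case True
    define a where "a = marginal f j (z(i := False))"
    define b where "b = marginal f i (z(j := False))"
    have ab: "a \<ge> 0" "b \<ge> 0" using ij z by (auto simp: a_def b_def marginal_nonneg cube_upd)
    have drop: "f z - f (z(i := False, j := False)) \<le> v i + v j"
    proof -
      have "f z - f (z(i := False, j := False)) \<le> (\<Sum>k\<in>{i, j}. v k)"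
        using True ij by (intro minorant_drop[OF v(2,3) z]) (auto simp: fun_eq_iff)
      then show ?thesis using ij by simp
    qed
    have "a \<le> v i + v j"
    proof -
      have "a = f (z(i := False)) - f (z(i := False, j := False))"
        using True ij by (simp add: a_def marginal_def fun_upd_idem)
      also have "f (z(i := False)) \<le> f z" using z by (intro XOS_mono) (auto simp: cube_upd_False split: if_splits)
      finally show ?thesis using drop by linarith
    qed
    have "b \<le> v i + v j"
    proof -
      have "b = f (z(j := False)) - f (z(i := False, j := False))"
        using True ij by (simp add: b_def marginal_def fun_upd_idem fun_upd_twist)
      also have "f (z(j := False)) \<le> f z" using z by (intro XOS_mono) (auto simp: cube_upd_False split: if_splits)
      finally show ?thesis using drop by linarith
    qed
    \<comment> \<open>Read \<open>b * a\<close> as an average of itself with weights v i / W and v j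
      / W; replace \<open>b\<close> by its upper bound \<open>W\<close> in the first term and
      \<open>a\<close> in the second. The division forces the separate case
      \<open>W = 0\<close>.\<close>
    define W where "W = v i + v j"
    have W: "a \<le> W" "b \<le> W" using \<open>a \<le> v i + v j\<close> \<open>b \<le> v i + v j\<close> by (auto simp: W_def)
    have vv: "v i \<ge> 0" "v j \<ge> 0" using v(1) ij by auto
    have "b * a \<le> v i * a + v j * b"
    proof (cases "W = 0")
      case True
      then have "a = 0" using W ab by simp
      then show ?thesis using ab vv by simp
    next
      case False
      then have pos: "W > 0" using vv by (simp add: W_def)
      have "W * (b * a) = v i * (b * a) + v j * (b * a)" by (simp add: W_def distrib_right)
      also have "\<dots> \<le> v i * (W * a) + v j * (b * W)"
        using ab vv W by (intro add_mono mult_left_mono mult_right_mono) auto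
      also have "\<dots> = W * (v i * a + v j * b)" by (simp add: algebra_simps)
      finally show ?thesis using pos by simp
    qed
    then show ?thesis using True by (simp add: q_def a_def b_def)
  qed (auto simp: q_def)
  then have "(\<Sum>i<n. \<Sum>j\<in>{..<n} - {i}. of_bool (z i) * of_bool (z j) *
      (marginal f i (z(j := False)) * marginal f j (z(i := False)))) \<le>
      (\<Sum>i<n. \<Sum>j\<in>{..<n} - {i}. q i j + q j i)"
    by (intro sum_mono) auto
  also have "\<dots> \<le> (\<Sum>i<n. \<Sum>j<n. q i j + q j i)"
    by (intro sum_mono sum_mono2) (auto simp: q0)
  also have "\<dots> = 2 * (\<Sum>i<n. \<Sum>j<n. q i j)"
    by (simp add: sum.distrib sum.swap[of "\<lambda>i j. q j i"])
  also have "(\<Sum>i<n. \<Sum>j<n. q i j) \<le> (\<Sum>i<n. v i * of_bool (z i))"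
  proof (rule sum_mono)
    fix i assume i: "i \<in> {..<n}"
    have zi: "z(i := False) \<in> cube n" using z by (rule cube_upd_False)
    \<comment> \<open>The sum wanted differs from the self-bounding sum at
      \<open>z(i := False)\<close> only in the term \<open>j = i\<close>. If bit \<open>i\<close> is
      on in \<open>z\<close>, that term is the marginal which raises
      \<open>f (z(i := False))\<close> to \<open>f z\<close>, so the total is still at most
      1.\<close>
    have "(\<Sum>j<n. of_bool (z j) * marginal f j (z(i := False))) - of_bool (z i) * marginal f i z =
        (\<Sum>j<n. of_bool (z j) * marginal f j (z(i := False)) -
          (if j = i then of_bool (z i) * marginal f i z else 0))"
      using i by (simp only: sum_subtractf sum.delta finite_lessThan if_True)
    also have "\<dots> = (\<Sum>j<n. of_bool ((z(i := False)) j) * marginal f j (z(i := False)))"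
      by (intro sum.cong refl) auto
    also have "\<dots> \<le> f (z(i := False))" by (rule self_bounding[OF zi])
    finally have le: "(\<Sum>j<n. of_bool (z j) * marginal f j (z(i := False))) \<le>
        f (z(i := False)) + of_bool (z i) * marginal f i z" by simp
    also have "\<dots> \<le> 1"
    proof (cases "z i")
      case True
      then show ?thesis using range[OF z] by (simp add: marginal_def fun_upd_idem)
    qed (use range[OF zi] in auto)
    finally have "v i * of_bool (z i) * (\<Sum>j<n. of_bool (z j) * marginal f j (z(i := False))) \<le>
        v i * of_bool (z i) * 1"
      using v(1) i by (intro mult_left_mono) auto
    then show "(\<Sum>j<n. q i j) \<le> v i * of_bool (z i)"
      by (simp only: q_def sum_distrib_left ac_simps mult_1)
  qed
  also have "(\<Sum>i<n. v i * of_bool (z i)) \<le> 1"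
    using range[OF z] v(2) by simp
  finally show ?thesis by simp
qed

text \<open>In an off-diagonal term of the expanded square both bits are off at \<open>x\<close>;
  the average is moved to the point \<open>z\<close> with both on. As a marginal ignores its own
  bit, the two factors become marginals at the points just below \<open>z\<close>, and
  \<open>sum_marginal_products\<close> bounds the total by 2. The diagonal adds at most 1, since
  marginals in the unit interval dominate their squares.\<close>

lemma cube_avg_up_marginals:
  "cube_avg n (\<lambda>x. (\<Sum>i<n. of_bool (\<not> x i) * marginal f i x)\<^sup>2) \<le> 3"
proof -
  let ?u = "\<lambda>i j x. of_bool (\<not> x i) * of_bool (\<not> x j) * (marginal f i x * marginal f j x)"
  let ?o = "\<lambda>i j z. of_bool (z i) * of_bool (z j) *
      (marginal f i (z(j := False)) * marginal f j (z(i := False)))"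
  have diag: "cube_avg n (?u i i) = cube_avg n (\<lambda>x. of_bool (x i) * (marginal f i x)\<^sup>2)"
    if "i < n" for i
  proof -
    have "cube_avg n (?u i i) = cube_avg n (\<lambda>x. of_bool (\<not> x i) * (marginal f i x)\<^sup>2)"
      by (intro cube_avg_cong) (simp add: power2_eq_square)
    also have "\<dots> = cube_avg n (\<lambda>x. of_bool (x i) * (marginal f i x)\<^sup>2)"
      using that by (intro cube_avg_of_bool_not) auto
    finally show ?thesis .
  qed
  have off: "cube_avg n (?u i j) = cube_avg n (?o i j)" if ij: "i < n" "j < n" "i \<noteq> j" for i j
  proof -
    let ?m = "\<lambda>x. marginal f i (x(j := False)) * marginal f j (x(i := False))"
    have "cube_avg n (?u i j) =
        cube_avg n (\<lambda>x. of_bool (\<not> x i) * (of_bool (\<not> x j) * ?m x))"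
      by (intro cube_avg_cong) (auto simp: of_bool_def fun_upd_idem)
    also have "\<dots> = cube_avg n (\<lambda>x. of_bool (x i) * (of_bool (\<not> x j) * ?m x))"
      using ij by (intro cube_avg_of_bool_not) (auto simp: fun_upd_twist)
    also have "\<dots> = cube_avg n (\<lambda>x. of_bool (\<not> x j) * (of_bool (x i) * ?m x))"
      by (simp add: mult_ac)
    also have "\<dots> = cube_avg n (\<lambda>x. of_bool (x j) * (of_bool (x i) * ?m x))"
      using ij by (intro cube_avg_of_bool_not) (auto simp: fun_upd_twist)
    also have "\<dots> = cube_avg n (?o i j)"
      by (simp add: mult_ac)
    finally show ?thesis .
  qed
  have "cube_avg n (\<lambda>x. (\<Sum>i<n. of_bool (\<not> x i) * marginal f i x)\<^sup>2) =
      cube_avg n (\<lambda>x. \<Sum>i<n. \<Sum>j<n. ?u i j x)"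
    by (intro cube_avg_cong) (simp only: power2_eq_square sum_product ac_simps)
  also have "\<dots> = (\<Sum>i<n. \<Sum>j<n. cube_avg n (?u i j))"
    by (simp only: cube_avg_sum)
  also have "\<dots> = (\<Sum>i<n. cube_avg n (?u i i) + (\<Sum>j\<in>{..<n} - {i}. cube_avg n (?u i j)))"
    by (intro sum.cong refl sum.remove) auto
  also have "\<dots> = (\<Sum>i<n. cube_avg n (\<lambda>x. of_bool (x i) * (marginal f i x)\<^sup>2) +
      (\<Sum>j\<in>{..<n} - {i}. cube_avg n (?o i j)))"
    using diag off by (intro sum.cong arg_cong2[of _ _ _ _ "(+)"]) auto
  also have "\<dots> = cube_avg n (\<lambda>x. (\<Sum>i<n. of_bool (x i) * (marginal f i x)\<^sup>2) +
      (\<Sum>i<n. \<Sum>j\<in>{..<n} - {i}. ?o i j x))"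
    by (simp only: cube_avg_sum cube_avg_add sum.distrib)
  also have "\<dots> \<le> cube_avg n (\<lambda>_. 3)"
  proof (rule cube_avg_mono)
    fix x assume x: "x \<in> cube n"
    have "(\<Sum>i<n. of_bool (x i) * (marginal f i x)\<^sup>2) \<le> (\<Sum>i<n. of_bool (x i) * marginal f i x)"
    proof (intro sum_mono mult_left_mono)
      fix i assume "i \<in> {..<n}"
      then show "(marginal f i x)\<^sup>2 \<le> marginal f i x"
        using marginal_nonneg[OF x, of i] marginal_le_1[OF x, of i]
        by (simp add: power2_eq_square mult_left_le)
    qed simp
    also have "\<dots> \<le> 1" using self_bounding[OF x] range[OF x] by simp
    finally show "(\<Sum>i<n. of_bool (x i) * (marginal f i x)\<^sup>2) +
        (\<Sum>i<n. \<Sum>j\<in>{..<n} - {i}. ?o i j x) \<le> 3"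
      using sum_marginal_products[OF x] by simp
  qed
  finally show ?thesis by simp
qed

text \<open>The number operator applied to \<open>f\<close> is half the difference of the downward
  sum D and the upward sum U. Both are nonnegative by monotonicity and D is at most 1, so (D - U)^2
  <= 1 + U^2, whose mean is at most 4.\<close>

lemma sum_card_fourier: "(\<Sum>S\<in>Pow {..<n}. (real (card S) * fourier n f S)\<^sup>2) \<le> 1"
proof -
  let ?D = "\<lambda>x. \<Sum>i<n. of_bool (x i) * marginal f i x"
  let ?U = "\<lambda>x. \<Sum>i<n. of_bool (\<not> x i) * marginal f i x"
  have "(\<Sum>S\<in>Pow {..<n}. (real (card S) * fourier n f S)\<^sup>2) =
      cube_avg n (\<lambda>x. (\<Sum>S\<in>Pow {..<n}. (real (card S) * fourier n f S) * character S x)\<^sup>2)"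
    by (rule cube_avg_square_characters[symmetric]) simp
  also have "\<dots> = cube_avg n (\<lambda>x. ((?D x - ?U x) / 2)\<^sup>2)"
  proof (intro cube_avg_cong)
    fix x assume x: "x \<in> cube n"
    have "(\<Sum>S\<in>Pow {..<n}. (real (card S) * fourier n f S) * character S x) =
        (\<Sum>i<n. pm (x i) * (marginal f i x / 2))"
      unfolding marginal_def by (rule number_operator[OF x, symmetric])
    also have "\<dots> = (?D x - ?U x) / 2"
      unfolding sum_subtractf[symmetric] sum_divide_distrib
      by (intro sum.cong) (auto simp: pm_def of_bool_def)
    finally show "(\<Sum>S\<in>Pow {..<n}. (real (card S) * fourier n f S) * character S x)\<^sup>2 =
        ((?D x - ?U x) / 2)\<^sup>2"
      by (simp only:)
  qed
  also have "\<dots> \<le> cube_avg n (\<lambda>x. 1 / 4 * (1 + (?U x)\<^sup>2))"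
  proof (rule cube_avg_mono)
    fix x assume x: "x \<in> cube n"
    have "0 \<le> ?D x" "0 \<le> ?U x" using x by (auto intro!: sum_nonneg simp: marginal_nonneg)
    moreover have "?D x \<le> 1" using self_bounding[OF x] range[OF x] by simp
    ultimately have "(?D x)\<^sup>2 \<le> 1" "0 \<le> ?D x * ?U x" by (auto simp: power_le_one)
    then show "((?D x - ?U x) / 2)\<^sup>2 \<le> 1 / 4 * (1 + (?U x)\<^sup>2)"
      by (simp add: power_divide power2_diff)
  qed
  also have "\<dots> \<le> 1 / 4 * (1 + 3)"
    unfolding cube_avg_cmult cube_avg_add using cube_avg_up_marginals by simp
  finally show ?thesis by simp
qed

section \<open>From Fourier weight to a junta\<close>

lemma high_degree_weight:
  "(\<Sum>S | S \<subseteq> {..<n} \<and> d < card S. (fourier n f S)\<^sup>2) \<le> 1 / (real d + 1)\<^sup>2"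
proof -
  have "(real d + 1)\<^sup>2 * (\<Sum>S | S \<subseteq> {..<n} \<and> d < card S. (fourier n f S)\<^sup>2) =
      (\<Sum>S | S \<subseteq> {..<n} \<and> d < card S. (real d + 1)\<^sup>2 * (fourier n f S)\<^sup>2)"
    by (rule sum_distrib_left)
  also have "\<dots> \<le> (\<Sum>S | S \<subseteq> {..<n} \<and> d < card S. (real (card S) * fourier n f S)\<^sup>2)"
    unfolding power_mult_distrib by (intro sum_mono mult_right_mono power_mono) auto
  also have "\<dots> \<le> (\<Sum>S\<in>Pow {..<n}. (real (card S) * fourier n f S)\<^sup>2)"
    by (intro sum_mono2) auto
  also have "\<dots> \<le> 1" by (rule sum_card_fourier)
  finally show ?thesis
    by (simp add: field_simps)
qed

text \<open>The sets containing \<open>i\<close>, with \<open>i\<close> removed, carry the spectrum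
  of the halved marginal. That function has values between 0 and 1/2, and being nonnegative it has
  L1 norm equal to its mean, the coefficient at \<open>{i}\<close>.\<close>

lemma low_degree_weight_at:
  assumes i: "i < n"
  shows "(\<Sum>S | S \<subseteq> {..<n} \<and> card S \<le> d \<and> i \<in> S. (fourier n f S)\<^sup>2) \<le>
    3 ^ d * fourier n f {i} * sqrt (fourier n f {i})"
proof -
  let ?g = "\<lambda>x. marginal f i x / 2"
  let ?A = "{S. S \<subseteq> {..<n} \<and> card S \<le> d \<and> i \<in> S}"
  have fin: "finite S" if "S \<in> ?A" for S using that finite_subset by auto
  have "(\<Sum>S\<in>?A. (fourier n f S)\<^sup>2) = (\<Sum>S\<in>?A. (fourier n ?g (S - {i}))\<^sup>2)"
  proof (intro sum.cong refl)
    fix S assume S: "S \<in> ?A"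
    then have "insert i (S - {i}) = S" by auto
    then show "(fourier n f S)\<^sup>2 = (fourier n ?g (S - {i}))\<^sup>2"
      using fourier_marginal[of i n "S - {i}" f] i fin[OF S] by simp
  qed
  also have "\<dots> = (\<Sum>T\<in>(\<lambda>S. S - {i}) ` ?A. (fourier n ?g T)\<^sup>2)"
    by (subst sum.reindex) (auto intro!: inj_onI)
  also have "\<dots> \<le> (\<Sum>T | T \<subseteq> {..<n} \<and> card T \<le> d. (fourier n ?g T)\<^sup>2)"
    by (intro sum_mono2) (auto simp: card_Diff1_le intro: order_trans[OF card_Diff1_le])
  also have "\<dots> \<le> 3 ^ d * cube_avg n (\<lambda>x. \<bar>?g x\<bar>) * sqrt (cube_avg n (\<lambda>x. \<bar>?g x\<bar>))"
  proof (rule low_degree_hypercontractive)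
    fix x assume "x \<in> cube n"
    then show "\<bar>?g x\<bar> \<le> 1"
      using marginal_nonneg[of x i] marginal_le_1[of x i] i by simp
  qed
  also have "cube_avg n (\<lambda>x. \<bar>?g x\<bar>) = fourier n f {i}"
    unfolding fourier_singleton[OF i] using marginal_nonneg i by (intro cube_avg_cong) simp
  finally show ?thesis .
qed

text \<open>A low-degree set that is lost contains a coordinate outside \<open>J\<close>. Summing
  over that coordinate gives 3^d times a sum of 3/2 powers of singleton coefficients; the
  square-root factor is at most sqrt \<alpha> and the rest sums to at most 1, so \<open>n\<close>
  does not enter.\<close>

lemma fourier_weight_outside:
  assumes J: "J \<subseteq> {..<n}" and small: "\<And>i. i < n \<Longrightarrow> i \<notin> J \<Longrightarrow> fourier n f {i} \<le> \<alpha>"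
    and "0 \<le> \<alpha>"
  shows "(\<Sum>S\<in>Pow {..<n} - {S. S \<subseteq> J \<and> card S \<le> d}. (fourier n f S)\<^sup>2) \<le>
    1 / (real d + 1)\<^sup>2 + 3 ^ d * sqrt \<alpha>"
proof -
  let ?a = "\<lambda>i. fourier n f {i}"
  let ?L = "{S. S \<subseteq> {..<n} \<and> card S \<le> d \<and> \<not> S \<subseteq> J}"
  have "Pow {..<n} - {S. S \<subseteq> J \<and> card S \<le> d} = {S. S \<subseteq> {..<n} \<and> d < card S} \<union> ?L"
    by auto
  then have "(\<Sum>S\<in>Pow {..<n} - {S. S \<subseteq> J \<and> card S \<le> d}. (fourier n f S)\<^sup>2) =
      (\<Sum>S | S \<subseteq> {..<n} \<and> d < card S. (fourier n f S)\<^sup>2) + (\<Sum>S\<in>?L. (fourier n f S)\<^sup>2)"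
    by (simp, intro sum.union_disjoint) auto
  also have "(\<Sum>S\<in>?L. (fourier n f S)\<^sup>2) \<le> 3 ^ d * sqrt \<alpha>"
  proof -
    have "(\<Sum>S\<in>?L. (fourier n f S)\<^sup>2) \<le>
        (\<Sum>S\<in>?L. \<Sum>i\<in>{..<n} - J. if i \<in> S then (fourier n f S)\<^sup>2 else 0)"
    proof (rule sum_mono)
      fix S assume "S \<in> ?L"
      then obtain i where i: "i \<in> S" "i \<in> {..<n} - J" by auto
      have "(\<Sum>i\<in>{i}. if i \<in> S then (fourier n f S)\<^sup>2 else 0) \<le>
          (\<Sum>i\<in>{..<n} - J. if i \<in> S then (fourier n f S)\<^sup>2 else 0)"
        using i by (intro sum_mono2) auto
      then show "(fourier n f S)\<^sup>2 \<le> (\<Sum>i\<in>{..<n} - J. if i \<in> S then (fourier n f S)\<^sup>2 else 0)"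
        using i by simp
    qed
    also have "\<dots> = (\<Sum>i\<in>{..<n} - J. \<Sum>S\<in>?L. if i \<in> S then (fourier n f S)\<^sup>2 else 0)"
      by (rule sum.swap)
    also have "\<dots> \<le> (\<Sum>i\<in>{..<n} - J. 3 ^ d * sqrt \<alpha> * ?a i)"
    proof (rule sum_mono)
      fix i assume i: "i \<in> {..<n} - J"
      have "(\<Sum>S\<in>?L. if i \<in> S then (fourier n f S)\<^sup>2 else 0) =
          (\<Sum>S\<in>?L \<inter> {S. i \<in> S}. (fourier n f S)\<^sup>2)"
        by (subst sum.inter_restrict) auto
      also have "\<dots> \<le> (\<Sum>S | S \<subseteq> {..<n} \<and> card S \<le> d \<and> i \<in> S. (fourier n f S)\<^sup>2)"
        by (intro sum_mono2) auto
      also have "\<dots> \<le> 3 ^ d * ?a i * sqrt (?a i)"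
        using i by (intro low_degree_weight_at) auto
      also have "\<dots> \<le> 3 ^ d * ?a i * sqrt \<alpha>"
        using i small fourier_singleton_nonneg by (intro mult_left_mono) auto
      finally show "(\<Sum>S\<in>?L. if i \<in> S then (fourier n f S)\<^sup>2 else 0) \<le> 3 ^ d * sqrt \<alpha> * ?a i"
        by (simp add: mult_ac)
    qed
    also have "\<dots> = 3 ^ d * sqrt \<alpha> * (\<Sum>i\<in>{..<n} - J. ?a i)"
      by (simp add: sum_distrib_left)
    also have "(\<Sum>i\<in>{..<n} - J. ?a i) \<le> (\<Sum>i<n. ?a i)"
      by (intro sum_mono2) (auto simp: fourier_singleton_nonneg)
    also have "\<dots> \<le> 1" by (rule sum_fourier_singleton)
    finally show ?thesis using \<open>0 \<le> \<alpha>\<close> by (simp add: mult_left_mono)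
  qed
  finally show ?thesis using high_degree_weight[of d] by simp
qed

lemma card_influential:
  assumes "0 < \<alpha>" "I \<subseteq> {i. i < n \<and> \<alpha> \<le> fourier n f {i}}"
  shows "real (card I) \<le> 1 / \<alpha>"
proof -
  have "real (card I) * \<alpha> = (\<Sum>i\<in>I. \<alpha>)" by simp
  also have "\<dots> \<le> (\<Sum>i\<in>I. fourier n f {i})" using assms by (intro sum_mono) auto
  also have "\<dots> \<le> (\<Sum>i<n. fourier n f {i})"
    using assms by (intro sum_mono2) (auto simp: fourier_singleton_nonneg)
  also have "\<dots> \<le> 1" by (rule sum_fourier_singleton)
  finally show ?thesis using assms by (simp add: field_simps)
qed

end

section \<open>Reasoning about programs\<close>

text \<open>A total-correctness triple that carries a time bound.\<close>

definition reaches ::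
  "(nat \<Rightarrow> point \<times> real) \<Rightarrow> com \<Rightarrow> state \<Rightarrow> nat \<Rightarrow> (state \<Rightarrow> bool) \<Rightarrow> bool" where
  "reaches D c s T Q \<longleftrightarrow> (\<exists>t s'. exec D c s t s' \<and> t \<le> T \<and> Q s')"

text \<open>The closing \<open>Skip\<close> costs a step, which accounts for the \<open>+ 1\<close>
  in \<open>reaches_last\<close> and in the bounds built on it.\<close>

primrec block :: "com list \<Rightarrow> com" where
  "block [] = Skip"
| "block (c # cs) = Seq c (block cs)"

fun straight :: "com \<Rightarrow> bool" where
  "straight (Seq c d) \<longleftrightarrow> straight c \<and> straight d"
| "straight (Cond b c d) \<longleftrightarrow> straight c \<and> straight d"
| "straight (While b c) \<longleftrightarrow> False"
| "straight _ \<longleftrightarrow> True"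

text \<open>Symbolic execution of loop-free code, so that the simplifier can compute final states.
  The last equation also assigns a value to \<open>While\<close>, which \<open>straight\<close>
  excludes.\<close>

fun effect :: "(nat \<Rightarrow> point \<times> real) \<Rightarrow> com \<Rightarrow> state \<Rightarrow> state" where
  "effect D (NAssign v a e) s = s\<lparr>nmem := (nmem s)(v := (nmem s v)(nval a s := nval e s))\<rparr>"
| "effect D (RAssign v a e) s = s\<lparr>rmem := (rmem s)(v := (rmem s v)(nval a s := rval e s))\<rparr>"
| "effect D Draw s =
    s\<lparr>cur_point := fst (D (drawn s)), cur_label := snd (D (drawn s)), drawn := drawn s + 1\<rparr>"
| "effect D (Emit g) s = s\<lparr>emitted := emitted s @ [map_gate (\<lambda>a. nval a s) (\<lambda>e. rval e s) g]\<rparr>"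
| "effect D (Seq c d) s = effect D d (effect D c s)"
| "effect D (Cond b c d) s = (if bval b s then effect D c s else effect D d s)"
| "effect D _ s = s"

fun cost :: "com \<Rightarrow> nat" where
  "cost (Seq c d) = cost c + cost d"
| "cost (Cond b c d) = max (cost c) (cost d) + 1"
| "cost _ = 1"

lemma reaches_straight:
  assumes "straight c" "Q (effect D c s)" "cost c \<le> T"
  shows "reaches D c s T Q"
proof -
  have "\<exists>t\<le>cost c. exec D c s t (effect D c s)"
    using assms(1)
  proof (induction c arbitrary: s)
    case (Seq c d)
    then obtain t u where "t \<le> cost c" "exec D c s t (effect D c s)"
      "u \<le> cost d" "exec D d (effect D c s) u (effect D d (effect D c s))" by fastforce
    then show ?case by (auto intro!: exI[of _ "t + u"] exec_Seq)
  next
    case (Cond b c d)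
    show ?case
    proof (cases "bval b s")
      case True
      from Cond obtain t where "t \<le> cost c" "exec D c s t (effect D c s)" by fastforce
      then show ?thesis using True by (auto intro!: exI[of _ "t + 1"] exec_CondT[unfolded Suc_eq_plus1])
    next
      case False
      from Cond obtain t where "t \<le> cost d" "exec D d s t (effect D d s)" by fastforce
      then show ?thesis using False by (auto intro!: exI[of _ "t + 1"] exec_CondF[unfolded Suc_eq_plus1])
    qed
  next
    case Draw
    then show ?case using exec_Draw[of D s] by (intro exI[of _ 1]) simp
  qed (auto intro: exec.intros[unfolded One_nat_def])
  then show ?thesis using assms by (auto simp: reaches_def intro: order_trans)
qed

lemma reaches_mono:
  "reaches D c s T Q \<Longrightarrow> T \<le> T' \<Longrightarrow> (\<And>s'. Q s' \<Longrightarrow> R s') \<Longrightarrow> reaches D c s T' R"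
  unfolding reaches_def by (meson order_trans)

lemma reaches_Seq:
  assumes "reaches D c s T Q" "\<And>s'. Q s' \<Longrightarrow> reaches D d s' U R"
  shows "reaches D (Seq c d) s (T + U) R"
proof -
  obtain t s' where 1: "exec D c s t s'" "t \<le> T" "Q s'" using assms by (auto simp: reaches_def)
  then obtain u s'' where 2: "exec D d s' u s''" "u \<le> U" "R s''"
    using assms(2)[OF 1(3)] by (auto simp: reaches_def)
  show ?thesis unfolding reaches_def
    using exec_Seq[OF 1(1) 2(1)] 1 2 by (meson add_mono)
qed

lemma reaches_block_Cons:
  assumes "reaches D c s T Q" "\<And>s'. Q s' \<Longrightarrow> reaches D (block cs) s' U R"
  shows "reaches D (block (c # cs)) s (T + U) R"
  using reaches_Seq[OF assms] by simp

lemma reaches_block_Nil: "Q s \<Longrightarrow> reaches D (block []) s 1 Q"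
  by (auto intro!: reaches_straight)

lemma reaches_straight_Cons:
  assumes "straight c" "reaches D (block cs) (effect D c s) T Q"
  shows "reaches D (block (c # cs)) s (cost c + T) Q"
  by (rule reaches_block_Cons[where Q = "\<lambda>s'. s' = effect D c s"])
     (use assms in \<open>auto intro: reaches_straight\<close>)

lemma reaches_straight_Cons2:
  assumes "straight c" "straight d" "reaches D (block cs) (effect D d (effect D c s)) T Q"
  shows "reaches D (block (c # d # cs)) s (cost c + (cost d + T)) Q"
  using assms by (intro reaches_straight_Cons)

lemma reaches_last: "reaches D c s T Q \<Longrightarrow> reaches D (block [c]) s (T + 1) Q"
  by (rule reaches_block_Cons[OF _ reaches_block_Nil])

lemma reaches_straight_append:
  assumes "straight (block cs)" "reaches D (block ds) (effect D (block cs) s) T Q"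
  shows "reaches D (block (cs @ ds)) s (cost (block cs) + T) Q"
  using assms
proof (induction cs arbitrary: s)
  case Nil
  then show ?case by (auto intro: reaches_mono)
next
  case (Cons c cs)
  then have "reaches D (block (cs @ ds)) (effect D c s) (cost (block cs) + T) Q" by simp
  then show ?case using reaches_straight_Cons[of c D "cs @ ds"] Cons.prems by (simp add: add.assoc)
qed

lemma reaches_Cond:
  assumes "bval b s \<Longrightarrow> reaches D c s T Q" "\<not> bval b s \<Longrightarrow> reaches D d s T Q"
  shows "reaches D (Cond b c d) s (T + 1) Q"
proof (cases "bval b s")
  case True
  then show ?thesis
    using assms(1) exec_CondT[OF True, of D c _ _ d] unfolding reaches_def by (meson add_le_cancel_right)
next
  case False
  then show ?thesis
    using assms(2) exec_CondF[OF False, of D d _ _ c] unfolding reaches_def by (meson add_le_cancel_right)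
qed

text \<open>The number of rounds of each loop is known when it is entered, so the invariant is
  indexed by the iteration. The cost \<open>T i\<close> may vary with it: the screening loop needs
  this, as its rounds get cheaper when candidates are dropped.\<close>

lemma reaches_While:
  assumes "I 0 s"
    and "\<And>i s. i < k \<Longrightarrow> I i s \<Longrightarrow> bval b s \<and> reaches D c s (T i) (I (Suc i))"
    and "\<And>s. I k s \<Longrightarrow> \<not> bval b s"
  shows "reaches D (While b c) s ((\<Sum>i<k. T i + 1) + 1) (I k)"
proof -
  have "reaches D (While b c) s ((\<Sum>i\<in>{j..<k}. T i + 1) + 1) (I k)" if "I j s" "j \<le> k" for j s
    using that(2,1)
  proof (induction j arbitrary: s rule: inc_induct)
    case base
    show ?case using exec_WhileF[OF assms(3)[OF base]] base unfolding reaches_def by fastforce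
  next
    case (step j)
    then obtain t s' where 1: "bval b s" "exec D c s t s'" "t \<le> T j" "I (Suc j) s'"
      using assms(2)[of j s] by (auto simp: reaches_def)
    then obtain u s'' where 2: "exec D (While b c) s' u s''"
      "u \<le> (\<Sum>i\<in>{Suc j..<k}. T i + 1) + 1" "I k s''"
      using step.IH[of s'] by (auto simp: reaches_def)
    have "t + u + 1 \<le> (\<Sum>i\<in>{j..<k}. T i + 1) + 1"
      using 1 2 step by (subst sum.atLeast_Suc_lessThan) auto
    then show ?case unfolding reaches_def using exec_WhileT[OF 1(1,2) 2(1)] 2 by blast
  qed
  from this[OF assms(1)] show ?thesis by (simp add: lessThan_atLeast0)
qed

section \<open>The learning algorithm\<close>

text \<open>The parameters below are written so that the real RAM can compute them. Every candidate
  coordinate is tested against half of the threshold \<open>thr \<epsilon>\<close>; \<open>rate \<epsilon>\<close> is the resulting exponent in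
  the Chernoff bound, and \<open>burn \<epsilon>\<close> the number of examples after which eliminations begin.\<close>

definition deg_bound :: "real \<Rightarrow> nat" where
  "deg_bound \<epsilon> = nat \<lceil>2 / \<epsilon>\<rceil>"

definition thr :: "real \<Rightarrow> real" where
  "thr \<epsilon> = \<epsilon> * \<epsilon> * \<epsilon> * \<epsilon> / 16 / 9 ^ deg_bound \<epsilon>"

definition rate :: "real \<Rightarrow> real" where
  "rate \<epsilon> = thr \<epsilon> * thr \<epsilon> / 32"

definition burn :: "real \<Rightarrow> real" where
  "burn \<epsilon> = 40 / (thr \<epsilon> * rate \<epsilon> * rate \<epsilon>)"

text \<open>For positive \<open>n\<close> the ceiling of the binary logarithm, in the form that a
  doubling loop computes without rounding.\<close>

definition lg :: "nat \<Rightarrow> nat" where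
  "lg n = (LEAST l. n \<le> 2 ^ l)"

definition screen_bound :: "nat \<Rightarrow> real \<Rightarrow> real" where
  "screen_bound n \<epsilon> = burn \<epsilon> * (real (lg n) + 5)"

definition screen_size :: "nat \<Rightarrow> real \<Rightarrow> nat" where
  "screen_size n \<epsilon> = nat \<lceil>screen_bound n \<epsilon>\<rceil>"

text \<open>The first summand is 20 times the bound on the expected work spent on uninfluential
  coordinates, so Markov leaves failure probability 1/20. The second pays for the at most 4 / thr
  other coordinates, read in every example; its \<open>+ 1\<close> comes from the ceiling in
  \<open>screen_size\<close>.\<close>

definition budget :: "nat \<Rightarrow> real \<Rightarrow> real" where
  "budget n \<epsilon> = 20 * real n * (burn \<epsilon> + 2) + 4 / thr \<epsilon> * (screen_bound n \<epsilon> + 1)"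

text \<open>Screening: the candidates left after \<open>t\<close> examples together with the work spent so far.
  Reading all \<open>n\<close> coordinates of each of the \<open>O(log n)\<close> examples would take too long, so coordinates
  are dropped as soon as they look uninfluential. The budget enforces the time bound on
  atypical examples.\<close>

definition score :: "(nat \<Rightarrow> point \<times> real) \<Rightarrow> nat \<Rightarrow> nat \<Rightarrow> real" where
  "score D t i = (\<Sum>j<t. pm (fst (D j) i) * snd (D j))"

definition passes :: "real \<Rightarrow> (nat \<Rightarrow> point \<times> real) \<Rightarrow> nat \<Rightarrow> nat \<Rightarrow> bool" where
  "passes \<epsilon> D t i \<longleftrightarrow> real t < burn \<epsilon> \<or> thr \<epsilon> / 2 * real t \<le> score D t i"

primrec screen :: "nat \<Rightarrow> real \<Rightarrow> (nat \<Rightarrow> point \<times> real) \<Rightarrow> nat \<Rightarrow> nat list \<times> nat" where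
  "screen n \<epsilon> D 0 = ([0..<n], 0)"
| "screen n \<epsilon> D (Suc t) = (case screen n \<epsilon> D t of (xs, w) \<Rightarrow>
    if budget n \<epsilon> < real (w + length xs) then ([], w)
    else (filter (passes \<epsilon> D (Suc t)) xs, w + length xs))"

text \<open>Oversized lists are discarded, so that the later stages are bounded on every sequence of
  examples. In a typical run all survivors have coefficients above thr / 4, and there are at most 4
  / thr of those.\<close>

definition selected :: "nat \<Rightarrow> real \<Rightarrow> (nat \<Rightarrow> point \<times> real) \<Rightarrow> nat list" where
  "selected n \<epsilon> D = (let xs = fst (screen n \<epsilon> D (screen_size n \<epsilon>))
    in if 4 / thr \<epsilon> < real (length xs) then [] else xs)"

text \<open>Mirrors the order in which the program lays out its tree: each set comes after the set
  that it extends.\<close>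

primrec family :: "nat \<Rightarrow> nat list \<Rightarrow> nat \<Rightarrow> nat set list" where
  "family d xs 0 = [{}]"
| "family d xs (Suc q) =
    family d xs q @ map (insert (xs ! q)) (filter (\<lambda>S. card S < d) (family d xs q))"

text \<open>With this many examples the \<open>k\<close> mean square errors add up to at most
  \<epsilon>^2/40, a tenth of the \<epsilon>^2/4 allotted to sampling.\<close>

definition fit_size :: "real \<Rightarrow> nat \<Rightarrow> nat" where
  "fit_size \<epsilon> k = nat \<lceil>40 * real k / (\<epsilon> * \<epsilon>)\<rceil>"

abbreviation "nv v \<equiv> NV v (N 0)"
abbreviation "rv v \<equiv> RV v (N 0)"
abbreviation "nset v e \<equiv> NAssign v (N 0) e"
abbreviation "rset v e \<equiv> RAssign v (N 0) e"
abbreviation "rnum k \<equiv> OfNat (N k)"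
abbreviation "incr v \<equiv> nset v (NAdd (nv v) (N 1))"

text \<open>The array \<open>cand\<close> lists the \<open>k\<close> remaining candidates, and \<open>acc\<close> is indexed by coordinates.
  The sets of coordinates whose characters are fitted form a tree with \<open>N\<close> entries: entry \<open>0\<close> is
  the empty set, and entry \<open>p\<close> is entry \<open>par p\<close> with \<open>var p\<close> added and has \<open>g p\<close> elements.\<close>

definition com_degree :: com where
  "com_degree = block [
    rset ''al'' (RDiv (RMul (RMul (RMul (rv ''eps'') (rv ''eps'')) (rv ''eps'')) (rv ''eps'')) (rnum 16)),
    While (RLess (RMul (OfNat (nv ''d'')) (rv ''eps'')) (rnum 2))
      (block [incr ''d'', rset ''al'' (RDiv (rv ''al'') (rnum 9))])]"

definition com_log :: com where
  "com_log = block [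
    nset ''p'' (N 1),
    While (NLess (nv ''p'') (nv ''n'')) (block [nset ''p'' (NAdd (nv ''p'') (nv ''p'')), incr ''L''])]"

definition com_params :: com where
  "com_params = block [
    rset ''lam'' (RDiv (RMul (rv ''al'') (rv ''al'')) (rnum 32)),
    rset ''s'' (RDiv (rnum 40) (RMul (RMul (rv ''al'') (rv ''lam'')) (rv ''lam''))),
    rset ''M'' (RMul (rv ''s'') (RAdd (OfNat (nv ''L'')) (rnum 5))),
    rset ''B'' (RAdd (RMul (RMul (rnum 20) (OfNat (nv ''n''))) (RAdd (rv ''s'') (rnum 2)))
      (RMul (RDiv (rnum 4) (rv ''al'')) (RAdd (rv ''M'') (rnum 1))))]"

definition com_init :: com where
  "com_init = While (NLess (nv ''k'') (nv ''n''))
    (block [NAssign ''cand'' (nv ''k'') (nv ''k''), incr ''k''])"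

text \<open>The candidates are compacted in place, the write position \<open>j\<close> never passing
  the read position \<open>q\<close>. A dropped coordinate does not return, so scores are kept up to
  date for survivors only.\<close>

definition com_filter_step :: com where
  "com_filter_step = block [
    nset ''i'' (NV ''cand'' (nv ''q'')),
    Cond (Bit (nv ''i''))
      (RAssign ''acc'' (nv ''i'') (RAdd (RV ''acc'' (nv ''i'')) Label))
      (RAssign ''acc'' (nv ''i'') (RSub (RV ''acc'' (nv ''i'')) Label)),
    Cond (BAnd (BNot (RLess (OfNat (nv ''t'')) (rv ''s'')))
        (RLess (RV ''acc'' (nv ''i'')) (RMul (RDiv (rv ''al'') (rnum 2)) (OfNat (nv ''t'')))))
      Skip
      (block [NAssign ''cand'' (nv ''j'') (nv ''i''), incr ''j'']),
    incr ''q'']"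

text \<open>An example is drawn even when the budget is exhausted or no candidate is left: fitting
  must start at a fixed example for the independence argument.\<close>

definition com_screen_step :: com where
  "com_screen_step = block [Draw, incr ''t'',
    Cond (RLess (rv ''B'') (OfNat (NAdd (nv ''w'') (nv ''k''))))
      (nset ''k'' (N 0))
      (block [
        nset ''w'' (NAdd (nv ''w'') (nv ''k'')), nset ''q'' (N 0), nset ''j'' (N 0),
        While (NLess (nv ''q'') (nv ''k'')) com_filter_step,
        nset ''k'' (nv ''j'')])]"

definition com_screen :: com where
  "com_screen = block [
    While (RLess (OfNat (nv ''t'')) (rv ''M'')) com_screen_step,
    Cond (RLess (RDiv (rnum 4) (rv ''al'')) (OfNat (nv ''k''))) (nset ''k'' (N 0)) Skip]"

definition com_extend_step :: com where
  "com_extend_step = block [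
    Cond (NLess (NV ''g'' (nv ''p'')) (nv ''d''))
      (block [
        NAssign ''par'' (nv ''N'') (nv ''p''),
        NAssign ''var'' (nv ''N'') (NV ''cand'' (nv ''q'')),
        NAssign ''g'' (nv ''N'') (NAdd (NV ''g'' (nv ''p'')) (N 1)),
        incr ''N''])
      Skip,
    incr ''p'']"

definition com_family :: com where
  "com_family = block [
    nset ''N'' (N 1), nset ''q'' (N 0),
    While (NLess (nv ''q'') (nv ''k'')) (block [
      nset ''c'' (nv ''N''), nset ''p'' (N 0),
      While (NLess (nv ''p'') (nv ''c'')) com_extend_step,
      incr ''q''])]"

text \<open>One sign turns the character of the parent into that of the entry, so an example costs
  constant time per set, whatever the size of the set.\<close>

definition com_fit_step :: com where
  "com_fit_step = block [
    Cond (Bit (NV ''var'' (nv ''p'')))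
      (RAssign ''val'' (nv ''p'') (RV ''val'' (NV ''par'' (nv ''p''))))
      (RAssign ''val'' (nv ''p'') (RSub (rnum 0) (RV ''val'' (NV ''par'' (nv ''p''))))),
    RAssign ''sum'' (nv ''p'') (RAdd (RV ''sum'' (nv ''p'')) (RMul (RV ''val'' (nv ''p'')) Label)),
    incr ''p'']"

definition com_fit :: com where
  "com_fit = block [
    nset ''t'' (N 0),
    While (RLess (RMul (RMul (OfNat (nv ''t'')) (rv ''eps'')) (rv ''eps'')) (RMul (rnum 40) (OfNat (nv ''N''))))
      (block [Draw, incr ''t'',
        rset ''val'' (rnum 1), rset ''sum'' (RAdd (rv ''sum'') Label), nset ''p'' (N 1),
        While (NLess (nv ''p'') (nv ''N'')) com_fit_step])]"

definition seven_times :: "nexp \<Rightarrow> nexp" where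
  "seven_times e = NAdd e (NAdd e (NAdd e (NAdd e (NAdd e (NAdd e e)))))"

text \<open>The seven gates of entry \<open>p\<close>, based at gate \<open>7 p\<close>, end with the value of its character
  (at \<open>7 p + 3\<close>) and the partial sum up to \<open>p\<close> (at \<open>7 p + 6\<close>). Gates \<open>0\<close> and \<open>1\<close> hold the
  constants \<open>2\<close> and \<open>-1\<close> that turn a bit into a sign.\<close>

definition com_emit_step :: com where
  "com_emit_step = (let base = (\<lambda>k. NAdd (seven_times (nv ''p'')) (N k)) in block [
    Emit (GVar (NV ''var'' (nv ''p''))),
    Emit (GMul (base 0) (N 0)),
    Emit (GAdd (base 1) (N 1)),
    Emit (GMul (base 2) (NAdd (seven_times (NV ''par'' (nv ''p''))) (N 3))),
    Emit (GConst (RDiv (RV ''sum'' (nv ''p'')) (OfNat (nv ''t'')))),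
    Emit (GMul (base 3) (base 4)),
    Emit (GAdd (base 5) (NSub (base 0) (N 1))),
    incr ''p''])"

definition com_emit :: com where
  "com_emit = block [
    Emit (GConst (rnum 2)), Emit (GConst (RSub (rnum 0) (rnum 1))), Emit (GConst (rnum 0)),
    Emit (GConst (rnum 1)), Emit (GConst (RDiv (rv ''sum'') (OfNat (nv ''t'')))),
    Emit (GMul (N 3) (N 4)), Emit (GAdd (N 5) (N 2)), nset ''p'' (N 1),
    While (NLess (nv ''p'') (nv ''N'')) com_emit_step]"

definition com_small :: com where
  "com_small = block [
    Draw, Cond (Bit (N 0)) (rset ''w'' Label) Skip,
    Draw, Cond (Bit (N 0)) (rset ''w'' Label) Skip,
    Emit (GConst (rv ''w'')), Emit (GVar (N 0)), Emit (GMul (N 0) (N 1))]"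

definition com_main :: com where
  "com_main = block [com_degree, com_log, com_params, com_init, com_screen, com_family, com_fit, com_emit]"

text \<open>For \<epsilon> at least 1 the empty circuit, which computes 0, is accurate enough
  because \<open>f\<close> is bounded by 1.\<close>

definition learner :: com where
  "learner = Cond (NLess (nv ''n'') (N 2)) com_small
    (Cond (RLess (rv ''eps'') (rnum 1)) com_main Skip)"

definition estimate :: "(nat \<Rightarrow> point \<times> real) \<Rightarrow> nat \<Rightarrow> nat \<Rightarrow> nat set \<Rightarrow> real" where
  "estimate D m t S = (\<Sum>j<t. character S (fst (D (m + j))) * snd (D (m + j))) / real t"

abbreviation low_subsets :: "nat \<Rightarrow> nat set \<Rightarrow> nat set set" where
  "low_subsets d J \<equiv> {S. S \<subseteq> J \<and> card S \<le> d}"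

definition family_size :: "nat \<Rightarrow> real \<Rightarrow> (nat \<Rightarrow> point \<times> real) \<Rightarrow> nat" where
  "family_size n \<epsilon> D = card (low_subsets (deg_bound \<epsilon>) (set (selected n \<epsilon> D)))"

definition hypothesis :: "nat \<Rightarrow> real \<Rightarrow> (nat \<Rightarrow> point \<times> real) \<Rightarrow> nat list \<Rightarrow> point \<Rightarrow> real" where
  "hypothesis n \<epsilon> D xs x = (\<Sum>S\<in>low_subsets (deg_bound \<epsilon>) (set xs).
    estimate D (screen_size n \<epsilon>) (fit_size \<epsilon> (card (low_subsets (deg_bound \<epsilon>) (set xs)))) S *
    character S x)"

abbreviation learned :: "nat \<Rightarrow> real \<Rightarrow> (nat \<Rightarrow> point \<times> real) \<Rightarrow> point \<Rightarrow> real" where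
  "learned n \<epsilon> D \<equiv> hypothesis n \<epsilon> D (selected n \<epsilon> D)"

definition main_samples :: "nat \<Rightarrow> real \<Rightarrow> (nat \<Rightarrow> point \<times> real) \<Rightarrow> nat" where
  "main_samples n \<epsilon> D = screen_size n \<epsilon> + fit_size \<epsilon> (family_size n \<epsilon> D)"

text \<open>Kept unsimplified: the summands belong to the eight stages of \<open>com_main\<close>,
  nested as \<open>reaches_block_Cons\<close> composes them.\<close>

definition main_cost :: "nat \<Rightarrow> real \<Rightarrow> (nat \<Rightarrow> point \<times> real) \<Rightarrow> nat" where
  "main_cost n \<epsilon> D = (let k = family_size n \<epsilon> D; m = screen_size n \<epsilon> in
    (5 * deg_bound \<epsilon> + 5) + ((5 * lg n + 5) + (5 + ((4 * n + 1) +
    ((20 * m + 10 * snd (screen n \<epsilon> D m) + 5) + ((length (selected n \<epsilon> D) * (9 * k + 7) + 5) +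
    ((fit_size \<epsilon> k * (6 * k + 8) + 3) + (10 * k + 10 + 1))))))))"

section \<open>Correctness of the program\<close>

text \<open>The machine cannot round, so a counter runs up while it is below a real bound and
  thereby stops at the ceiling. This and the similar equivalences below match such loop tests with
  iteration counts.\<close>

lemma less_nat_ceiling_iff: "i < nat \<lceil>y\<rceil> \<longleftrightarrow> real i < y"
  by (simp add: zless_nat_eq_int_zless less_ceiling_iff)

lemma less_deg_bound_iff: "0 < \<epsilon> \<Longrightarrow> i < deg_bound \<epsilon> \<longleftrightarrow> real i * \<epsilon> < 2"
  by (simp add: deg_bound_def less_nat_ceiling_iff field_simps)

lemma less_screen_size_iff: "i < screen_size n \<epsilon> \<longleftrightarrow> real i < screen_bound n \<epsilon>"
  by (simp add: screen_size_def less_nat_ceiling_iff)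

lemma less_fit_size_iff: "0 < \<epsilon> \<Longrightarrow> i < fit_size \<epsilon> k \<longleftrightarrow> real i * \<epsilon> * \<epsilon> < 40 * real k"
  by (simp add: fit_size_def less_nat_ceiling_iff field_simps)

lemma le_two_power_lg: "n \<le> 2 ^ lg n"
  unfolding lg_def by (rule LeastI[of _ n]) (simp add: less_imp_le)

lemma less_lg_iff: "i < lg n \<longleftrightarrow> 2 ^ i < n"
proof
  show "i < lg n \<Longrightarrow> 2 ^ i < n" unfolding lg_def using not_less_Least not_le by blast
  show "i < lg n" if "2 ^ i < n"
  proof (rule ccontr)
    assume "\<not> i < lg n"
    then have "(2::nat) ^ lg n \<le> 2 ^ i" by (intro power_increasing) auto
    then show False using that le_two_power_lg[of n] by linarith
  qed
qed

text \<open>Memory starts out zero, and the program relies on that instead of clearing cells.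
  \<open>zeroed\<close> collects what the stages after screening need, \<open>unscreened\<close>
  what screening itself needs.\<close>

definition zeroed :: "state \<Rightarrow> bool" where
  "zeroed s \<longleftrightarrow> (\<forall>i. rmem s ''sum'' i = 0) \<and> nmem s ''g'' 0 = 0 \<and> emitted s = []"

definition unscreened :: "state \<Rightarrow> bool" where
  "unscreened s \<longleftrightarrow> (\<forall>i. rmem s ''acc'' i = 0) \<and> nmem s ''w'' 0 = 0 \<and> nmem s ''t'' 0 = 0 \<and> drawn s = 0"

definition inputs :: "nat \<Rightarrow> real \<Rightarrow> state \<Rightarrow> bool" where
  "inputs n \<epsilon> s \<longleftrightarrow> nmem s ''n'' 0 = n \<and> rmem s ''eps'' 0 = \<epsilon>"

definition params :: "nat \<Rightarrow> real \<Rightarrow> state \<Rightarrow> bool" where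
  "params n \<epsilon> s \<longleftrightarrow> inputs n \<epsilon> s \<and> nmem s ''d'' 0 = deg_bound \<epsilon> \<and> rmem s ''al'' 0 = thr \<epsilon> \<and>
    rmem s ''s'' 0 = burn \<epsilon> \<and> rmem s ''M'' 0 = screen_bound n \<epsilon> \<and> rmem s ''B'' 0 = budget n \<epsilon>"

definition holds_list :: "state \<Rightarrow> nat list \<Rightarrow> bool" where
  "holds_list s xs \<longleftrightarrow> nmem s ''k'' 0 = length xs \<and> (\<forall>j<length xs. nmem s ''cand'' j = xs ! j)"

definition encodes :: "state \<Rightarrow> nat set list \<Rightarrow> bool" where
  "encodes s E \<longleftrightarrow> nmem s ''N'' 0 = length E \<and> E \<noteq> [] \<and> E ! 0 = {} \<and>
    (\<forall>p<length E. finite (E ! p) \<and> nmem s ''g'' p = card (E ! p)) \<and>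
    (\<forall>p<length E. 0 < p \<longrightarrow> nmem s ''par'' p < p \<and> nmem s ''var'' p \<notin> E ! nmem s ''par'' p \<and>
      E ! p = insert (nmem s ''var'' p) (E ! nmem s ''par'' p))"

definition configured :: "nat \<Rightarrow> real \<Rightarrow> nat \<Rightarrow> real \<Rightarrow> nat \<Rightarrow> state \<Rightarrow> bool" where
  "configured n \<epsilon> d \<alpha> l s \<longleftrightarrow> inputs n \<epsilon> s \<and> zeroed s \<and> unscreened s \<and> nmem s ''d'' 0 = d \<and>
    rmem s ''al'' 0 = \<alpha> \<and> nmem s ''L'' 0 = l \<and> nmem s ''k'' 0 = 0"

lemmas layout_defs = configured_def zeroed_def unscreened_def inputs_def params_def holds_list_def

lemma com_degree_correct:
  assumes "0 < \<epsilon>"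
  shows "reaches D com_degree (start n \<epsilon>) (5 * deg_bound \<epsilon> + 5)
    (configured n \<epsilon> (deg_bound \<epsilon>) (thr \<epsilon>) 0)"
proof -
  define I where "I i = configured n \<epsilon> i (\<epsilon> * \<epsilon> * \<epsilon> * \<epsilon> / 16 / 9 ^ i) 0" for i
  show ?thesis
    unfolding com_degree_def
  proof (rule reaches_mono[OF reaches_straight_Cons[OF _ reaches_last[OF
      reaches_While[where I = I and k = "deg_bound \<epsilon>" and T = "\<lambda>_. 3"]]]], goal_cases)
    case 2
    then show ?case by (simp add: I_def start_def layout_defs)
  next
    case (3 i s)
    then show ?case using assms(1)
      by (auto simp: I_def layout_defs less_deg_bound_iff intro!: reaches_straight)
  next
    case (4 s)
    then show ?case
      using less_deg_bound_iff[OF assms(1), of "deg_bound \<epsilon>"] by (simp add: I_def layout_defs)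
  qed (simp_all add: I_def thr_def)
qed

lemma com_log_correct:
  assumes "configured n \<epsilon> d \<alpha> 0 s"
  shows "reaches D com_log s (5 * lg n + 5) (configured n \<epsilon> d \<alpha> (lg n))"
proof -
  define I where "I i s \<longleftrightarrow> configured n \<epsilon> d \<alpha> i s \<and> nmem s ''p'' 0 = 2 ^ i" for i s
  show ?thesis
    unfolding com_log_def
  proof (rule reaches_mono[OF reaches_straight_Cons[OF _ reaches_last[OF
      reaches_While[where I = I and k = "lg n" and T = "\<lambda>_. 3"]]]], goal_cases)
    case 2
    then show ?case using assms by (simp add: I_def layout_defs)
  next
    case (3 i s)
    then show ?case
      by (auto simp: I_def layout_defs less_lg_iff intro!: reaches_straight)
  next
    case (4 s)
    then show ?case
      using less_lg_iff[of "lg n" n] by (simp add: I_def layout_defs)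
  qed (simp_all add: I_def)
qed

lemma com_params_correct:
  assumes "configured n \<epsilon> (deg_bound \<epsilon>) (thr \<epsilon>) (lg n) s"
  shows "reaches D com_params s 5
    (\<lambda>s. params n \<epsilon> s \<and> zeroed s \<and> unscreened s \<and> nmem s ''k'' 0 = 0)"
  unfolding com_params_def
  using assms by (intro reaches_straight)
    (simp_all add: layout_defs rate_def burn_def screen_bound_def budget_def)

lemma com_init_correct:
  assumes "params n \<epsilon> s" "zeroed s" "unscreened s" "nmem s ''k'' 0 = 0"
  shows "reaches D com_init s (4 * n + 1)
    (\<lambda>s. params n \<epsilon> s \<and> zeroed s \<and> unscreened s \<and> holds_list s [0..<n])"
proof -
  define I where "I i s \<longleftrightarrow> params n \<epsilon> s \<and> zeroed s \<and> unscreened s \<and> holds_list s [0..<i]" for i s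
  show ?thesis
    unfolding com_init_def
  proof (rule reaches_mono[OF 
      reaches_While[where I = I and k = n and T = "\<lambda>_. 3"]], goal_cases)
    case 1
    then show ?case using assms by (simp add: I_def layout_defs)
  next
    case (2 i s)
    then show ?case
      by (auto simp: I_def layout_defs less_Suc_eq nth_append intro!: reaches_straight)
  next
    case (3 s)
    then show ?case by (simp add: I_def layout_defs)
  qed (simp_all add: I_def)
qed

section \<open>The screening loop\<close>

lemma screen_sound:
  "distinct (fst (screen n \<epsilon> D t)) \<and> set (fst (screen n \<epsilon> D t)) \<subseteq> {..<n}"
  by (induction t) (auto simp: split_beta)

lemma screen_work_le_budget:
  assumes "0 \<le> budget n \<epsilon>"
  shows "real (snd (screen n \<epsilon> D t)) \<le> budget n \<epsilon>"
  by (induction t) (use assms in \<open>auto simp: split_beta\<close>)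

lemma score_Suc: "score D (Suc t) i = score D t i + pm (fst (D t) i) * snd (D t)"
  by (simp add: score_def)

definition screening :: "nat \<Rightarrow> real \<Rightarrow> nat \<Rightarrow> state \<Rightarrow> bool" where
  "screening n \<epsilon> t s \<longleftrightarrow> params n \<epsilon> s \<and> zeroed s \<and> nmem s ''t'' 0 = t \<and> drawn s = t"

lemma filter_loop_correct:
  assumes "screening n \<epsilon> (Suc t) s" "cur_point s = fst (D t)" "cur_label s = snd (D t)"
    and "holds_list s xs" "distinct xs" "\<And>x. x \<in> set xs \<Longrightarrow> rmem s ''acc'' x = score D t x"
    and "nmem s ''w'' 0 = w" "nmem s ''q'' 0 = 0" "nmem s ''j'' 0 = 0"
  shows "reaches D (While (NLess (nv ''q'') (nv ''k'')) com_filter_step) s (10 * length xs + 1)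
    (\<lambda>s. screening n \<epsilon> (Suc t) s \<and> nmem s ''w'' 0 = w \<and>
      nmem s ''j'' 0 = length (filter (passes \<epsilon> D (Suc t)) xs) \<and>
      (\<forall>r<length (filter (passes \<epsilon> D (Suc t)) xs).
        nmem s ''cand'' r = filter (passes \<epsilon> D (Suc t)) xs ! r) \<and>
      (\<forall>x\<in>set xs. rmem s ''acc'' x = score D (Suc t) x))"
proof -
  let ?P = "passes \<epsilon> D (Suc t)"
  define Y where "Y q = filter ?P (take q xs)" for q
  define I where "I q s \<longleftrightarrow> screening n \<epsilon> (Suc t) s \<and> cur_point s = fst (D t) \<and>
    cur_label s = snd (D t) \<and> nmem s ''w'' 0 = w \<and> nmem s ''k'' 0 = length xs \<and>
    nmem s ''q'' 0 = q \<and> nmem s ''j'' 0 = length (Y q) \<and>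
    (\<forall>r<length (Y q). nmem s ''cand'' r = Y q ! r) \<and>
    (\<forall>r. q \<le> r \<and> r < length xs \<longrightarrow> nmem s ''cand'' r = xs ! r) \<and>
    (\<forall>r<length xs. rmem s ''acc'' (xs ! r) =
      (if r < q then score D (Suc t) (xs ! r) else score D t (xs ! r)))" for q s
  have Y_le: "length (Y q) \<le> q" if "q < length xs" for q
    using length_filter_le[of ?P "take q xs"] that by (simp add: Y_def)
  have Y_Suc: "Y (Suc q) = (if ?P (xs ! q) then Y q @ [xs ! q] else Y q)" if "q < length xs" for q
    using that by (simp add: Y_def take_Suc_conv_app_nth)
  have step: "I (Suc q) (effect D com_filter_step s)" if q: "q < length xs" and I: "I q s" for q s
  proof -
    define x where "x = xs ! q"
    have x: "nmem s ''cand'' q = x" "rmem s ''acc'' x = score D t x"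
      using I q by (auto simp: I_def x_def)
    let ?s = "effect D com_filter_step s"
    have acc: "rmem ?s ''acc'' = (rmem s ''acc'')(x := score D (Suc t) x)"
      using I x by (simp add: com_filter_step_def I_def score_Suc pm_def)
    have P: "?P x \<longleftrightarrow> \<not> (\<not> real (Suc t) < burn \<epsilon> \<and> score D (Suc t) x < thr \<epsilon> / 2 * real (Suc t))"
      by (auto simp: passes_def)
    have nm: "nmem ?s = (if ?P x then
        (nmem s)(''i'' := (nmem s ''i'')(0 := x), ''cand'' := (nmem s ''cand'')(length (Y q) := x),
          ''j'' := (nmem s ''j'')(0 := Suc (length (Y q))), ''q'' := (nmem s ''q'')(0 := Suc q))
        else (nmem s)(''i'' := (nmem s ''i'')(0 := x), ''q'' := (nmem s ''q'')(0 := Suc q)))"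
      using I x unfolding P
      by (simp add: com_filter_step_def I_def score_Suc pm_def screening_def params_def
          fun_upd_twist)
    have rest: "rmem ?s v = rmem s v" if "v \<noteq> ''acc''" for v
      using that by (simp add: com_filter_step_def)
    have other: "cur_point ?s = cur_point s" "cur_label ?s = cur_label s" "drawn ?s = drawn s"
      "emitted ?s = emitted s"
      by (simp_all add: com_filter_step_def)
    \<comment> \<open>As the candidates are distinct, the update of \<open>acc\<close> at
      \<open>x\<close> leaves the scores of the others alone.\<close>
    have neq: "xs ! r \<noteq> x" if "r < length xs" "r \<noteq> q" for r
      using that q assms(5) by (simp add: x_def nth_eq_iff_index_eq)
    show ?thesis
      unfolding I_def Y_Suc[OF q] x_def[symmetric]
      using I Y_le[OF q] neq
      by (auto simp: I_def nm acc rest other screening_def layout_defs nth_append less_Suc_eq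
          x_def[symmetric])
  qed
  show ?thesis
  proof (rule reaches_mono[OF reaches_While[where I = I and k = "length xs" and T = "\<lambda>_. 9"]], goal_cases)
    case 1
    then show ?case using assms by (auto simp: I_def Y_def holds_list_def)
  next
    case (2 q s)
    have "reaches D com_filter_step s 9 (I (Suc q))"
      using step[OF 2] by (rule reaches_straight[rotated]) (simp_all add: com_filter_step_def)
    then show ?case using 2 by (simp add: I_def)
  next
    case (3 s)
    then show ?case by (simp add: I_def)
  next
    case (5 s)
    then show ?case by (auto simp: I_def Y_def in_set_conv_nth)
  qed simp
qed

lemma com_screen_correct:
  assumes "params n \<epsilon> s" "zeroed s" "unscreened s" "holds_list s [0..<n]"
  shows "reaches D com_screen s
    (20 * screen_size n \<epsilon> + 10 * snd (screen n \<epsilon> D (screen_size n \<epsilon>)) + 5)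
    (\<lambda>s. params n \<epsilon> s \<and> zeroed s \<and> drawn s = screen_size n \<epsilon> \<and> holds_list s (selected n \<epsilon> D))"
proof -
  let ?sc = "screen n \<epsilon> D"
  define I where "I t s \<longleftrightarrow> screening n \<epsilon> t s \<and> holds_list s (fst (?sc t)) \<and>
    nmem s ''w'' 0 = snd (?sc t) \<and> (\<forall>x\<in>set (fst (?sc t)). rmem s ''acc'' x = score D t x)" for t s
  \<comment> \<open>The cost of a round is charged to the work that \<open>screen\<close> counts in
    it, so the total telescopes to ten times the final work count plus a constant per
    example.\<close>
  define T where "T t = 18 + 10 * (snd (?sc (Suc t)) - snd (?sc t))" for t
  have step: "reaches D com_screen_step s (T t) (I (Suc t))" if I: "I t s" for t s
  proof -
    obtain xs w where sc: "?sc t = (xs, w)" by fastforce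
    have dist: "distinct xs" using screen_sound[of n \<epsilon> D t] sc by simp
    define s' where "s' = effect D (incr ''t'') (effect D Draw s)"
    have s': "screening n \<epsilon> (Suc t) s'" "cur_point s' = fst (D t)" "cur_label s' = snd (D t)"
      "holds_list s' xs" "nmem s' ''w'' 0 = w"
      "\<And>x. x \<in> set xs \<Longrightarrow> rmem s' ''acc'' x = score D t x"
      using I by (auto simp: s'_def I_def sc screening_def layout_defs)
    let ?b = "RLess (rv ''B'') (OfNat (NAdd (nv ''w'') (nv ''k'')))"
    let ?else = "[nset ''w'' (NAdd (nv ''w'') (nv ''k'')), nset ''q'' (N 0), nset ''j'' (N 0),
        While (NLess (nv ''q'') (nv ''k'')) com_filter_step,
        nset ''k'' (nv ''j'')]"
    have b: "bval ?b s' \<longleftrightarrow> budget n \<epsilon> < real (w + length xs)"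
      using s' by (simp add: screening_def layout_defs)
    have "reaches D (Cond ?b (nset ''k'' (N 0)) (block ?else)) s' (T t - 3) (I (Suc t))"
    proof (cases "bval ?b s'")
      case True
      then have "?sc (Suc t) = ([], w)" using b by (simp add: sc)
      then have "I (Suc t) (effect D (nset ''k'' (N 0)) s')"
        using s' by (simp add: I_def screening_def layout_defs)
      then have "reaches D (nset ''k'' (N 0)) s' (T t - 4) (I (Suc t))"
        by (rule reaches_straight[rotated]) (simp_all add: T_def)
      then have "reaches D (Cond ?b (nset ''k'' (N 0)) (block ?else)) s' (T t - 4 + 1) (I (Suc t))"
        using True by (intro reaches_Cond) auto
      then show ?thesis by (rule reaches_mono) (auto simp: T_def)
    next
      case False
      let ?ys = "filter (passes \<epsilon> D (Suc t)) xs"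
      have sc': "?sc (Suc t) = (?ys, w + length xs)" using False b by (simp add: sc)
      then have T: "T t = 18 + 10 * length xs" by (simp add: T_def sc)
      let ?s = "effect D (nset ''j'' (N 0)) (effect D (nset ''q'' (N 0))
        (effect D (nset ''w'' (NAdd (nv ''w'') (nv ''k''))) s'))"
      have "reaches D (While (NLess (nv ''q'') (nv ''k'')) com_filter_step) ?s (10 * length xs + 1)
        (\<lambda>s. screening n \<epsilon> (Suc t) s \<and> nmem s ''w'' 0 = w + length xs \<and>
          nmem s ''j'' 0 = length ?ys \<and> (\<forall>r<length ?ys. nmem s ''cand'' r = ?ys ! r) \<and>
          (\<forall>x\<in>set xs. rmem s ''acc'' x = score D (Suc t) x))"
        by (rule filter_loop_correct) (use s' dist in \<open>simp_all add: screening_def layout_defs\<close>)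
      then have *: "reaches D (block [While (NLess (nv ''q'') (nv ''k'')) com_filter_step,
          nset ''k'' (nv ''j'')]) ?s (10 * length xs + 1 + 2) (I (Suc t))"
        unfolding I_def sc' fst_conv snd_conv
        by (rule reaches_block_Cons) (intro reaches_straight, simp_all add: screening_def layout_defs)
      have "reaches D (block ?else) s' (3 + (10 * length xs + 1 + 2)) (I (Suc t))"
        by (rule reaches_mono[OF reaches_straight_Cons[OF _ reaches_straight_Cons2[OF _ _ *]]]) simp_all
      then have "reaches D (Cond ?b (nset ''k'' (N 0)) (block ?else)) s'
          (3 + (10 * length xs + 1 + 2) + 1) (I (Suc t))"
        using False by (intro reaches_Cond) auto
      then show ?thesis by (rule reaches_mono) (auto simp: T)
    qed
    note * = reaches_last[OF this, unfolded s'_def]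
    have "reaches D com_screen_step s (2 + (T t - 3 + 1)) (I (Suc t))"
      unfolding com_screen_step_def
      by (rule reaches_mono[OF reaches_straight_Cons2[OF _ _ *]]) simp_all
    then show ?thesis by (rule reaches_mono) (auto simp: T_def)
  qed
  have mono: "snd (?sc t) \<le> snd (?sc (Suc t))" for t
    by (simp add: split_beta)
  have sum_T: "(\<Sum>i<m. T i + 1) = 19 * m + 10 * snd (?sc m)" for m
  proof (induction m)
    case (Suc m)
    then show ?case using mono[of m] by (simp add: T_def del: screen.simps)
  qed simp
  have "reaches D (While (RLess (OfNat (nv ''t'')) (rv ''M'')) com_screen_step) s
      ((\<Sum>i<screen_size n \<epsilon>. T i + 1) + 1) (I (screen_size n \<epsilon>))"
  proof (rule reaches_While)
    show "I 0 s" using assms by (simp add: I_def screening_def layout_defs score_def)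
  next
    fix t s assume "t < screen_size n \<epsilon>" "I t s"
    then show "bval (RLess (OfNat (nv ''t'')) (rv ''M'')) s \<and> reaches D com_screen_step s (T t) (I (Suc t))"
      using step[of t s] by (simp add: I_def screening_def layout_defs less_screen_size_iff)
  next
    fix s assume "I (screen_size n \<epsilon>) s"
    then show "\<not> bval (RLess (OfNat (nv ''t'')) (rv ''M'')) s"
      using less_screen_size_iff[of "screen_size n \<epsilon>" n \<epsilon>] by (simp add: I_def screening_def layout_defs)
  qed
  then have "reaches D com_screen s ((\<Sum>i<screen_size n \<epsilon>. T i + 1) + 1 + 3)
    (\<lambda>s. params n \<epsilon> s \<and> zeroed s \<and> drawn s = screen_size n \<epsilon> \<and> holds_list s (selected n \<epsilon> D))"
    unfolding com_screen_def
  proof (rule reaches_block_Cons)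
    fix s assume "I (screen_size n \<epsilon>) s"
    then show "reaches D (block [Cond (RLess (RDiv (rnum 4) (rv ''al'')) (OfNat (nv ''k'')))
        (nset ''k'' (N 0)) Skip]) s 3
      (\<lambda>s. params n \<epsilon> s \<and> zeroed s \<and> drawn s = screen_size n \<epsilon> \<and> holds_list s (selected n \<epsilon> D))"
      by (intro reaches_straight) (auto simp: I_def screening_def layout_defs selected_def Let_def)
  qed
  then show ?thesis unfolding sum_T by (rule reaches_mono) simp_all
qed

section \<open>Building the low-degree sets\<close>

lemma family_sound:
  assumes "distinct xs" "q \<le> length xs"
  shows "distinct (family d xs q) \<and>
    set (family d xs q) = {S. S \<subseteq> set (take q xs) \<and> card S \<le> d}"
  using assms(2)
proof (induction q)
  case 0
  then show ?case by auto
next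
  case (Suc q)
  let ?x = "xs ! q" and ?A = "set (take q xs)"
  have A: "set (take (Suc q) xs) = insert ?x ?A" using Suc by (simp add: take_Suc_conv_app_nth)
  have x: "?x \<notin> ?A"
    using Suc assms(1) by (auto simp: in_set_conv_nth nth_eq_iff_index_eq)
  have IH: "distinct (family d xs q)" "set (family d xs q) = {S. S \<subseteq> ?A \<and> card S \<le> d}"
    using Suc by auto
  have inj: "inj_on (insert ?x) {S. S \<subseteq> ?A}"
    by (rule inj_on_inverseI[where g = "\<lambda>S. S - {?x}"]) (use x in auto)
  have "set (family d xs (Suc q)) =
      {S. S \<subseteq> ?A \<and> card S \<le> d} \<union> insert ?x ` {S. S \<subseteq> ?A \<and> card S < d}"
    using IH by auto
  moreover have "distinct (family d xs (Suc q))"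
    using IH x inj by (auto simp: distinct_map intro: inj_on_subset)
  ultimately show ?case using x by (simp add: A subsets_card_insert)
qed

lemma length_family_mono: "q \<le> r \<Longrightarrow> length (family d xs q) \<le> length (family d xs r)"
  by (induction r rule: dec_induct) auto

lemma encodes_extend:
  assumes "encodes s E" "p < length E" "x \<notin> E ! p"
    and "nmem s' ''N'' 0 = Suc (length E)" "nmem s' ''par'' = (nmem s ''par'')(length E := p)"
      "nmem s' ''var'' = (nmem s ''var'')(length E := x)"
      "nmem s' ''g'' = (nmem s ''g'')(length E := Suc (nmem s ''g'' p))"
  shows "encodes s' (E @ [insert x (E ! p)])"
  using assms unfolding encodes_def by (auto simp: nth_append less_Suc_eq)

definition extending :: "nat \<Rightarrow> real \<Rightarrow> nat \<Rightarrow> nat list \<Rightarrow> state \<Rightarrow> bool" where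
  "extending n \<epsilon> m xs s \<longleftrightarrow> params n \<epsilon> s \<and> zeroed s \<and> drawn s = m \<and> holds_list s xs"

text \<open>The length of the list is frozen in \<open>c\<close> before the loop: entries appended
  meanwhile lie beyond \<open>c\<close> and are not extended by the same coordinate again.\<close>

lemma extend_loop_correct:
  assumes "extending n \<epsilon> m xs s" "encodes s E" "nmem s ''q'' 0 = q" "q < length xs"
    and "\<And>S. S \<in> set E \<Longrightarrow> xs ! q \<notin> S" "nmem s ''c'' 0 = length E" "nmem s ''p'' 0 = 0"
  shows "reaches D (While (NLess (nv ''p'') (nv ''c'')) com_extend_step) s (9 * length E + 1)
    (\<lambda>s. extending n \<epsilon> m xs s \<and> nmem s ''q'' 0 = q \<and>
      encodes s (E @ map (insert (xs ! q)) (filter (\<lambda>S. card S < deg_bound \<epsilon>) E)))"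
proof -
  define G where "G p = E @ map (insert (xs ! q)) (filter (\<lambda>S. card S < deg_bound \<epsilon>) (take p E))" for p
  define I where "I p s \<longleftrightarrow> extending n \<epsilon> m xs s \<and> nmem s ''q'' 0 = q \<and> encodes s (G p) \<and>
    nmem s ''c'' 0 = length E \<and> nmem s ''p'' 0 = p" for p s
  have step: "I (Suc p) (effect D com_extend_step s)" if p: "p < length E" and I: "I p s" for p s
  proof -
    let ?s = "effect D com_extend_step s"
    have G: "length E \<le> length (G p)" "G p ! p = E ! p" "G p \<noteq> []" using p by (auto simp: G_def nth_append)
    have deg: "nmem s ''g'' p = card (E ! p)" and len: "nmem s ''N'' 0 = length (G p)"
      using I G p by (auto simp: I_def encodes_def)
    have vals: "nmem s ''p'' 0 = p" "nmem s ''q'' 0 = q" "nmem s ''d'' 0 = deg_bound \<epsilon>"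
      "nmem s ''cand'' q = xs ! q"
      using I assms(4) by (auto simp: I_def extending_def layout_defs)
    have rest: "rmem ?s = rmem s" "drawn ?s = drawn s" "emitted ?s = emitted s"
      by (simp_all add: com_extend_step_def)
    show ?thesis
    proof (cases "card (E ! p) < deg_bound \<epsilon>")
      case True
      have nm: "nmem ?s = (nmem s)(''par'' := (nmem s ''par'')(length (G p) := p),
          ''var'' := (nmem s ''var'')(length (G p) := xs ! q),
          ''g'' := (nmem s ''g'')(length (G p) := Suc (nmem s ''g'' p)),
          ''N'' := (nmem s ''N'')(0 := Suc (length (G p))), ''p'' := (nmem s ''p'')(0 := Suc p))"
        using True by (simp add: com_extend_step_def vals deg len)
      have "G (Suc p) = G p @ [insert (xs ! q) (G p ! p)]"
        unfolding G(2) using True p by (simp add: G_def take_Suc_conv_app_nth)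
      moreover have "encodes ?s (G p @ [insert (xs ! q) (G p ! p)])"
      proof (rule encodes_extend)
        show "encodes s (G p)" using I by (simp add: I_def)
        show "xs ! q \<notin> G p ! p" unfolding G(2) using p assms(5) by auto
      qed (use p G nm in simp_all)
      ultimately show ?thesis
        using I G(3) by (simp add: I_def extending_def layout_defs nm rest)
    next
      case False
      have nm: "nmem ?s = (nmem s)(''p'' := (nmem s ''p'')(0 := Suc p))"
        using False by (simp add: com_extend_step_def vals deg)
      have "G (Suc p) = G p" using False p by (simp add: G_def take_Suc_conv_app_nth)
      then show ?thesis
        using I by (simp add: I_def extending_def layout_defs encodes_def nm rest)
    qed
  qed
  show ?thesis
  proof (rule reaches_mono[OF reaches_While[where I = I and k = "length E" and T = "\<lambda>_. 8"]], goal_cases)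
    case 1
    then show ?case using assms by (simp add: I_def G_def)
  next
    case (2 p s)
    have "reaches D com_extend_step s 8 (I (Suc p))"
      using step[OF 2] by (rule reaches_straight[rotated]) (simp_all add: com_extend_step_def)
    then show ?case using 2 by (simp add: I_def)
  qed (simp_all add: I_def G_def)
qed

lemma com_family_correct:
  assumes "extending n \<epsilon> m xs s" "distinct xs"
  defines "E \<equiv> family (deg_bound \<epsilon>) xs"
  shows "reaches D com_family s (length xs * (9 * length (E (length xs)) + 7) + 5)
    (\<lambda>s. extending n \<epsilon> m xs s \<and> encodes s (E (length xs)))"
proof -
  define I where "I q s \<longleftrightarrow> extending n \<epsilon> m xs s \<and> encodes s (E q) \<and> nmem s ''q'' 0 = q" for q s
  let ?body = "[nset ''c'' (nv ''N''), nset ''p'' (N 0),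
      While (NLess (nv ''p'') (nv ''c'')) com_extend_step, incr ''q'']"
  have step: "reaches D (block ?body) s (9 * length (E (length xs)) + 6) (I (Suc q))"
    if q: "q < length xs" and I: "I q s" for q s
  proof -
    let ?s = "effect D (nset ''p'' (N 0)) (effect D (nset ''c'' (nv ''N'')) s)"
    have notin: "xs ! q \<notin> S" if "S \<in> set (E q)" for S
    proof -
      have "S \<subseteq> set (take q xs)" using that family_sound[OF assms(2), of q] q by (auto simp: E_def)
      moreover have "xs ! q \<notin> set (take q xs)"
        using q assms(2) by (auto simp: in_set_conv_nth nth_eq_iff_index_eq)
      ultimately show ?thesis by blast
    qed
    have len: "length (E q) \<le> length (E (length xs))"
      unfolding E_def using q by (intro length_family_mono) auto
    have "reaches D (While (NLess (nv ''p'') (nv ''c'')) com_extend_step) ?s (9 * length (E q) + 1)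
      (\<lambda>s. extending n \<epsilon> m xs s \<and> nmem s ''q'' 0 = q \<and> encodes s (E (Suc q)))"
      unfolding E_def family.simps
    proof (rule extend_loop_correct)
      show "xs ! q \<notin> S" if "S \<in> set (family (deg_bound \<epsilon>) xs q)" for S
        using notin that by (simp add: E_def)
    qed (use I q in \<open>simp_all add: I_def E_def extending_def layout_defs encodes_def\<close>)
    then have *: "reaches D (block [While (NLess (nv ''p'') (nv ''c'')) com_extend_step, incr ''q''])
        ?s (9 * length (E q) + 1 + 2) (I (Suc q))"
      unfolding I_def
      by (rule reaches_block_Cons)
        (intro reaches_straight, simp_all add: extending_def layout_defs encodes_def)
    have "reaches D (block ?body) s (2 + (9 * length (E q) + 1 + 2)) (I (Suc q))"
      by (rule reaches_mono[OF reaches_straight_Cons2[OF _ _ *]]) simp_all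
    then show ?thesis by (rule reaches_mono) (use len in auto)
  qed
  let ?s = "effect D (nset ''q'' (N 0)) (effect D (nset ''N'' (N 1)) s)"
  have "I 0 ?s"
    using assms by (simp add: I_def E_def extending_def layout_defs encodes_def)
  then have "reaches D (While (NLess (nv ''q'') (nv ''k'')) (block ?body)) ?s
    ((\<Sum>q<length xs. 9 * length (E (length xs)) + 6 + 1) + 1) (I (length xs))"
  proof (rule reaches_While)
    fix q s assume "q < length xs" "I q s"
    then show "bval (NLess (nv ''q'') (nv ''k'')) s \<and>
      reaches D (block ?body) s (9 * length (E (length xs)) + 6) (I (Suc q))"
      using step[of q s] by (simp add: I_def extending_def layout_defs)
  qed (simp add: I_def extending_def layout_defs)
  note * = reaches_last[OF this]
  have "reaches D com_family s (2 + ((\<Sum>q<length xs. 9 * length (E (length xs)) + 6 + 1) + 1 + 1)) (I (length xs))"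
    unfolding com_family_def
    by (rule reaches_mono[OF reaches_straight_Cons2[OF _ _ *]]) simp_all
  then show ?thesis
    by (rule reaches_mono) (simp_all add: I_def algebra_simps)
qed

section \<open>Fitting the coefficients\<close>

definition fitted ::
  "(nat \<Rightarrow> point \<times> real) \<Rightarrow> real \<Rightarrow> nat \<Rightarrow> nat set list \<Rightarrow> nat \<Rightarrow> state \<Rightarrow> bool" where
  "fitted D \<epsilon> m E t s \<longleftrightarrow> rmem s ''eps'' 0 = \<epsilon> \<and> encodes s E \<and> emitted s = [] \<and>
    nmem s ''t'' 0 = t \<and> drawn s = m + t \<and>
    (\<forall>p<length E. rmem s ''sum'' p =
      (\<Sum>j<t. character (E ! p) (fst (D (m + j))) * snd (D (m + j))))"

lemma fit_loop_correct:
  assumes "encodes s E" "rmem s ''val'' 0 = 1" "nmem s ''p'' 0 = 1"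
  shows "reaches D (While (NLess (nv ''p'') (nv ''N'')) com_fit_step) s (6 * length E + 1)
    (\<lambda>s'. rmem s' ''eps'' 0 = rmem s ''eps'' 0 \<and> encodes s' E \<and> emitted s' = emitted s \<and>
      nmem s' ''t'' 0 = nmem s ''t'' 0 \<and> drawn s' = drawn s \<and>
      rmem s' ''sum'' 0 = rmem s ''sum'' 0 \<and>
      (\<forall>p. 0 < p \<and> p < length E \<longrightarrow> rmem s' ''sum'' p =
        rmem s ''sum'' p + character (E ! p) (cur_point s) * cur_label s))"
proof -
  define x where "x = cur_point s"
  define y where "y = cur_label s"
  define A where "A = rmem s ''sum''"
  have E: "E \<noteq> []" "E ! 0 = {}" using assms by (auto simp: encodes_def)
  define I where "I i s' \<longleftrightarrow> rmem s' ''eps'' 0 = rmem s ''eps'' 0 \<and> encodes s' E \<and>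
    emitted s' = emitted s \<and> nmem s' ''t'' 0 = nmem s ''t'' 0 \<and> drawn s' = drawn s \<and>
    cur_point s' = x \<and> cur_label s' = y \<and> nmem s' ''p'' 0 = Suc i \<and>
    (\<forall>p\<le>i. rmem s' ''val'' p = character (E ! p) x) \<and>
    (\<forall>p. rmem s' ''sum'' p = (if 0 < p \<and> p \<le> i then A p + character (E ! p) x * y else A p))" for i s'
  have step: "I (Suc i) (effect D com_fit_step s')" if i: "Suc i < length E" and I: "I i s'" for i s'
  proof -
    let ?s = "effect D com_fit_step s'"
    define par where "par = nmem s' ''par'' (Suc i)"
    define var where "var = nmem s' ''var'' (Suc i)"
    have enc: "par < Suc i" "var \<notin> E ! par" "E ! Suc i = insert var (E ! par)" "finite (E ! par)"
      using I i by (auto simp: I_def encodes_def par_def var_def)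
    have ch: "character (E ! Suc i) x = pm (x var) * character (E ! par) x"
      using enc by (simp add: character_insert)
    have p: "nmem s' ''p'' 0 = Suc i" and pt: "cur_point s' = x" "cur_label s' = y"
      and v: "rmem s' ''val'' par = character (E ! par) x"
      using I enc by (auto simp: I_def)
    have "rmem ?s = (rmem s')(''val'' := (rmem s' ''val'')(Suc i := character (E ! Suc i) x),
        ''sum'' := (rmem s' ''sum'')(Suc i := rmem s' ''sum'' (Suc i) + character (E ! Suc i) x * y))"
      unfolding ch by (simp add: com_fit_step_def p pt par_def[symmetric] var_def[symmetric] v pm_def)
    moreover have "nmem ?s = (nmem s')(''p'' := (nmem s' ''p'')(0 := Suc (Suc i)))"
      by (simp add: com_fit_step_def p)
    moreover have "cur_point ?s = x" "cur_label ?s = y" "drawn ?s = drawn s'" "emitted ?s = emitted s'"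
      by (simp_all add: com_fit_step_def pt)
    ultimately show ?thesis using I by (simp add: I_def encodes_def le_Suc_eq)
  qed
  show ?thesis
  proof (rule reaches_mono[OF reaches_While[where I = I and k = "length E - 1" and T = "\<lambda>_. 5"]], goal_cases)
    case 1
    then show ?case using assms E by (simp add: I_def x_def y_def A_def)
  next
    case (2 i s')
    then have "reaches D com_fit_step s' 5 (I (Suc i))"
      using step[of i s'] by (intro reaches_straight) (simp_all add: com_fit_step_def)
    then show ?case using 2 by (simp add: I_def encodes_def)
  next
    case (3 s')
    then show ?case using E by (simp add: I_def encodes_def)
  next
    case (5 s')
    then show ?case using E by (auto simp: I_def x_def y_def A_def)
  qed simp
qed

lemma com_fit_correct:
  assumes "0 < \<epsilon>" "rmem s ''eps'' 0 = \<epsilon>" "encodes s E" "zeroed s" "drawn s = m"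
  shows "reaches D com_fit s (fit_size \<epsilon> (length E) * (6 * length E + 8) + 3)
    (fitted D \<epsilon> m E (fit_size \<epsilon> (length E)))"
proof -
  let ?T = "fit_size \<epsilon> (length E)"
  let ?loop = "While (NLess (nv ''p'') (nv ''N'')) com_fit_step"
  let ?body = "[Draw, incr ''t'', rset ''val'' (rnum 1), rset ''sum'' (RAdd (rv ''sum'') Label),
    nset ''p'' (N 1), ?loop]"
  let ?b = "RLess (RMul (RMul (OfNat (nv ''t'')) (rv ''eps'')) (rv ''eps''))
    (RMul (rnum 40) (OfNat (nv ''N'')))"
  have E: "E \<noteq> []" "E ! 0 = {}" using assms by (auto simp: encodes_def)
  have step: "reaches D (block ?body) s (6 * length E + 7) (fitted D \<epsilon> m E (Suc t))"
    if fit: "fitted D \<epsilon> m E t s" for t s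
  proof -
    let ?s = "effect D (nset ''p'' (N 1)) (effect D (rset ''sum'' (RAdd (rv ''sum'') Label))
      (effect D (rset ''val'' (rnum 1)) (effect D (incr ''t'') (effect D Draw s))))"
    have "reaches D ?loop ?s (6 * length E + 1) (fitted D \<epsilon> m E (Suc t))"
    proof (rule reaches_mono[OF fit_loop_correct])
      show "encodes ?s E" using fit by (simp add: fitted_def encodes_def)
      fix s' assume s': "rmem s' ''eps'' 0 = rmem ?s ''eps'' 0 \<and> encodes s' E \<and> emitted s' = emitted ?s \<and>
        nmem s' ''t'' 0 = nmem ?s ''t'' 0 \<and> drawn s' = drawn ?s \<and>
        rmem s' ''sum'' 0 = rmem ?s ''sum'' 0 \<and>
        (\<forall>p. 0 < p \<and> p < length E \<longrightarrow> rmem s' ''sum'' p =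
          rmem ?s ''sum'' p + character (E ! p) (cur_point ?s) * cur_label ?s)"
      have "rmem s' ''sum'' p =
          (\<Sum>j<Suc t. character (E ! p) (fst (D (m + j))) * snd (D (m + j)))" if "p < length E" for p
        using s' fit that E by (cases "p = 0") (simp_all add: fitted_def)
      then show "fitted D \<epsilon> m E (Suc t) s'" using s' fit by (simp add: fitted_def)
    qed simp_all
    note * = reaches_last[OF this]
    show ?thesis
      by (rule reaches_mono[OF reaches_straight_Cons2[OF _ _ reaches_straight_Cons2[OF _ _
          reaches_straight_Cons[OF _ *]]]]) simp_all
  qed
  have "fitted D \<epsilon> m E 0 (effect D (nset ''t'' (N 0)) s)"
    using assms by (simp add: fitted_def encodes_def zeroed_def)
  then have "reaches D (While ?b (block ?body)) (effect D (nset ''t'' (N 0)) s)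
    ((\<Sum>t<?T. 6 * length E + 7 + 1) + 1) (fitted D \<epsilon> m E ?T)"
  proof (rule reaches_While)
    fix t s assume "t < ?T" "fitted D \<epsilon> m E t s"
    then show "bval ?b s \<and> reaches D (block ?body) s (6 * length E + 7) (fitted D \<epsilon> m E (Suc t))"
      using step[of t s] assms(1) by (simp add: fitted_def encodes_def less_fit_size_iff)
  next
    fix s assume "fitted D \<epsilon> m E ?T s"
    then show "\<not> bval ?b s"
      using less_fit_size_iff[OF assms(1), of ?T "length E"] by (simp add: fitted_def encodes_def)
  qed
  note * = reaches_last[OF this]
  show ?thesis unfolding com_fit_def
    by (rule reaches_mono[OF reaches_straight_Cons[OF _ *]]) (simp_all add: algebra_simps)
qed

section \<open>The output circuit\<close>

lemma circuit_vals_snoc: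
  "circuit_vals x gs = vs \<Longrightarrow> gate_val x vs g = v \<Longrightarrow> circuit_vals x (gs @ [g]) = vs @ [v]"
  by (simp add: circuit_vals_def)

lemma wire_append_left: "j < length vs \<Longrightarrow> wire (vs @ ws) j = vs ! j"
  by (simp add: wire_def nth_append)

lemma wire_append_right: "r < length ws \<Longrightarrow> wire (vs @ ws) (length vs + r) = ws ! r"
  by (simp add: wire_def)

definition gates_ok :: "nat set list \<Rightarrow> (nat \<Rightarrow> real) \<Rightarrow> nat \<Rightarrow> circuit \<Rightarrow> bool" where
  "gates_ok E c p gs \<longleftrightarrow> (\<forall>x. let vs = circuit_vals x gs in length vs = 7 * p \<and>
    vs ! 0 = 2 \<and> vs ! 1 = -1 \<and> (\<forall>r<p. vs ! (7 * r + 3) = character (E ! r) x) \<and>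
    vs ! (7 * p - 1) = (\<Sum>r<p. c r * character (E ! r) x))"

lemma gates_ok_Suc:
  assumes "gates_ok E c p gs" "0 < p" "q < p" "v \<notin> E ! q" "finite (E ! q)" "E ! p = insert v (E ! q)"
  shows "gates_ok E c (Suc p) (gs @ [GVar v, GMul (7 * p) 0, GAdd (7 * p + 1) 1,
    GMul (7 * p + 2) (7 * q + 3), GConst (c p), GMul (7 * p + 3) (7 * p + 4), GAdd (7 * p + 5) (7 * p - 1)])"
  unfolding gates_ok_def
proof
  fix x
  define vs where "vs = circuit_vals x gs"
  have vs: "length vs = 7 * p" "vs ! 0 = 2" "vs ! 1 = -1" "\<And>r. r < p \<Longrightarrow> vs ! (7 * r + 3) = character (E ! r) x"
    "vs ! (7 * p - 1) = (\<Sum>r<p. c r * character (E ! r) x)"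
    using assms(1) unfolding gates_ok_def vs_def Let_def by blast+
  define b where "b = (of_bool (x v) :: real)"
  define ch where "ch = character (E ! p) x"
  have ch: "ch = (b * 2 + -1) * character (E ! q) x"
    using assms by (simp add: ch_def b_def character_insert pm_def)
  define S where "S = (\<Sum>r<p. c r * character (E ! r) x)"
  have left: "wire (vs @ ws) 0 = 2" "wire (vs @ ws) 1 = -1"
      "wire (vs @ ws) (7 * q + 3) = character (E ! q) x" "wire (vs @ ws) (7 * p - 1) = S" for ws
    using vs assms(2,3) by (simp_all add: wire_append_left S_def)
  have right: "wire (vs @ ws) (7 * p + r) = ws ! r" if "r < length ws" for ws r
    using wire_append_right[OF that, of vs] vs(1) by simp
  have right1: "wire (vs @ ws) (Suc (7 * p)) = ws ! 1" if "1 < length ws" for ws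
    using right[of 1 ws] that by simp
  have right2: "wire (vs @ ws) (Suc (Suc (7 * p))) = ws ! 2" if "2 < length ws" for ws
    using right[of 2 ws] that by simp
  note left = left[unfolded One_nat_def]
  have right0: "wire (vs @ ws) (7 * p) = ws ! 0" if "ws \<noteq> []" for ws
    using right[of 0 ws] that by simp
  let ?g1 = "GVar v" and ?g2 = "GMul (7 * p) 0" and ?g3 = "GAdd (7 * p + 1) 1"
    and ?g4 = "GMul (7 * p + 2) (7 * q + 3)" and ?g5 = "GConst (c p)"
    and ?g6 = "GMul (7 * p + 3) (7 * p + 4)" and ?g7 = "GAdd (7 * p + 5) (7 * p - 1)"
  have "circuit_vals x (gs @ [?g1]) = vs @ [b]"
    by (rule circuit_vals_snoc) (simp_all add: vs_def b_def)
  from circuit_vals_snoc[OF this, of ?g2 "b * 2"]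
  have "circuit_vals x (gs @ [?g1, ?g2]) = vs @ [b, b * 2]"
    by (simp add: left right0)
  from circuit_vals_snoc[OF this, of ?g3 "b * 2 + -1"]
  have "circuit_vals x (gs @ [?g1, ?g2, ?g3]) = vs @ [b, b * 2, b * 2 + -1]"
    by (simp add: left right1 del: add_uminus_conv_diff)
  from circuit_vals_snoc[OF this, of ?g4 ch]
  have "circuit_vals x (gs @ [?g1, ?g2, ?g3, ?g4]) = vs @ [b, b * 2, b * 2 + -1, ch]"
    by (simp add: left right2 ch del: add_uminus_conv_diff)
  from circuit_vals_snoc[OF this, of ?g5 "c p"]
  have "circuit_vals x (gs @ [?g1, ?g2, ?g3, ?g4, ?g5]) = vs @ [b, b * 2, b * 2 + -1, ch, c p]"
    by simp
  from circuit_vals_snoc[OF this, of ?g6 "ch * c p"]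
  have "circuit_vals x (gs @ [?g1, ?g2, ?g3, ?g4, ?g5, ?g6]) =
      vs @ [b, b * 2, b * 2 + -1, ch, c p, ch * c p]"
    by (simp add: right)
  from circuit_vals_snoc[OF this, of ?g7 "ch * c p + S"]
  have all: "circuit_vals x (gs @ [?g1, ?g2, ?g3, ?g4, ?g5, ?g6, ?g7]) =
      vs @ [b, b * 2, b * 2 + -1, ch, c p, ch * c p, ch * c p + S]"
    by (simp add: left right)
  have r: "(vs @ [b, b * 2, b * 2 + -1, ch, c p, ch * c p, ch * c p + S]) ! (7 * r + 3) =
      character (E ! r) x" if "r < Suc p" for r
    using that vs(1,4) by (cases "r = p") (simp_all add: nth_append ch_def)
  show "let vs = circuit_vals x (gs @ [?g1, ?g2, ?g3, ?g4, ?g5, ?g6, ?g7]) in length vs = 7 * Suc p \<and>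
    vs ! 0 = 2 \<and> vs ! 1 = -1 \<and> (\<forall>r<Suc p. vs ! (7 * r + 3) = character (E ! r) x) \<and>
    vs ! (7 * Suc p - 1) = (\<Sum>r<Suc p. c r * character (E ! r) x)"
    unfolding all Let_def using r vs(1,2,3) assms(2)
    by (simp add: nth_append S_def ch_def mult.commute)
qed

lemma nval_seven_times [simp]: "nval (seven_times e) s = 7 * nval e s"
  by (simp add: seven_times_def)

lemma com_emit_correct:
  assumes "fitted D \<epsilon> m E t s" "distinct E"
  shows "reaches D com_emit s (10 * length E + 10)
    (\<lambda>s. drawn s = m + t \<and>
      (\<forall>x. circuit_fun (emitted s) x = (\<Sum>S\<in>set E. estimate D m t S * character S x)))"
proof -
  have E: "E \<noteq> []" "E ! 0 = {}" using assms by (auto simp: fitted_def encodes_def)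
  define c where "c p = estimate D m t (E ! p)" for p
  define I where "I i s \<longleftrightarrow> encodes s E \<and> nmem s ''t'' 0 = t \<and> drawn s = m + t \<and>
    (\<forall>p<length E. rmem s ''sum'' p / real t = c p) \<and> nmem s ''p'' 0 = Suc i \<and>
    gates_ok E c (Suc i) (emitted s)" for i s
  have step: "I (Suc i) (effect D com_emit_step s)" if i: "Suc i < length E" and I: "I i s" for i s
  proof -
    let ?s = "effect D com_emit_step s"
    let ?p = "Suc i" and ?q = "nmem s ''par'' (Suc i)" and ?v = "nmem s ''var'' (Suc i)"
    have p: "nmem s ''p'' 0 = ?p" and t: "nmem s ''t'' 0 = t"
      and sum: "rmem s ''sum'' ?p / real t = c ?p" using I i by (auto simp: I_def)
    have em: "emitted ?s = emitted s @ [GVar ?v, GMul (7 * ?p) 0, GAdd (7 * ?p + 1) 1,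
      GMul (7 * ?p + 2) (7 * ?q + 3), GConst (c ?p), GMul (7 * ?p + 3) (7 * ?p + 4),
      GAdd (7 * ?p + 5) (7 * ?p - 1)]"
      by (simp add: com_emit_step_def Let_def p t sum)
    have "gates_ok E c (Suc ?p) (emitted ?s)"
      unfolding em using I i by (intro gates_ok_Suc) (auto simp: I_def encodes_def)
    moreover have "nmem ?s = (nmem s)(''p'' := (nmem s ''p'')(0 := Suc ?p))" "rmem ?s = rmem s"
      "drawn ?s = drawn s"
      by (simp_all add: com_emit_step_def Let_def p)
    ultimately show ?thesis using I by (simp add: I_def encodes_def)
  qed
  let ?cs = "[Emit (GConst (rnum 2)), Emit (GConst (RSub (rnum 0) (rnum 1))), Emit (GConst (rnum 0)),
    Emit (GConst (rnum 1)), Emit (GConst (RDiv (rv ''sum'') (OfNat (nv ''t'')))),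
    Emit (GMul (N 3) (N 4)), Emit (GAdd (N 5) (N 2)), nset ''p'' (N 1)]"
  have start: "I 0 (effect D (block ?cs) s)"
  proof -
    have *: "(\<forall>p<length E. rmem s ''sum'' p / real t = c p)"
      using assms(1) by (simp add: fitted_def c_def estimate_def)
    then have "rmem s ''sum'' 0 / real t = c 0" using E by simp
    moreover have "emitted s = []" "nmem s ''t'' 0 = t" using assms(1) by (auto simp: fitted_def)
    \<comment> \<open>The empty set gets seven gates like every other entry: its character 1 sits at
      position 3, and gate 2 is a zero that serves as the empty partial sum.\<close>
    ultimately have "emitted (effect D (block ?cs) s) = [GConst 2, GConst (-1), GConst 0, GConst 1,
        GConst (c 0), GMul 3 4, GAdd 5 2]"
      by simp
    moreover have "gates_ok E c 1 [GConst 2, GConst (-1), GConst 0, GConst 1,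
        GConst (c 0), GMul 3 4, GAdd 5 2]"
      using E by (simp add: gates_ok_def circuit_vals_def wire_def Let_def)
    ultimately show ?thesis
      using assms(1) * by (simp add: I_def fitted_def encodes_def)
  qed
  have "reaches D (While (NLess (nv ''p'') (nv ''N'')) com_emit_step) (effect D (block ?cs) s)
    ((\<Sum>i<length E - 1. 9 + 1) + 1) (I (length E - 1))"
    using start
  proof (rule reaches_While)
    fix i s assume "i < length E - 1" "I i s"
    then show "bval (NLess (nv ''p'') (nv ''N'')) s \<and> reaches D com_emit_step s 9 (I (Suc i))"
      using step[of i s]
      by (auto simp: I_def encodes_def com_emit_step_def Let_def intro!: reaches_straight)
  qed (use E in \<open>simp add: I_def encodes_def\<close>)
  note * = reaches_last[OF this]
  have "reaches D (block (?cs @ [While (NLess (nv ''p'') (nv ''N'')) com_emit_step])) s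
      (cost (block ?cs) + ((\<Sum>i<length E - 1. 9 + 1) + 1 + 1)) (I (length E - 1))"
    by (rule reaches_straight_append[OF _ *]) simp
  then have "reaches D com_emit s
      (cost (block ?cs) + ((\<Sum>i<length E - 1. 9 + 1) + 1 + 1)) (I (length E - 1))"
    by (simp only: com_emit_def append.simps)
  then show ?thesis
  proof (rule reaches_mono)
    fix s assume I: "I (length E - 1) s"
    have "circuit_fun (emitted s) x = (\<Sum>S\<in>set E. estimate D m t S * character S x)" for x
    proof -
      have len: "Suc (length E - 1) = length E" using E by simp
      have gates: "gates_ok E c (length E) (emitted s)" using I len by (simp add: I_def)
      then have vs: "length (circuit_vals x (emitted s)) = 7 * length E"
        "circuit_vals x (emitted s) ! (7 * length E - 1) = (\<Sum>p<length E. c p * character (E ! p) x)"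
        unfolding gates_ok_def Let_def by blast+
      have "emitted s \<noteq> []" using vs(1) E by (auto simp: circuit_vals_def)
      moreover have "circuit_vals x (emitted s) \<noteq> []" using vs(1) E by auto
      ultimately have "circuit_fun (emitted s) x = (\<Sum>p<length E. c p * character (E ! p) x)"
        using vs by (simp add: circuit_fun_def last_conv_nth)
      also have "\<dots> = (\<Sum>S\<leftarrow>E. estimate D m t S * character S x)"
        by (simp add: sum_list_sum_nth c_def lessThan_atLeast0)
      also have "\<dots> = (\<Sum>S\<in>set E. estimate D m t S * character S x)"
        using assms(2) by (simp add: sum_list_distinct_conv_sum_set)
      finally show ?thesis .
    qed
    then show "drawn s = m + t \<and>
      (\<forall>x. circuit_fun (emitted s) x = (\<Sum>S\<in>set E. estimate D m t S * character S x))"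
      using I by (simp add: I_def)
  next
    show "cost (block ?cs) + ((\<Sum>i<length E - 1. 9 + 1) + 1 + 1) \<le> 10 * length E + 10"
      using E by (cases E) simp_all
  qed
qed

lemma com_main_correct:
  assumes "0 < \<epsilon>"
  shows "reaches D com_main (start n \<epsilon>) (main_cost n \<epsilon> D) (\<lambda>s. drawn s = main_samples n \<epsilon> D \<and>
    (\<forall>x. circuit_fun (emitted s) x = learned n \<epsilon> D x))"
proof -
  define d where "d = deg_bound \<epsilon>"
  define m where "m = screen_size n \<epsilon>"
  define xs where "xs = selected n \<epsilon> D"
  define k where "k = card (low_subsets d (set xs))"
  define t where "t = fit_size \<epsilon> k"
  define E where "E = family d xs (length xs)"
  have dist: "distinct xs"
    using screen_sound[of n \<epsilon> D m] by (simp add: xs_def selected_def Let_def m_def)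
  have E: "distinct E" "set E = low_subsets d (set xs)"
    using family_sound[OF dist, of "length xs" d] by (auto simp: E_def)
  then have len: "length E = k" by (simp add: k_def flip: distinct_card)
  let ?Q = "\<lambda>s. drawn s = m + t \<and> (\<forall>x. circuit_fun (emitted s) x =
      (\<Sum>S\<in>low_subsets d (set xs). estimate D m t S * character S x))"
  let ?w = "snd (screen n \<epsilon> D m)"
  have r7: "reaches D (block [com_emit]) s (10 * k + 10 + 1) ?Q" if "fitted D \<epsilon> m E t s" for s
    using reaches_last[OF com_emit_correct[OF that E(1)]] by (simp only: E(2) len)
  have r6: "reaches D (block [com_fit, com_emit]) s ((t * (6 * k + 8) + 3) + (10 * k + 10 + 1)) ?Q"
    if s: "extending n \<epsilon> m xs s" "encodes s E" for s
  proof (rule reaches_block_Cons[OF _ r7])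
    show "reaches D com_fit s (t * (6 * k + 8) + 3) (fitted D \<epsilon> m E t)"
      unfolding t_def len[symmetric] using s assms(1)
      by (intro com_fit_correct) (auto simp: extending_def params_def inputs_def)
  qed
  have r5: "reaches D (block [com_family, com_fit, com_emit]) s
      ((length xs * (9 * k + 7) + 5) + ((t * (6 * k + 8) + 3) + (10 * k + 10 + 1))) ?Q"
    if "extending n \<epsilon> m xs s" for s
    by (rule reaches_block_Cons[OF
        com_family_correct[OF that dist, folded d_def, folded E_def, unfolded len]])
      (use r6 in blast)
  have r4: "reaches D (block [com_screen, com_family, com_fit, com_emit]) s
      ((20 * m + 10 * ?w + 5) + ((length xs * (9 * k + 7) + 5) +
        ((t * (6 * k + 8) + 3) + (10 * k + 10 + 1)))) ?Q"
    if "params n \<epsilon> s \<and> zeroed s \<and> unscreened s \<and> holds_list s [0..<n]" for s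
    unfolding m_def
    by (rule reaches_block_Cons[OF com_screen_correct])
      (use that r5 in \<open>auto simp: extending_def xs_def m_def\<close>)
  have r3: "reaches D (block [com_init, com_screen, com_family, com_fit, com_emit]) s
      ((4 * n + 1) + ((20 * m + 10 * ?w + 5) + ((length xs * (9 * k + 7) + 5) +
        ((t * (6 * k + 8) + 3) + (10 * k + 10 + 1))))) ?Q"
    if "params n \<epsilon> s \<and> zeroed s \<and> unscreened s \<and> nmem s ''k'' 0 = 0" for s
    by (rule reaches_block_Cons[OF com_init_correct r4]) (use that in auto)
  have r2: "reaches D (block [com_params, com_init, com_screen, com_family, com_fit, com_emit]) s
      (5 + ((4 * n + 1) + ((20 * m + 10 * ?w + 5) + ((length xs * (9 * k + 7) + 5) +
        ((t * (6 * k + 8) + 3) + (10 * k + 10 + 1)))))) ?Q"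
    if "configured n \<epsilon> d (thr \<epsilon>) (lg n) s" for s
    by (rule reaches_block_Cons[OF com_params_correct r3]) (use that in \<open>simp_all add: d_def\<close>)
  have r1: "reaches D (block [com_log, com_params, com_init, com_screen, com_family, com_fit, com_emit]) s
      ((5 * lg n + 5) + (5 + ((4 * n + 1) + ((20 * m + 10 * ?w + 5) + ((length xs * (9 * k + 7) + 5) +
        ((t * (6 * k + 8) + 3) + (10 * k + 10 + 1))))))) ?Q"
    if "configured n \<epsilon> d (thr \<epsilon>) 0 s" for s
    by (rule reaches_block_Cons[OF com_log_correct[OF that] r2])
  note reaches_block_Cons[OF com_degree_correct[OF assms, folded d_def] r1, folded com_main_def]
  then show ?thesis
    unfolding main_cost_def main_samples_def family_size_def hypothesis_def Let_def
      d_def m_def xs_def k_def t_def .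
qed

section \<open>Complexity bounds\<close>

lemma card_small_subsets:
  assumes "finite A"
  shows "card (low_subsets d A) \<le> (card A + 1) ^ d"
  using assms
proof (induction A arbitrary: d rule: finite_induct)
  case empty
  have "{S. S \<subseteq> {} \<and> card S \<le> d} = {{}::nat set}" by auto
  then show ?case by simp
next
  case (insert a A)
  show ?case
  proof (cases d)
    case 0
    have "{S. S \<subseteq> insert a A \<and> card S \<le> 0} = {{}}"
      using insert finite_subset[of _ "insert a A"] by auto
    then show ?thesis using 0 by simp
  next
    case (Suc e)
    let ?Y = "{S. S \<subseteq> A \<and> card S \<le> e}"
    have fin: "finite ?Y" using insert by simp
    have "card {S. S \<subseteq> insert a A \<and> card S \<le> d} \<le>
        card {S. S \<subseteq> A \<and> card S \<le> d} + card (insert a ` ?Y)"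
      unfolding subsets_card_insert[OF insert.hyps] Suc less_Suc_eq_le by (rule card_Un_le)
    also have "\<dots> \<le> (card A + 1) ^ d + (card A + 1) ^ e"
      using insert.IH[of d] insert.IH[of e] card_image_le[OF fin, of "insert a"] by linarith
    also have "\<dots> = (card A + 2) * (card A + 1) ^ e" by (simp add: Suc)
    also have "\<dots> \<le> (card A + 2) * (card A + 2) ^ e" by (intro mult_left_mono power_mono) auto
    finally show ?thesis using insert Suc by simp
  qed
qed

text \<open>Complexity bounds are kept in the form \<open>z ^ i * y\<close> with \<open>z\<close> at
  least 2: a sum costs one exponent, a product adds exponents, and a numeral costs its binary
  logarithm. The large exponents below arise in this way and are not optimized.\<close>

lemma power_bound_add:
  fixes z a b y :: real
  assumes "2 \<le> z" "a \<le> z ^ i * y" "b \<le> z ^ i * y" "0 \<le> y" "i < j"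
  shows "a + b \<le> z ^ j * y"
proof -
  have "a + b \<le> 2 * (z ^ i * y)" using assms by simp
  also have "\<dots> \<le> z * (z ^ i * y)" using assms by (intro mult_right_mono) auto
  also have "\<dots> = z ^ Suc i * y" by simp
  also have "\<dots> \<le> z ^ j * y"
    using assms by (intro mult_right_mono power_increasing) auto
  finally show ?thesis .
qed

lemma power_bound_lift:
  fixes z a y :: real
  assumes "a \<le> z ^ i * y" "2 \<le> z" "i \<le> j" "0 \<le> y"
  shows "a \<le> z ^ j * y"
  using assms by (meson mult_right_mono order_trans power_increasing one_le_numeral)

lemma power_bound_mult:
  fixes z a b x y :: real
  assumes "a \<le> z ^ i * x" "b \<le> z ^ j * y" "0 \<le> a" "0 \<le> b"
  shows "a * b \<le> z ^ (i + j) * (x * y)"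
  using mult_mono[OF assms(1,2)] assms by (simp add: power_add mult_ac)

lemma numeral_le_power: "2 \<le> z \<Longrightarrow> c \<le> 2 ^ i \<Longrightarrow> c \<le> (z :: real) ^ i"
  by (meson order_trans power_mono zero_le_numeral)

lemma real_le_two_powr:
  fixes x :: real
  assumes x: "0 \<le> x"
  shows "x \<le> 2 powr x"
proof -
  have "1 / 2 \<le> ln (2::real)" using ln2_ge_two_thirds by simp
  then have "x \<le> 2 * ln 2 * x" using mult_right_mono[of "1/2" "ln 2" "2 * x"] x by simp
  \<comment> \<open>With t = ln 2 * x this is 2 t <= (1 + t/2)^2. Using 1 + t <= exp t directly
    would be too weak for large x because ln 2 < 1, so that bound is applied to t/2 and
    squared.\<close>
  also have "\<dots> \<le> (1 + ln 2 * x / 2)\<^sup>2"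
    using zero_le_power2[of "1 - ln 2 * x / 2"] by (simp add: power2_eq_square algebra_simps)
  also have "\<dots> \<le> (exp (ln 2 * x / 2))\<^sup>2"
    using x by (intro power_mono exp_ge_add_one_self) auto
  also have "\<dots> = 2 powr x"
    by (simp add: powr_def exp_double[symmetric])
  finally show ?thesis .
qed

lemma lg_le:
  assumes "1 \<le> n"
  shows "real (lg n) \<le> 1 + log 2 (real n)" "lg n \<le> n"
proof -
  have "real (lg n) \<le> 1 + log 2 (real n) \<and> lg n \<le> n"
  proof (cases "lg n")
    case (Suc l)
    then have *: "2 ^ l < n" using less_lg_iff[of l n] by simp
    then have "2 powr real l < real n" by (simp add: powr_realpow flip: of_nat_power)
    then have "real l < log 2 (real n)" using assms by (simp add: less_log_iff)
    moreover have "l < n" using * less_exp[of l] by linarith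
    ultimately show ?thesis using Suc by simp
  qed (use assms in simp)
  then show "real (lg n) \<le> 1 + log 2 (real n)" "lg n \<le> n" by auto
qed

section \<open>Resource bounds in powers of \<open>z\<close>\<close>

context
  fixes n :: nat and \<epsilon> u r z :: real
  assumes n: "2 \<le> n" and eps: "0 < \<epsilon>" "\<epsilon> < 1"
  defines "u \<equiv> 2 powr (1 / \<epsilon>)" and "r \<equiv> min (real n) u" and "z \<equiv> r powr (1 / \<epsilon>)"
begin

lemma inverse_eps: "1 \<le> 1 / \<epsilon>"
  using eps by simp

lemma u_ge: "2 \<le> u" "1 / \<epsilon> \<le> u"
  using powr_mono[OF inverse_eps, of 2] real_le_two_powr[of "1 / \<epsilon>"] eps by (auto simp: u_def)

lemma r_ge: "2 \<le> r"
  using u_ge n by (simp add: r_def)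

text \<open>Since \<open>r\<close> is at least 2, \<open>z\<close> dominates \<open>u\<close> even
  if \<open>r = n\<close> is much smaller than \<open>u\<close>. So every factor 2^O(1/\<epsilon>)
  is bounded by a power of \<open>z\<close>.\<close>

lemma z_ge: "2 \<le> z" "u \<le> z" "r \<le> z"
proof -
  show "u \<le> z" unfolding z_def u_def using r_ge eps by (intro powr_mono2) auto
  then show "2 \<le> z" using u_ge by simp
  show "r \<le> z" using powr_mono[OF inverse_eps, of r] r_ge by (simp add: z_def)
qed

lemma inverse_eps_le: "1 / \<epsilon> \<le> z"
  using u_ge z_ge by simp

lemma deg_bound_le: "real (deg_bound \<epsilon>) \<le> 3 / \<epsilon>"
proof -
  have "real (deg_bound \<epsilon>) \<le> 2 / \<epsilon> + 1"
    using of_nat_ceiling[of "2 / \<epsilon>"] eps le_of_int_ceiling[of "2 / \<epsilon>"]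
    by (simp add: deg_bound_def)
  also have "\<dots> \<le> 2 / \<epsilon> + 1 / \<epsilon>" using inverse_eps by linarith
  finally show ?thesis by simp
qed

lemma thr_pos: "0 < thr \<epsilon>"
  using eps by (simp add: thr_def)

text \<open>The exponent is 4 + 4 + 12: the numeral 16, the factor 1/\<epsilon>^4, and 9^d <= 2^(4
  d) with d <= 3/\<epsilon>.\<close>

lemma inverse_thr_le_u: "1 / thr \<epsilon> \<le> u ^ 20"
proof -
  have "(9::real) ^ deg_bound \<epsilon> \<le> 16 ^ deg_bound \<epsilon>" by (intro power_mono) auto
  also have "\<dots> = 2 powr (4 * real (deg_bound \<epsilon>))"
    using powr_realpow[of 2 "4 * deg_bound \<epsilon>"] by (simp add: power_mult)
  also have "\<dots> \<le> 2 powr (12 * (1 / \<epsilon>))"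
    using deg_bound_le by (intro powr_mono) auto
  also have "\<dots> = u powr 12" by (simp add: u_def powr_powr)
  also have "\<dots> = u ^ 12" using u_ge by simp
  finally have "16 * (1 / \<epsilon>) ^ 4 * 9 ^ deg_bound \<epsilon> \<le> u ^ 4 * u ^ 4 * u ^ 12"
  proof (intro mult_mono)
    show "16 \<le> u ^ 4" using numeral_le_power[OF u_ge(1), of 16 4] by simp
    show "(1 / \<epsilon>) ^ 4 \<le> u ^ 4" using u_ge eps by (intro power_mono) auto
  qed (use eps in simp_all)
  then show ?thesis
    by (simp add: thr_def power_add[symmetric] field_simps eval_nat_numeral)
qed

lemma inverse_thr_le: "1 / thr \<epsilon> \<le> z ^ 20"
  using inverse_thr_le_u power_mono[OF z_ge(2), of 20] u_ge by simp

lemma burn_eq: "burn \<epsilon> = 40 * 1024 * (1 / thr \<epsilon>) ^ 5"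
  using thr_pos by (simp add: burn_def rate_def field_simps eval_nat_numeral)

lemma burn_le: "burn \<epsilon> \<le> z ^ 116"
proof -
  have "burn \<epsilon> \<le> z ^ 16 * (z ^ 20) ^ 5"
    unfolding burn_eq
  proof (rule mult_mono)
    show "40 * 1024 \<le> z ^ 16" using numeral_le_power[OF z_ge(1), of "40 * 1024" 16] by simp
    show "(1 / thr \<epsilon>) ^ 5 \<le> (z ^ 20) ^ 5"
      using inverse_thr_le thr_pos by (intro power_mono) auto
  qed (use thr_pos z_ge in simp_all)
  also have "\<dots> = z ^ 116" by (simp flip: power_add power_mult)
  finally show ?thesis .
qed

lemma burn_pos: "0 < burn \<epsilon>"
  using thr_pos by (simp add: burn_eq)

lemma screen_bound_le:
  assumes "real (lg n) + 5 \<le> 7 * y" "1 \<le> y"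
  shows "screen_bound n \<epsilon> \<le> z ^ 119 * y" "real (screen_size n \<epsilon>) \<le> z ^ 120 * y"
proof -
  have z3: "7 \<le> z ^ 3" using numeral_le_power[OF z_ge(1), of 7 3] by simp
  have "real (lg n) + 5 \<le> z ^ 3 * y"
    using assms mult_right_mono[OF z3, of y] by linarith
  then have "burn \<epsilon> * (real (lg n) + 5) \<le> z ^ (116 + 3) * (1 * y)"
    using burn_le burn_pos by (intro power_bound_mult) auto
  then show M: "screen_bound n \<epsilon> \<le> z ^ 119 * y" by (simp add: screen_bound_def)
  have "0 \<le> screen_bound n \<epsilon>" using burn_pos by (simp add: screen_bound_def)
  then have "real (screen_size n \<epsilon>) \<le> screen_bound n \<epsilon> + 1"
    unfolding screen_size_def by linarith
  also have "\<dots> \<le> z ^ 120 * y"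
  proof (rule power_bound_add[OF z_ge(1) M])
    show "1 \<le> z ^ 119 * y"
      using mult_mono[OF one_le_power[of z 119] assms(2)] z_ge assms by simp
  qed (use assms in simp_all)
  finally show "real (screen_size n \<epsilon>) \<le> z ^ 120 * y" .
qed

lemma lg_le_n: "real (lg n) + 5 \<le> 7 * real n"
  using lg_le(2)[of n] n by simp

lemma lg_le_log: "real (lg n) + 5 \<le> 7 * max 1 (log 2 (real n))"
proof -
  have "1 \<le> log 2 (real n)" using n by (simp add: le_log_iff)
  moreover from this have "max 1 (log 2 (real n)) = log 2 (real n)" by simp
  ultimately show ?thesis using lg_le(1)[of n] n by linarith
qed

lemma budget_nonneg: "0 \<le> budget n \<epsilon>"
  using burn_pos thr_pos by (simp add: budget_def screen_bound_def)

lemma budget_le: "budget n \<epsilon> \<le> z ^ 144 * real n"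
proof -
  have n0: "0 \<le> real n" "1 \<le> real n" using n by auto
  have "burn \<epsilon> + 2 \<le> z ^ 117 * 1"
    using burn_le z_ge(1) power_increasing[of 1 116 z]
    by (intro power_bound_add[OF z_ge(1), where i = 116]) (auto intro: numeral_le_power)
  then have "20 * (burn \<epsilon> + 2) \<le> z ^ (5 + 117) * (1 * 1)"
    using burn_pos z_ge by (intro power_bound_mult) (auto intro: numeral_le_power)
  then have "20 * (burn \<epsilon> + 2) * real n \<le> z ^ 122 * real n"
    using n0 by (intro mult_right_mono) auto
  then have 1: "20 * real n * (burn \<epsilon> + 2) \<le> z ^ 143 * real n"
    using power_bound_lift[of _ z 122 "real n" 143] z_ge n0 by (simp add: mult_ac)
  have M: "screen_bound n \<epsilon> + 1 \<le> z ^ 120 * real n"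
  proof (rule power_bound_add[OF z_ge(1) screen_bound_le(1)[OF lg_le_n n0(2)]])
    show "1 \<le> z ^ 119 * real n"
      using mult_mono[OF one_le_power[of z 119] n0(2)] z_ge by simp
  qed simp_all
  have K: "4 * (1 / thr \<epsilon>) \<le> z ^ (2 + 20) * (1 * 1)"
    using inverse_thr_le thr_pos z_ge by (intro power_bound_mult) (auto intro: numeral_le_power)
  have "4 * (1 / thr \<epsilon>) * (screen_bound n \<epsilon> + 1) \<le> z ^ ((2 + 20) + 120) * ((1 * 1) * real n)"
    using thr_pos burn_pos by (intro power_bound_mult[OF K M]) (simp_all add: screen_bound_def)
  then have 2: "4 / thr \<epsilon> * (screen_bound n \<epsilon> + 1) \<le> z ^ 143 * real n"
    using power_bound_lift[of _ z 142 "real n" 143] z_ge n0 by simp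
  show ?thesis
    using power_bound_add[OF z_ge(1) 1 2, of 144] by (simp add: budget_def)
qed

text \<open>Both cases of the minimum occur: if \<open>r = n\<close>, the number of coordinates is
  the bound, otherwise the cap 4 / thr is. The \<open>+ 1\<close> fits
  \<open>card_small_subsets\<close>; raised to d <= 3/\<epsilon>, the exponent 23 becomes the 69 of
  the next lemma.\<close>

lemma length_selected:
  "length (selected n \<epsilon> D) \<le> n" "real (length (selected n \<epsilon> D)) + 1 \<le> r ^ 23"
proof -
  let ?k = "length (selected n \<epsilon> D)" and ?xs = "fst (screen n \<epsilon> D (screen_size n \<epsilon>))"
  have "length ?xs \<le> n"
    using screen_sound[of n \<epsilon> D "screen_size n \<epsilon>"] card_mono[of "{..<n}" "set ?xs"]
    by (simp add: distinct_card)
  then show kn: "?k \<le> n" by (simp add: selected_def Let_def)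
  have "real ?k \<le> 4 * (1 / thr \<epsilon>)"
    using thr_pos by (auto simp: selected_def Let_def)
  also have "\<dots> \<le> u ^ 2 * u ^ 20"
  proof (rule mult_mono[OF _ inverse_thr_le_u])
    show "4 \<le> u ^ 2" using numeral_le_power[OF u_ge(1), of 4 2] by simp
  qed (use thr_pos in simp_all)
  finally have ku: "real ?k \<le> u ^ 22 * 1" by (simp flip: power_add)
  show "real ?k + 1 \<le> r ^ 23"
  proof (cases "real n \<le> u")
    case True
    then have r: "r = real n" by (simp add: r_def)
    have "real ?k + 1 \<le> r ^ 23 * 1"
      using kn n r by (intro power_bound_add[where i = 1]) auto
    then show ?thesis by simp
  next
    case False
    then have r: "r = u" by (simp add: r_def)
    have "real ?k + 1 \<le> u ^ 23 * 1"
      using ku u_ge one_le_power[of u 22] by (intro power_bound_add[where i = 22]) auto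
    then show ?thesis by (simp add: r)
  qed
qed

lemma family_size_le: "real (family_size n \<epsilon> D) \<le> z ^ 69"
proof -
  let ?xs = "selected n \<epsilon> D" and ?d = "deg_bound \<epsilon>"
  have "real (family_size n \<epsilon> D) \<le> real ((card (set ?xs) + 1) ^ ?d)"
    unfolding family_size_def by (intro of_nat_mono card_small_subsets) simp
  also have "\<dots> \<le> (real (length ?xs) + 1) ^ ?d"
    using card_length[of ?xs] by (simp add: power_mono)
  also have "\<dots> \<le> (r ^ 23) ^ ?d"
    using length_selected(2) by (intro power_mono) auto
  also have "\<dots> = r powr (23 * real ?d)"
    using powr_realpow[of r "23 * ?d"] r_ge by (simp add: power_mult)
  also have "\<dots> \<le> r powr (1 / \<epsilon> * 69)"
    using deg_bound_le r_ge by (intro powr_mono) auto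
  also have "\<dots> = z powr 69" by (simp add: z_def powr_powr)
  also have "\<dots> = z ^ 69" using z_ge by simp
  finally show ?thesis .
qed

lemma fit_size_le:
  assumes "real k \<le> z ^ 69"
  shows "real (fit_size \<epsilon> k) \<le> z ^ 78"
proof -
  have K: "40 * real k \<le> z ^ (6 + 69) * (1 * 1)"
    using assms z_ge by (intro power_bound_mult) (auto intro: numeral_le_power)
  have I: "1 / \<epsilon> * (1 / \<epsilon>) \<le> z ^ (1 + 1) * (1 * 1)"
    using inverse_eps_le eps by (intro power_bound_mult) auto
  have "40 * real k * (1 / \<epsilon> * (1 / \<epsilon>)) \<le> z ^ ((6 + 69) + (1 + 1)) * ((1 * 1) * (1 * 1))"
    using eps by (intro power_bound_mult[OF K I]) auto
  then have "40 * real k / (\<epsilon> * \<epsilon>) \<le> z ^ 77 * 1" by simp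
  then have "40 * real k / (\<epsilon> * \<epsilon>) + 1 \<le> z ^ 78 * 1"
    using z_ge one_le_power[of z 77] by (intro power_bound_add[where i = 77]) auto
  moreover have "real (fit_size \<epsilon> k) \<le> 40 * real k / (\<epsilon> * \<epsilon>) + 1"
  proof -
    have "0 \<le> 40 * real k / (\<epsilon> * \<epsilon>)" using eps by simp
    then show ?thesis unfolding fit_size_def by linarith
  qed
  ultimately show ?thesis by simp
qed

lemma main_bounds:
  shows "real (main_cost n \<epsilon> D) \<le> z ^ 160 * real n"
    and "real (main_samples n \<epsilon> D) \<le> z ^ 121 * max 1 (log 2 (real n))"
proof -
  define d where "d = deg_bound \<epsilon>"
  define m where "m = screen_size n \<epsilon>"
  define xs where "xs = selected n \<epsilon> D"
  define k where "k = family_size n \<epsilon> D"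
  define t where "t = fit_size \<epsilon> k"
  have n0: "1 \<le> real n" "0 \<le> real n" using n by auto
  have k: "real k \<le> z ^ 69" unfolding k_def by (rule family_size_le)
  have t: "real t \<le> z ^ 78" unfolding t_def by (rule fit_size_le[OF k])
  have lift: "a \<le> z ^ 154 * real n" if "a \<le> z ^ i * 1" "i \<le> 154" for a :: real and i
  proof -
    have "a \<le> z ^ 154 * 1" by (rule power_bound_lift[OF that(1) z_ge(1) that(2)]) simp
    also have "\<dots> \<le> z ^ 154 * real n" using n0 z_ge by (intro mult_left_mono) auto
    finally show ?thesis .
  qed
  have num: "c * a \<le> z ^ (5 + i) * y" if "a \<le> z ^ i * y" "0 \<le> a" "0 \<le> c" "c \<le> 32" for a c y :: real and i
    using power_bound_mult[of c z 5 1 a i y] that numeral_le_power[OF z_ge(1), of c 5] by simp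
  have d: "5 * real d \<le> z ^ 154 * real n"
  proof (rule lift)
    have "3 * (1 / \<epsilon>) \<le> z ^ (5 + 1) * 1"
      by (rule num) (use inverse_eps_le eps in simp_all)
    then have "real d \<le> z ^ 6 * 1" using deg_bound_le by (simp add: d_def)
    then show "5 * real d \<le> z ^ (5 + 6) * 1" by (rule num) simp_all
  qed simp
  have l: "5 * real (lg n) \<le> z ^ 154 * real n"
  proof -
    have "5 * real (lg n) \<le> z ^ (5 + 0) * real n"
      by (rule num) (use lg_le(2)[of n] n in simp_all)
    from power_bound_lift[OF this z_ge(1) _ n0(2), of 154] show ?thesis by simp
  qed
  have nn: "4 * real n \<le> z ^ 154 * real n"
    using n0 numeral_le_power[OF z_ge(1), of 4 154] by (intro mult_right_mono) auto
  have m: "20 * real m \<le> z ^ 154 * real n"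
  proof -
    have "20 * real m \<le> z ^ (5 + 120) * real n"
      unfolding m_def by (rule num[OF screen_bound_le(2)[OF lg_le_n n0(1)]]) simp_all
    from power_bound_lift[OF this z_ge(1) _ n0(2), of 154] show ?thesis by simp
  qed
  have w: "10 * real (snd (screen n \<epsilon> D m)) \<le> z ^ 154 * real n"
  proof -
    have "10 * real (snd (screen n \<epsilon> D m)) \<le> z ^ (5 + 144) * real n"
      by (rule num[OF order_trans[OF screen_work_le_budget[OF budget_nonneg] budget_le]]) simp_all
    from power_bound_lift[OF this z_ge(1) _ n0(2), of 154] show ?thesis by simp
  qed
  have k1: "1 \<le> real k"
  proof -
    have "{} \<in> low_subsets d (set xs)" by simp
    then have "k > 0" unfolding k_def family_size_def d_def xs_def by (intro card_gt_0_iff[THEN iffD2]) auto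
    then show ?thesis by simp
  qed
  have lin: "9 * real k + 7 \<le> z ^ 74 * 1"
  proof -
    have "9 * real k + 7 \<le> 16 * real k" using k1 by simp
    also have "16 * real k \<le> z ^ (5 + 69) * 1" by (rule num) (use k in simp_all)
    finally show ?thesis by simp
  qed
  have f: "real (length xs) * (9 * real k + 7) \<le> z ^ 154 * real n"
  proof -
    have "real (length xs) * (9 * real k + 7) \<le> z ^ (0 + 74) * (real n * 1)"
      by (rule power_bound_mult[OF _ lin]) (use length_selected(1)[of D] in \<open>simp_all add: xs_def\<close>)
    then show ?thesis using power_bound_lift[of _ z 74 "real n" 154] z_ge n0 by simp
  qed
  have g: "real t * (6 * real k + 8) \<le> z ^ 154 * real n"
  proof (rule lift)
    have "6 * real k + 8 \<le> 16 * real k" using k1 by simp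
    also have "16 * real k \<le> z ^ (5 + 69) * 1" by (rule num) (use k in simp_all)
    finally show "real t * (6 * real k + 8) \<le> z ^ (78 + (5 + 69)) * 1"
      using power_bound_mult[of "real t" z 78 1 "6 * real k + 8" "5 + 69" 1] t by simp
  qed simp
  have e: "10 * real k \<le> z ^ 154 * real n"
    by (rule lift[of _ "5 + 69"], rule num) (use k in simp_all)
  have c: "45 \<le> z ^ 154 * real n"
    using numeral_le_power[OF z_ge(1), of 45 6] by (intro lift[of _ 6]) simp_all
  \<comment> \<open>Nine summands, rounded up to 16. The largest of their exponents is 152 = 78 +
    74, from fitting.\<close>
  have "real (main_cost n \<epsilon> D) \<le> 16 * (z ^ 154 * real n)"
    unfolding main_cost_def Let_def d_def[symmetric] m_def[symmetric] xs_def[symmetric]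
      k_def[symmetric] t_def[symmetric]
    using d l nn m w f g e c by simp
  also have "\<dots> \<le> z ^ 6 * (z ^ 154 * real n)"
  proof (rule mult_right_mono)
    show "16 \<le> z ^ 6" using numeral_le_power[OF z_ge(1), of 16 6] by simp
    show "0 \<le> z ^ 154 * real n" using z_ge(1) by simp
  qed
  also have "\<dots> = z ^ 160 * real n" by (simp flip: power_add mult.assoc)
  finally show "real (main_cost n \<epsilon> D) \<le> z ^ 160 * real n" .
  let ?l = "max 1 (log 2 (real n))"
  have "real t \<le> z ^ 120 * ?l"
  proof -
    have "real t \<le> z ^ 120 * 1"
      by (rule power_bound_lift[of _ z 78]) (use t z_ge in simp_all)
    also have "\<dots> \<le> z ^ 120 * ?l" using z_ge(1) by (intro mult_left_mono) simp_all
    finally show ?thesis .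
  qed
  then have "real m + real t \<le> z ^ 121 * ?l"
    unfolding m_def
    by (intro power_bound_add[OF z_ge(1) screen_bound_le(2)[OF lg_le_log]]) simp_all
  then show "real (main_samples n \<epsilon> D) \<le> z ^ 121 * ?l"
    by (simp add: main_samples_def m_def t_def k_def)
qed

end

section \<open>Independent examples\<close>

abbreviation labelled :: "(point \<Rightarrow> real) \<Rightarrow> (nat \<Rightarrow> point) \<Rightarrow> nat \<Rightarrow> point \<times> real" where
  "labelled f X \<equiv> \<lambda>j. (X j, f (X j))"

lemma prob_space_uniform: "prob_space (uniform n)"
  by (simp add: uniform_def measure_pmf.prob_space_axioms)

lemma sets_uniform [simp]: "sets (uniform n) = UNIV"
  by (simp add: uniform_def)

lemma space_uniform [simp]: "space (uniform n) = UNIV"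
  by (simp add: uniform_def)

lemma measurable_uniform: "h \<in> measurable (uniform n) L \<longleftrightarrow> range h \<subseteq> space L"
  by (auto simp: measurable_def)

lemma prob_space_iid_points: "prob_space (iid_points n)"
  unfolding iid_points_def by (intro prob_space_PiM prob_space_uniform)

lemma space_iid_points [simp]: "space (iid_points n) = UNIV"
  by (simp add: iid_points_def space_PiM)

lemma measurable_component_comp:
  assumes "j \<in> I" "range h \<subseteq> space L"
  shows "(\<lambda>X. h (X j)) \<in> measurable (Pi\<^sub>M I (\<lambda>_. uniform n)) L"
  using assms
  by (intro measurable_compose[OF measurable_component_singleton]) (auto simp: measurable_uniform)

lemma borel_measurable_iid_points:
  "(\<lambda>X. h (X j) :: real) \<in> borel_measurable (iid_points n)"
  unfolding iid_points_def by (rule measurable_component_comp) auto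

lemma distr_iid_points: "distr (iid_points n) (uniform n) (\<lambda>X. X j) = uniform n"
  unfolding iid_points_def by (rule distr_PiM_component) (auto simp: prob_space_uniform)

lemma AE_iid_points: "AE X in iid_points n. X j \<in> cube n"
proof -
  have "AE x in uniform n. x \<in> cube n"
    unfolding uniform_def by (simp add: AE_measure_pmf_iff finite_cube cube_nonempty)
  then show ?thesis
    unfolding iid_points_def by (intro AE_PiM_component) (auto simp: prob_space_uniform)
qed

lemma integrable_iid_points: "integrable (iid_points n) (\<lambda>X. h (X j) :: real)"
proof -
  have "integrable (uniform n) h"
    unfolding uniform_def
    by (intro integrable_measure_pmf_finite) (simp add: finite_cube cube_nonempty)
  then have "integrable (distr (iid_points n) (uniform n) (\<lambda>X. X j)) h"
    by (simp add: distr_iid_points)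
  then show ?thesis
    by (rule integrable_distr[rotated]) (simp add: iid_points_def)
qed

lemma integral_iid_points: "(\<integral>X. h (X j) \<partial>iid_points n) = cube_avg n h"
proof -
  have "(\<integral>X. h (X j) \<partial>iid_points n) = (\<integral>x. h x \<partial>distr (iid_points n) (uniform n) (\<lambda>X. X j))"
    by (intro integral_distr[symmetric]) (auto simp: iid_points_def measurable_uniform)
  then show ?thesis by (simp add: distr_iid_points integral_uniform)
qed

lemma indep_vars_iid_points:
  "prob_space.indep_vars (iid_points n) (\<lambda>_. uniform n) (\<lambda>j X. X j) UNIV"
proof -
  interpret prob_space "iid_points n" by (rule prob_space_iid_points)
  have "distr (iid_points n) (\<Pi>\<^sub>M i\<in>UNIV. uniform n) (\<lambda>X. \<lambda>i\<in>UNIV. X i) = iid_points n"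
    using distr_id2[of "\<Pi>\<^sub>M i\<in>UNIV. uniform n" "iid_points n"] by (simp add: iid_points_def restrict_UNIV)
  also have "\<dots> = (\<Pi>\<^sub>M i\<in>UNIV. distr (iid_points n) (uniform n) (\<lambda>X. X i))"
    by (simp add: distr_iid_points) (simp add: iid_points_def)
  finally show ?thesis
    by (subst indep_vars_iff_distr_eq_PiM) (auto simp: iid_points_def)
qed

lemma indep_vars_iid_points_comp:
  "prob_space.indep_vars (iid_points n) (\<lambda>_. borel) (\<lambda>j X. h j (X j) :: real) J"
proof -
  interpret prob_space "iid_points n" by (rule prob_space_iid_points)
  show ?thesis
    by (rule indep_vars_compose2[OF indep_vars_subset[OF indep_vars_iid_points]])
      (auto simp: measurable_uniform)
qed

text \<open>Events determined by disjoint blocks of examples are independent. Dependence on a block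
  is expressed as invariance under \<open>restrict\<close>, so \<open>P\<close> and \<open>Q\<close>
  remain predicates on whole sequences while their measurability is checked on the block
  alone.\<close>

lemma prob_early_late:
  fixes P Q :: "(nat \<Rightarrow> point) \<Rightarrow> bool"
  assumes P: "{X \<in> space (Pi\<^sub>M {..<m} (\<lambda>_. uniform n)). P X} \<in> sets (Pi\<^sub>M {..<m} (\<lambda>_. uniform n))"
    and Q: "{X \<in> space (Pi\<^sub>M {m..} (\<lambda>_. uniform n)). Q X} \<in> sets (Pi\<^sub>M {m..} (\<lambda>_. uniform n))"
    and P_cong: "\<And>X. P (restrict X {..<m}) = P X" and Q_cong: "\<And>X. Q (restrict X {m..}) = Q X"
  shows "measure (iid_points n) {X. P X \<and> Q X} =
    measure (iid_points n) {X. P X} * measure (iid_points n) {X. Q X}"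
proof -
  interpret prob_space "iid_points n" by (rule prob_space_iid_points)
  let ?A = "\<lambda>X. restrict (\<lambda>i. X i) {..<m}" and ?B = "\<lambda>X. restrict (\<lambda>i. X i) {m..}"
  have "indep_var (Pi\<^sub>M {..<m} (\<lambda>_. uniform n)) ?A (Pi\<^sub>M {m..} (\<lambda>_. uniform n)) ?B"
    by (rule indep_var_restrict[OF indep_vars_iid_points]) auto
  from indep_varD[OF this P Q]
  show ?thesis
    by (simp add: vimage_def space_PiM P_cong Q_cong conj_commute)
qed

context
  fixes n :: nat and f :: "point \<Rightarrow> real"
  assumes range: "\<And>x. x \<in> cube n \<Longrightarrow> f x \<in> {0..1}"
begin

lemma score_tail:
  assumes "i < n" "0 < t" "0 \<le> c"
  defines "a \<equiv> real t * fourier n f {i}"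
  shows "measure (iid_points n) {X. a + real t * c \<le> score (labelled f X) t i} \<le>
      exp (- (real t * c\<^sup>2 / 2))"
    and "measure (iid_points n) {X. score (labelled f X) t i \<le> a - real t * c} \<le>
      exp (- (real t * c\<^sup>2 / 2))"
proof -
  interpret prob_space "iid_points n" by (rule prob_space_iid_points)
  let ?Z = "\<lambda>j X. pm (X j i) * f (X j)"
  \<comment> \<open>\<open>f\<close> is bounded only on the cube, and the sample space consists of
    all sequences of points, so the range condition of Hoeffding's inequality holds only almost
    surely.\<close>
  have AE: "AE X in iid_points n. ?Z j X \<in> {-1..1}" for j
    using AE_iid_points[where n = n and j = j]
  proof eventually_elim
    case (elim X)
    then show ?case using range[OF elim] by (auto simp: pm_def)
  qed
  interpret Hoeffding_ineq "iid_points n" "{..<t}" ?Z "\<lambda>_. -1" "\<lambda>_. 1" "\<Sum>j<t. expectation (?Z j)"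
    by unfold_locales (auto simp: AE intro: indep_vars_iid_points_comp[of n "\<lambda>j x. pm (x i) * f x"]
        simp del: atLeastAtMost_iff)
  have mean: "expectation (?Z j) = fourier n f {i}" for j
    using integral_iid_points[of n "\<lambda>x. pm (x i) * f x" j]
    by (simp add: fourier_def character_def mult.commute)
  have exponent: "-2 * (real t * c)\<^sup>2 / (\<Sum>j<t. (1 - -1)\<^sup>2) = - (real t * c\<^sup>2 / 2)"
    using assms(2) by (simp add: power2_eq_square field_simps)
  show "prob {X. a + real t * c \<le> score (labelled f X) t i} \<le> exp (- (real t * c\<^sup>2 / 2))"
    using Hoeffding_ineq_ge[of "real t * c"] assms(2,3) unfolding exponent
    by (simp add: score_def mean a_def)
  show "prob {X. score (labelled f X) t i \<le> a - real t * c} \<le> exp (- (real t * c\<^sup>2 / 2))"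
    using Hoeffding_ineq_le[of "real t * c"] assms(2,3) unfolding exponent
    by (simp add: score_def mean a_def)
qed

lemma estimate_mean_square:
  assumes "0 < t"
  shows "(\<integral>X. (estimate (labelled f X) m t S - fourier n f S)\<^sup>2 \<partial>iid_points n) \<le> 1 / real t"
    and "integrable (iid_points n)
      (\<lambda>X. (estimate (labelled f X) m t S - fourier n f S)\<^sup>2)"
proof -
  interpret prob_space "iid_points n" by (rule prob_space_iid_points)
  define h where "h x = character S x * f x - fourier n f S" for x
  have mean: "cube_avg n h = 0"
    by (simp add: h_def[abs_def] cube_avg_diff fourier_def mult.commute)
  have square: "cube_avg n (\<lambda>x. (h x)\<^sup>2) \<le> 1"
  proof -
    have "cube_avg n (\<lambda>x. (h x)\<^sup>2) = cube_avg n (\<lambda>x. (character S x * f x)\<^sup>2 - (2 * fourier n f S) *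
        (f x * character S x) + (fourier n f S)\<^sup>2)"
      by (intro cube_avg_cong) (simp add: h_def power2_diff)
    also have "\<dots> = cube_avg n (\<lambda>x. (character S x * f x)\<^sup>2) - 2 * fourier n f S * fourier n f S +
        (fourier n f S)\<^sup>2"
      by (simp only: cube_avg_add cube_avg_diff cube_avg_cmult cube_avg_const fourier_def)
    also have "\<dots> \<le> cube_avg n (\<lambda>x. (character S x * f x)\<^sup>2)"
      by (simp add: power2_eq_square)
    also have "\<dots> \<le> cube_avg n (\<lambda>_. 1)"
    proof (rule cube_avg_mono)
      fix x assume "x \<in> cube n"
      then have "\<bar>character S x * f x\<bar> \<le> 1" using range[of x] by (simp add: abs_mult)
      then show "(character S x * f x)\<^sup>2 \<le> 1" by (simp add: abs_square_le_1)
    qed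
    finally show ?thesis by simp
  qed
  let ?Z = "\<lambda>j X. h (X j)"
  have int: "integrable (iid_points n) (?Z j)" for j by (rule integrable_iid_points)
  have pair: "integrable (iid_points n) (\<lambda>X. ?Z j X * ?Z l X) \<and>
      expectation (\<lambda>X. ?Z j X * ?Z l X) = (if j = l then cube_avg n (\<lambda>x. (h x)\<^sup>2) else 0)" for j l
  proof (cases "j = l")
    case True
    then show ?thesis
      using integrable_iid_points[of n "\<lambda>x. (h x)\<^sup>2" j] integral_iid_points[of n "\<lambda>x. (h x)\<^sup>2" j]
      by (simp add: power2_eq_square)
  next
    case False
    have ind: "indep_vars (\<lambda>_. borel) ?Z {j, l}" by (rule indep_vars_iid_points_comp)
    show ?thesis
      using indep_vars_lebesgue_integral[OF _ ind int] indep_vars_integrable[OF _ ind int] False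
      by (simp add: integral_iid_points mean)
  qed
  have eq: "(estimate (labelled f X) m t S - fourier n f S)\<^sup>2 =
      1 / (real t)\<^sup>2 * (\<Sum>j<t. \<Sum>l<t. ?Z (m + j) X * ?Z (m + l) X)" for X
  proof -
    have "estimate (labelled f X) m t S - fourier n f S = (\<Sum>j<t. ?Z (m + j) X) / real t"
      using assms by (simp add: estimate_def h_def sum_subtractf diff_divide_distrib)
    then show ?thesis by (simp add: power_divide power2_eq_square sum_product)
  qed
  show "integrable (iid_points n) (\<lambda>X. (estimate (labelled f X) m t S - fourier n f S)\<^sup>2)"
    unfolding eq by (intro integrable_mult_right Bochner_Integration.integrable_sum) (use pair in blast)
  have "expectation (\<lambda>X. (estimate (labelled f X) m t S - fourier n f S)\<^sup>2) =
      1 / (real t)\<^sup>2 * (\<Sum>j<t. \<Sum>l<t. expectation (\<lambda>X. ?Z (m + j) X * ?Z (m + l) X))"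
    unfolding eq using pair by (simp add: Bochner_Integration.integral_sum Bochner_Integration.integrable_sum)
  also have "\<dots> = 1 / (real t)\<^sup>2 * (real t * cube_avg n (\<lambda>x. (h x)\<^sup>2))"
    using pair by simp
  also have "\<dots> \<le> 1 / (real t)\<^sup>2 * (real t * 1)"
    using square by (intro mult_left_mono) auto
  also have "\<dots> = 1 / real t" by (simp add: power2_eq_square)
  finally show "expectation (\<lambda>X. (estimate (labelled f X) m t S - fourier n f S)\<^sup>2) \<le> 1 / real t" .
qed

text \<open>Markov is applied to the sum of squared errors, which is the quantity that Parseval asks
  for; a union bound over \<open>F\<close> would need each coefficient to be accurate with high
  confidence.\<close>

lemma fit_failure:
  assumes "finite F" "F \<noteq> {}" "0 < \<epsilon>"
  defines "t \<equiv> fit_size \<epsilon> (card F)"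
  shows "measure (iid_points n) {X. \<epsilon>\<^sup>2 / 4 \<le>
    (\<Sum>S\<in>F. (estimate (labelled f X) m t S - fourier n f S)\<^sup>2)} \<le> 1 / 10"
proof -
  interpret prob_space "iid_points n" by (rule prob_space_iid_points)
  let ?e = "\<lambda>S X. (estimate (labelled f X) m t S - fourier n f S)\<^sup>2"
  have card: "0 < card F" using assms by (simp add: card_gt_0_iff)
  then have "0 < 40 * real (card F) / (\<epsilon> * \<epsilon>)" using assms by simp
  then have t_ge: "40 * real (card F) / (\<epsilon> * \<epsilon>) \<le> real t" and t: "0 < t"
    unfolding t_def fit_size_def by linarith+
  have int: "integrable (iid_points n) (\<lambda>X. \<Sum>S\<in>F. ?e S X)"
    using estimate_mean_square(2)[OF t] by (intro Bochner_Integration.integrable_sum)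
  have "expectation (\<lambda>X. \<Sum>S\<in>F. ?e S X) = (\<Sum>S\<in>F. expectation (?e S))"
    using estimate_mean_square(2)[OF t] by (intro Bochner_Integration.integral_sum)
  also have "\<dots> \<le> (\<Sum>S\<in>F. 1 / real t)"
    by (intro sum_mono estimate_mean_square(1)[OF t])
  also have "\<dots> \<le> \<epsilon>\<^sup>2 / 40"
    using t_ge t assms(3) by (simp add: field_simps power2_eq_square)
  finally have E: "expectation (\<lambda>X. \<Sum>S\<in>F. ?e S X) \<le> \<epsilon>\<^sup>2 / 40" .
  have "prob {X \<in> space (iid_points n). (\<Sum>S\<in>F. ?e S X) \<ge> \<epsilon>\<^sup>2 / 4} \<le>
      expectation (\<lambda>X. \<Sum>S\<in>F. ?e S X) / (\<epsilon>\<^sup>2 / 4)"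
    using assms(3) by (intro integral_Markov_inequality_measure[OF int, of "{}"]) (auto simp: sum_nonneg)
  also have "\<dots> \<le> (\<epsilon>\<^sup>2 / 40) / (\<epsilon>\<^sup>2 / 4)"
    using E by (intro divide_right_mono) auto
  finally show ?thesis using assms(3) by simp
qed

end

section \<open>Success probability\<close>

lemma score_cong: "(\<And>j. j < t \<Longrightarrow> D j = D' j) \<Longrightarrow> score D t = score D' t"
  by (simp add: score_def fun_eq_iff)

lemma screen_cong:
  assumes "\<And>j. j < t \<Longrightarrow> D j = D' j"
  shows "screen n \<epsilon> D t = screen n \<epsilon> D' t"
  using assms
proof (induction t)
  case (Suc t)
  have *: "passes \<epsilon> D (Suc t) = passes \<epsilon> D' (Suc t)"
    using score_cong[of "Suc t" D D'] Suc.prems by (simp add: passes_def fun_eq_iff)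
  show ?case unfolding screen.simps * using Suc by simp
qed simp

lemma selected_cong:
  assumes "\<And>j. j < screen_size n \<epsilon> \<Longrightarrow> D j = D' j"
  shows "selected n \<epsilon> D = selected n \<epsilon> D'"
  using screen_cong[OF assms] by (simp add: selected_def)

lemma measurable_filter_passes:
  assumes "\<And>i. (\<lambda>\<omega>. score (D \<omega>) t i) \<in> borel_measurable M"
  shows "(\<lambda>\<omega>. filter (passes \<epsilon> (D \<omega>) t) xs) \<in> measurable M (count_space UNIV)"
proof (induction xs)
  case (Cons x xs)
  have "Measurable.pred M (\<lambda>\<omega>. passes \<epsilon> (D \<omega>) t x)"
    unfolding passes_def using assms by measurable
  moreover have "(\<lambda>\<omega>. x # filter (passes \<epsilon> (D \<omega>) t) xs) \<in> measurable M (count_space UNIV)"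
    by (rule measurable_compose[OF Cons]) simp
  ultimately show ?case using Cons by simp
qed simp

lemma measurable_screen:
  assumes "\<And>t i. t \<le> T \<Longrightarrow> (\<lambda>\<omega>. score (D \<omega>) t i) \<in> borel_measurable M" "t \<le> T"
  shows "(\<lambda>\<omega>. screen n \<epsilon> (D \<omega>) t) \<in> measurable M (count_space UNIV)"
  using assms(2)
proof (induction t)
  case (Suc t)
  have filter: "(\<lambda>\<omega>. filter (passes \<epsilon> (D \<omega>) (Suc t)) xs) \<in> measurable M (count_space UNIV)" for xs
    using assms(1)[of "Suc t"] Suc.prems by (intro measurable_filter_passes)
  have "(\<lambda>\<omega>. case p of (xs, w) \<Rightarrow> if budget n \<epsilon> < real (w + length xs) then ([], w)
      else (filter (passes \<epsilon> (D \<omega>) (Suc t)) xs, w + length xs)) \<in> measurable M (count_space UNIV)" for p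
    by (cases p) (auto intro: measurable_compose[OF filter])
  \<comment> \<open>The screening state has a countable type, so measurability may be checked for
    each fixed earlier state \<open>p\<close>.\<close>
  from measurable_compose_countable[OF this Suc.IH] Suc.prems show ?case by simp
qed simp

lemma measurable_selected:
  assumes "\<And>t i. t \<le> screen_size n \<epsilon> \<Longrightarrow> (\<lambda>\<omega>. score (D \<omega>) t i) \<in> borel_measurable M"
  shows "(\<lambda>\<omega>. selected n \<epsilon> (D \<omega>)) \<in> measurable M (count_space UNIV)"
  unfolding selected_def by (rule measurable_compose[OF measurable_screen[OF assms order_refl]]) auto

lemma borel_measurable_score:
  assumes "{..<t} \<subseteq> I"
  shows "(\<lambda>X. score (labelled f X) t i) \<in> borel_measurable (Pi\<^sub>M I (\<lambda>_. uniform n))"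
  unfolding score_def fst_conv snd_conv
  using assms by (intro borel_measurable_sum measurable_component_comp[where h = "\<lambda>x. pm (x i) * f x"]) auto

lemma borel_measurable_score_iid [measurable]:
  "(\<lambda>X. score (labelled f X) t i) \<in> borel_measurable (iid_points n)"
  unfolding iid_points_def by (rule borel_measurable_score) simp

lemma score_events:
  fixes f :: "point \<Rightarrow> real"
  shows "{X. score (labelled f X) t i < c} \<in> sets (iid_points n)"
    and "{X. score (labelled f X) t i \<le> c} \<in> sets (iid_points n)"
    and "{X. c \<le> score (labelled f X) t i} \<in> sets (iid_points n)"
proof -
  note [measurable] = borel_measurable_score_iid[of f t i n]
  have "{X \<in> space (iid_points n). score (labelled f X) t i < c} \<in> sets (iid_points n)"
    "{X \<in> space (iid_points n). score (labelled f X) t i \<le> c} \<in> sets (iid_points n)"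
    "{X \<in> space (iid_points n). c \<le> score (labelled f X) t i} \<in> sets (iid_points n)"
    by measurable
  then show "{X. score (labelled f X) t i < c} \<in> sets (iid_points n)"
    "{X. score (labelled f X) t i \<le> c} \<in> sets (iid_points n)"
    "{X. c \<le> score (labelled f X) t i} \<in> sets (iid_points n)"
    by simp_all
qed

text \<open>\<open>V t\<close> is what screening would keep without a budget. If the work of that
  ideal process fits into the budget, the cutoff never fires and the two agree; the analysis can
  then count passed tests instead of following lists.\<close>

lemma screen_eq:
  fixes n m :: nat and \<epsilon> :: real and D :: "nat \<Rightarrow> point \<times> real"
  defines "V \<equiv> \<lambda>t. {i. i < n \<and> (\<forall>u. 0 < u \<and> u \<le> t \<longrightarrow> passes \<epsilon> D u i)}"
  assumes "real (\<Sum>t<m. card (V t)) \<le> budget n \<epsilon>" "t \<le> m"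
  shows "set (fst (screen n \<epsilon> D t)) = V t \<and> snd (screen n \<epsilon> D t) = (\<Sum>u<t. card (V u))"
  using assms(3)
proof (induction t)
  case 0
  then show ?case by (auto simp: V_def)
next
  case (Suc t)
  obtain xs w where sc: "screen n \<epsilon> D t = (xs, w)" by fastforce
  have IH: "set xs = V t" "w = (\<Sum>u<t. card (V u))" using Suc sc by auto
  have len: "length xs = card (V t)"
    using screen_sound[of n \<epsilon> D t] IH sc by (simp flip: distinct_card)
  have "(\<Sum>u<Suc t. card (V u)) \<le> (\<Sum>u<m. card (V u))"
    using Suc.prems by (intro sum_mono2) auto
  then have "real (w + length xs) \<le> real (\<Sum>u<m. card (V u))"
    using IH(2) len by (intro of_nat_mono) simp
  then have "real (w + length xs) \<le> budget n \<epsilon>"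
    using assms(2) by (rule order_trans)
  moreover have "V (Suc t) = {i \<in> V t. passes \<epsilon> D (Suc t) i}"
    by (auto simp: V_def le_Suc_eq)
  ultimately show ?case using sc IH len by auto
qed

section \<open>Tail sums and the success of screening\<close>

context
  fixes n :: nat and \<epsilon> :: real
  assumes n: "2 \<le> n" and eps: "0 < \<epsilon>" "\<epsilon> < 1"
begin

lemma thr_le: "thr \<epsilon> \<le> 1" and rate_pos: "0 < rate \<epsilon>" and rate_le: "rate \<epsilon> \<le> 1"
proof -
  have "\<epsilon> * \<epsilon> * \<epsilon> * \<epsilon> \<le> 1" using eps by (intro mult_le_one) auto
  moreover have "(1::real) \<le> 9 ^ deg_bound \<epsilon>" by (rule one_le_power) simp
  ultimately have "\<epsilon> * \<epsilon> * \<epsilon> * \<epsilon> / 16 \<le> 1 * 9 ^ deg_bound \<epsilon>" by linarith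
  then show thr: "thr \<epsilon> \<le> 1" unfolding thr_def by (simp add: divide_le_eq)
  show "0 < rate \<epsilon>" using thr_pos[OF n eps] by (simp add: rate_def)
  show "rate \<epsilon> \<le> 1"
    using mult_mono[OF thr thr] thr_pos[OF n eps] by (simp add: rate_def)
qed

lemma rate_burn: "rate \<epsilon> * burn \<epsilon> = 40 / (thr \<epsilon> * rate \<epsilon>)"
  using rate_pos by (simp add: burn_def)

text \<open>A geometric tail starting at \<open>burn\<close>: its leading term is at most 1 / (rate
  * burn) = thr * rate / 40, and the series contributes at most 2 / rate. \<open>burn\<close> is
  chosen for this; the remaining factor thr pays for a union bound over up to 1 / thr influential
  coordinates.\<close>

lemma sum_exp_rate: "(\<Sum>t | t < m \<and> burn \<epsilon> \<le> real t. exp (- rate \<epsilon> * real t)) \<le> thr \<epsilon> / 20"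
proof -
  define q where "q = exp (- rate \<epsilon>)"
  define k where "k = nat \<lceil>burn \<epsilon>\<rceil>"
  have q: "0 < q" "q < 1" using rate_pos by (auto simp: q_def)
  have q_power: "exp (- rate \<epsilon> * real t) = q ^ t" for t
    unfolding q_def by (simp add: exp_of_nat_mult[symmetric] mult.commute)
  have k: "burn \<epsilon> \<le> real k" unfolding k_def by linarith
  have "(\<Sum>t | t < m \<and> burn \<epsilon> \<le> real t. exp (- rate \<epsilon> * real t)) \<le> (\<Sum>t\<in>{0 + k..<m + k}. q ^ t)"
    unfolding q_power
  proof (rule sum_mono2)
    show "{t. t < m \<and> burn \<epsilon> \<le> real t} \<subseteq> {0 + k..<m + k}"
    proof
      fix t assume t: "t \<in> {t. t < m \<and> burn \<epsilon> \<le> real t}"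
      then have "k \<le> t" unfolding k_def by (simp add: nat_le_iff ceiling_le_iff)
      then show "t \<in> {0 + k..<m + k}" using t by simp
    qed
  qed (use q in auto)
  also have "\<dots> = q ^ k * (\<Sum>t<m. q ^ t)"
    by (simp only: sum.shift_bounds_nat_ivl power_add sum_distrib_left lessThan_atLeast0 mult.commute)
  also have "\<dots> \<le> thr \<epsilon> * rate \<epsilon> / 40 * (2 / rate \<epsilon>)"
  proof (rule mult_mono)
    have "q ^ k \<le> exp (- (rate \<epsilon> * burn \<epsilon>))"
      using k rate_pos unfolding q_power[symmetric] by simp
    also have "\<dots> \<le> 1 / (rate \<epsilon> * burn \<epsilon>)"
    proof -
      have y: "0 < rate \<epsilon> * burn \<epsilon>" using rate_pos burn_pos[OF n eps] by simp
      have "rate \<epsilon> * burn \<epsilon> \<le> exp (rate \<epsilon> * burn \<epsilon>)"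
        using exp_ge_add_one_self[of "rate \<epsilon> * burn \<epsilon>"] by linarith
      then show ?thesis using y by (simp add: exp_minus field_simps)
    qed
    finally show "q ^ k \<le> thr \<epsilon> * rate \<epsilon> / 40" unfolding rate_burn by simp
    have "1 + rate \<epsilon> \<le> exp (rate \<epsilon>)" by (rule exp_ge_add_one_self)
    then have "q \<le> 1 / (1 + rate \<epsilon>)"
      using rate_pos by (simp add: q_def exp_minus field_simps)
    also have "\<dots> \<le> 1 - rate \<epsilon> / 2"
    proof -
      have "rate \<epsilon> * rate \<epsilon> \<le> rate \<epsilon>" using mult_left_mono[OF rate_le, of "rate \<epsilon>"] rate_pos by simp
      then show ?thesis using rate_pos by (simp add: field_simps)
    qed
    finally have half: "rate \<epsilon> / 2 \<le> 1 - q" by simp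
    have "(1 - q) * (\<Sum>t<m. q ^ t) = 1 - q ^ m"
      by (rule one_diff_power_eq[symmetric])
    also have "\<dots> \<le> 1" using q by simp
    finally have "(\<Sum>t<m. q ^ t) \<le> 1 / (1 - q)" using q by (simp add: field_simps)
    also have "\<dots> \<le> 1 / (rate \<epsilon> / 2)" using half rate_pos by (intro divide_left_mono) auto
    finally show "(\<Sum>t<m. q ^ t) \<le> 2 / rate \<epsilon>" by simp
    show "0 \<le> thr \<epsilon> * rate \<epsilon> / 40" using thr_pos[OF n eps] rate_pos by simp
    show "0 \<le> (\<Sum>t<m. q ^ t)" using q by (simp add: sum_nonneg)
  qed
  also have "\<dots> = thr \<epsilon> / 20" using rate_pos by simp
  finally show ?thesis .
qed

text \<open>As rate * burn is at least 1, the exponent is at least lg n + 5, and n / 2^(lg n + 5) <=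
  1/32.\<close>

lemma exp_screen_size: "real n * exp (- rate \<epsilon> * real (screen_size n \<epsilon>)) \<le> 1 / 20"
  and burn_le_screen_size: "burn \<epsilon> \<le> real (screen_size n \<epsilon>)"
proof -
  have M: "screen_bound n \<epsilon> \<le> real (screen_size n \<epsilon>)"
    unfolding screen_size_def by linarith
  have "burn \<epsilon> * 1 \<le> screen_bound n \<epsilon>"
    unfolding screen_bound_def using burn_pos[OF n eps] by (intro mult_left_mono) auto
  then show "burn \<epsilon> \<le> real (screen_size n \<epsilon>)" using M by simp
  have "1 \<le> rate \<epsilon> * burn \<epsilon>"
  proof -
    have "thr \<epsilon> * rate \<epsilon> \<le> 1" using thr_le rate_le rate_pos by (intro mult_le_one) auto
    then show ?thesis unfolding rate_burn using thr_pos[OF n eps] rate_pos by (simp add: field_simps)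
  qed
  then have "1 * (real (lg n) + 5) \<le> rate \<epsilon> * burn \<epsilon> * (real (lg n) + 5)"
    by (intro mult_right_mono) auto
  also have "\<dots> \<le> rate \<epsilon> * real (screen_size n \<epsilon>)"
    using M rate_pos by (simp add: screen_bound_def mult.assoc)
  finally have "exp (- rate \<epsilon> * real (screen_size n \<epsilon>)) \<le> exp (- (real (lg n + 5)))" by simp
  also have "\<dots> = 1 / exp 1 ^ (lg n + 5)"
    unfolding exp_of_nat_mult[of "lg n + 5" "1::real", symmetric]
    by (simp add: exp_minus inverse_eq_divide del: of_nat_add)
  also have "\<dots> \<le> 1 / 2 ^ (lg n + 5)"
    using exp_ge_add_one_self[of 1] by (intro divide_left_mono power_mono) auto
  finally have "real n * exp (- rate \<epsilon> * real (screen_size n \<epsilon>)) \<le> real n * (1 / 2 ^ (lg n + 5))"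
    by (intro mult_left_mono) auto
  also have "\<dots> \<le> 2 ^ lg n * (1 / 2 ^ (lg n + 5))"
  proof (rule mult_right_mono)
    have "real n \<le> real (2 ^ lg n)" using le_two_power_lg[of n] by (rule of_nat_mono)
    then show "real n \<le> 2 ^ lg n" by simp
  qed simp
  also have "\<dots> \<le> 1 / 20" by (simp add: power_add)
  finally show "real n * exp (- rate \<epsilon> * real (screen_size n \<epsilon>)) \<le> 1 / 20" .
qed

context
  fixes f :: "point \<Rightarrow> real"
  assumes XOS: "XOS n f" and range: "\<And>x. x \<in> cube n \<Longrightarrow> f x \<in> {0..1}"
begin

lemma score_tail_large:
  assumes "i < n" "thr \<epsilon> \<le> fourier n f {i}" "0 < t"
  shows "measure (iid_points n) {X. score (labelled f X) t i < thr \<epsilon> / 2 * real t} \<le>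
    exp (- rate \<epsilon> * real t)"
proof -
  interpret prob_space "iid_points n" by (rule prob_space_iid_points)
  have "thr \<epsilon> * real t \<le> fourier n f {i} * real t" using assms by (intro mult_right_mono) auto
  then have "prob {X. score (labelled f X) t i < thr \<epsilon> / 2 * real t} \<le>
      prob {X. score (labelled f X) t i \<le> real t * fourier n f {i} - real t * (thr \<epsilon> / 2)}"
    by (intro finite_measure_mono score_events) (auto simp: algebra_simps)
  also have "\<dots> \<le> exp (- (real t * (thr \<epsilon> / 2)\<^sup>2 / 2))"
    using assms thr_pos[OF n eps] by (intro score_tail(2)[OF range]) auto
  also have "\<dots> \<le> exp (- rate \<epsilon> * real t)"
    by (simp add: rate_def power2_eq_square field_simps)
  finally show ?thesis .
qed

text \<open>This case fixes \<open>rate\<close>: the test lies at least thr / 4 above the mean, and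
  Hoeffding for variables in an interval of length 2 gives the exponent (thr / 4)^2 / 2 per example.
  Influential coordinates have the larger gap thr / 2.\<close>

lemma score_tail_small:
  assumes "i < n" "fourier n f {i} \<le> thr \<epsilon> / 4" "0 < t"
  shows "measure (iid_points n) {X. thr \<epsilon> / 2 * real t \<le> score (labelled f X) t i} \<le>
    exp (- rate \<epsilon> * real t)"
proof -
  interpret prob_space "iid_points n" by (rule prob_space_iid_points)
  have "fourier n f {i} * real t \<le> thr \<epsilon> / 4 * real t" using assms by (intro mult_right_mono) auto
  then have "prob {X. thr \<epsilon> / 2 * real t \<le> score (labelled f X) t i} \<le>
      prob {X. real t * fourier n f {i} + real t * (thr \<epsilon> / 4) \<le> score (labelled f X) t i}"
    by (intro finite_measure_mono score_events) (auto simp: algebra_simps)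
  also have "\<dots> \<le> exp (- (real t * (thr \<epsilon> / 4)\<^sup>2 / 2))"
    using assms thr_pos[OF n eps] by (intro score_tail(1)[OF range]) auto
  also have "\<dots> \<le> exp (- rate \<epsilon> * real t)"
    by (simp add: rate_def power2_eq_square field_simps)
  finally show ?thesis .
qed

text \<open>Three bad events, each of probability at most 1/20: an influential coordinate fails some
  test (\<open>B1\<close>), an uninfluential one passes the last test (\<open>B2\<close>), or the
  uninfluential ones cause too much work (\<open>B3\<close>). The union bound for \<open>B1\<close>
  runs over all times but at most 1 / thr coordinates; only the one for \<open>B2\<close> pays for
  \<open>n\<close>. Coordinates between thr / 4 and thr may go either way, as there are at most 4 /
  thr of them.\<close>

lemma screening_success:
  obtains B where "B \<in> sets (iid_points n)" "measure (iid_points n) B \<le> 3 / 20"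
    "\<And>X i. X \<notin> B \<Longrightarrow> i < n \<Longrightarrow> thr \<epsilon> \<le> fourier n f {i} \<Longrightarrow> i \<in> set (selected n \<epsilon> (labelled f X))"
proof -
  interpret prob_space "iid_points n" by (rule prob_space_iid_points)
  define m where "m = screen_size n \<epsilon>"
  define L where "L = {i. i < n \<and> thr \<epsilon> \<le> fourier n f {i}}"
  define S where "S = {i. i < n \<and> fourier n f {i} \<le> thr \<epsilon> / 4}"
  define T where "T = {t. t < Suc m \<and> burn \<epsilon> \<le> real t}"
  have T_pos: "0 < t" if "t \<in> T" for t
    using that burn_pos[OF n eps] by (cases t) (auto simp: T_def)
  have fin: "finite L" "finite S" "finite T" by (auto simp: L_def S_def T_def)
  have S_le: "real (card S) \<le> real n"
    using card_mono[of "{..<n}" S] by (auto simp: S_def)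
  define B1 where "B1 = (\<Union>i\<in>L. \<Union>t\<in>T. {X. score (labelled f X) t i < thr \<epsilon> / 2 * real t})"
  define B2 where "B2 = (\<Union>i\<in>S. {X. thr \<epsilon> / 2 * real m \<le> score (labelled f X) m i})"
  define P where "P t i = {X. passes \<epsilon> (labelled f X) t i}" for t i
  \<comment> \<open>Counts the single tests that uninfluential coordinates pass. A survivor has in
    particular passed its latest test, so this dominates the work spent on them.\<close>
  define W where "W X = (\<Sum>t<m. \<Sum>i\<in>S. indicat_real (P t i) X)" for X
  define B3 where "B3 = {X. 20 * real n * (burn \<epsilon> + 2) \<le> W X}"
  have ev1: "{X. score (labelled f X) t i < c} \<in> events" "{X. c \<le> score (labelled f X) t i} \<in> events" for t i c
    by (rule score_events)+
  have ev: "B1 \<in> events" "B2 \<in> events"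
    unfolding B1_def B2_def by (intro sets.finite_UN fin ev1)+
  have P_ev: "P t i \<in> events" for t i
    using ev1(2)[of "thr \<epsilon> / 2 * real t" t i] sets.top[of "iid_points n"] by (cases "real t < burn \<epsilon>") (auto simp: P_def passes_def)
  have W_int: "integrable (iid_points n) W"
    unfolding W_def using P_ev by (intro Bochner_Integration.integrable_sum) (simp add: emeasure_eq_measure)
  have B3_ev: "B3 \<in> events"
  proof -
    note [measurable] = borel_measurable_integrable[OF W_int]
    have "{X \<in> space (iid_points n). 20 * real n * (burn \<epsilon> + 2) \<le> W X} \<in> events" by measurable
    then show ?thesis by (simp add: B3_def)
  qed
  have p1: "prob B1 \<le> 1 / 20"
  proof -
    have "prob B1 \<le> (\<Sum>i\<in>L. prob (\<Union>t\<in>T. {X. score (labelled f X) t i < thr \<epsilon> / 2 * real t}))"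
      unfolding B1_def by (intro measure_UNION_le sets.finite_UN fin ev1)
    also have "\<dots> \<le> (\<Sum>i\<in>L. \<Sum>t\<in>T. prob {X. score (labelled f X) t i < thr \<epsilon> / 2 * real t})"
      by (intro sum_mono measure_UNION_le fin ev1)
    also have "\<dots> \<le> (\<Sum>i\<in>L. \<Sum>t\<in>T. exp (- rate \<epsilon> * real t))"
      using T_pos by (intro sum_mono score_tail_large) (auto simp: L_def)
    also have "\<dots> \<le> (\<Sum>i\<in>L. thr \<epsilon> / 20)"
      unfolding T_def by (intro sum_mono sum_exp_rate)
    also have "\<dots> = real (card L) * thr \<epsilon> / 20" by simp
    also have "\<dots> \<le> (1 / thr \<epsilon>) * thr \<epsilon> / 20"
      using card_influential[OF XOS range thr_pos[OF n eps], of L] thr_pos[OF n eps]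
      by (intro divide_right_mono mult_right_mono) (auto simp: L_def)
    finally show ?thesis using thr_pos[OF n eps] by simp
  qed
  have p2: "prob B2 \<le> 1 / 20"
  proof -
    have "0 < m" using burn_le_screen_size burn_pos[OF n eps] by (cases m) (auto simp: m_def)
    have "prob B2 \<le> (\<Sum>i\<in>S. prob {X. thr \<epsilon> / 2 * real m \<le> score (labelled f X) m i})"
      unfolding B2_def by (intro measure_UNION_le fin ev1)
    also have "\<dots> \<le> (\<Sum>i\<in>S. exp (- rate \<epsilon> * real m))"
      using \<open>0 < m\<close> by (intro sum_mono score_tail_small) (auto simp: S_def)
    also have "\<dots> \<le> real n * exp (- rate \<epsilon> * real m)" using S_le by simp
    finally show ?thesis using exp_screen_size by (simp add: m_def)
  qed
  have p3: "prob B3 \<le> 1 / 20"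
  proof -
    have "expectation W = (\<Sum>t<m. \<Sum>i\<in>S. prob (P t i))"
      unfolding W_def using P_ev
      by (simp add: Bochner_Integration.integral_sum Bochner_Integration.integrable_sum emeasure_eq_measure)
    also have "\<dots> = (\<Sum>i\<in>S. \<Sum>t<m. prob (P t i))" by (rule sum.swap)
    \<comment> \<open>At most burn + 1 times precede the first real test, and the tail sum after
      them is at most 1.\<close>
    also have "\<dots> \<le> (\<Sum>i\<in>S. burn \<epsilon> + 2)"
    proof (rule sum_mono)
      fix i assume i: "i \<in> S"
      have "(\<Sum>t<m. prob (P t i)) =
          (\<Sum>t\<in>{t. t < m \<and> burn \<epsilon> \<le> real t} \<union> {t. t < m \<and> real t < burn \<epsilon>}. prob (P t i))"
        by (intro sum.cong) auto
      also have "\<dots> = (\<Sum>t | t < m \<and> burn \<epsilon> \<le> real t. prob (P t i)) + (\<Sum>t | t < m \<and> real t < burn \<epsilon>. prob (P t i))"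
        by (intro sum.union_disjoint) auto
      also have "(\<Sum>t | t < m \<and> burn \<epsilon> \<le> real t. prob (P t i)) \<le>
          (\<Sum>t | t < m \<and> burn \<epsilon> \<le> real t. exp (- rate \<epsilon> * real t))"
      proof (rule sum_mono)
        fix t assume t: "t \<in> {t. t < m \<and> burn \<epsilon> \<le> real t}"
        then have "P t i = {X. thr \<epsilon> / 2 * real t \<le> score (labelled f X) t i}"
          by (auto simp: P_def passes_def)
        moreover have "0 < t" using t T_pos[of t] by (simp add: T_def)
        ultimately show "prob (P t i) \<le> exp (- rate \<epsilon> * real t)"
          using score_tail_small[of i t] i by (simp add: S_def)
      qed
      also have "\<dots> \<le> thr \<epsilon> / 20" by (rule sum_exp_rate)
      also have "\<dots> \<le> 1" using thr_le by simp
      also have "(\<Sum>t | t < m \<and> real t < burn \<epsilon>. prob (P t i)) \<le> (\<Sum>t | t < m \<and> real t < burn \<epsilon>. 1)"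
        by (intro sum_mono) simp
      also have "\<dots> = real (card {t. t < m \<and> real t < burn \<epsilon>})" by simp
      also have "\<dots> \<le> real (card {..<nat \<lceil>burn \<epsilon>\<rceil>})"
        by (intro of_nat_mono card_mono) (auto simp: less_nat_ceiling_iff)
      also have "\<dots> \<le> burn \<epsilon> + 1"
        using burn_pos[OF n eps] by simp
      finally show "(\<Sum>t<m. prob (P t i)) \<le> burn \<epsilon> + 2" by simp
    qed
    also have "\<dots> \<le> real n * (burn \<epsilon> + 2)"
      using S_le burn_pos[OF n eps] by simp
    finally have E: "expectation W \<le> real n * (burn \<epsilon> + 2)" .
    have pos: "0 < 20 * real n * (burn \<epsilon> + 2)" using n burn_pos[OF n eps] by simp
    have "prob {X \<in> space (iid_points n). W X \<ge> 20 * real n * (burn \<epsilon> + 2)} \<le>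
        expectation W / (20 * real n * (burn \<epsilon> + 2))"
      using pos by (intro integral_Markov_inequality_measure[OF W_int, of "{}"]) (auto simp: W_def sum_nonneg)
    also have "\<dots> \<le> (real n * (burn \<epsilon> + 2)) / (20 * real n * (burn \<epsilon> + 2))"
      using E pos by (intro divide_right_mono) auto
    also have "\<dots> = 1 / 20" using pos by (simp add: field_simps)
    finally show ?thesis by (simp add: B3_def)
  qed
  show thesis
  proof
    show "B1 \<union> B2 \<union> B3 \<in> events" using ev B3_ev by auto
    have "prob (B1 \<union> B2 \<union> B3) \<le> prob B1 + prob B2 + prob B3"
      using measure_Un_le[of "B1 \<union> B2" "iid_points n" B3] measure_Un_le[of B1 "iid_points n" B2] ev B3_ev
      by auto
    then show "prob (B1 \<union> B2 \<union> B3) \<le> 3 / 20" using p1 p2 p3 by linarith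
    fix X i assume X: "X \<notin> B1 \<union> B2 \<union> B3" and i: "i < n" "thr \<epsilon> \<le> fourier n f {i}"
    let ?D = "labelled f X"
    define V where "V t = {i. i < n \<and> (\<forall>u. 0 < u \<and> u \<le> t \<longrightarrow> passes \<epsilon> ?D u i)}" for t
    define R where "R = {i. i < n \<and> thr \<epsilon> / 4 < fourier n f {i}}"
    have R_card: "real (card R) \<le> 4 / thr \<epsilon>"
      using card_influential[OF XOS range, of "thr \<epsilon> / 4" R] thr_pos[OF n eps] by (simp add: R_def less_imp_le subset_iff)
    \<comment> \<open>At time 0 no test has been made; \<open>passes\<close> holds there because
      \<open>burn\<close> is positive.\<close>
    have V_sub: "V t \<subseteq> R \<union> {i \<in> S. X \<in> P t i}" for t
      using burn_pos[OF n eps] by (cases t) (auto simp: V_def R_def S_def P_def passes_def)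
    have "real (\<Sum>t<m. card (V t)) \<le> real (\<Sum>t<m. card R + card {i \<in> S. X \<in> P t i})"
    proof (intro of_nat_mono sum_mono)
      fix t
      have "card (V t) \<le> card (R \<union> {i \<in> S. X \<in> P t i})"
        using fin by (intro card_mono V_sub) (auto simp: R_def)
      also have "\<dots> \<le> card R + card {i \<in> S. X \<in> P t i}" by (rule card_Un_le)
      finally show "card (V t) \<le> card R + card {i \<in> S. X \<in> P t i}" .
    qed
    also have "\<dots> = real m * real (card R) + W X"
      using fin by (simp add: sum.distrib W_def indicator_def sum.If_cases Int_def)
    also have "\<dots> \<le> (screen_bound n \<epsilon> + 1) * (4 / thr \<epsilon>) + 20 * real n * (burn \<epsilon> + 2)"
    proof (intro add_mono mult_mono)
      have "0 \<le> screen_bound n \<epsilon>" using burn_pos[OF n eps] by (simp add: screen_bound_def)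
      then show "real m \<le> screen_bound n \<epsilon> + 1" "0 \<le> screen_bound n \<epsilon> + 1"
        unfolding m_def screen_size_def by linarith+
      show "W X \<le> 20 * real n * (burn \<epsilon> + 2)" using X by (simp add: B3_def)
    qed (use R_card in simp_all)
    also have "\<dots> = budget n \<epsilon>" by (simp add: budget_def mult.commute)
    finally have "set (fst (screen n \<epsilon> ?D m)) = V m"
      using screen_eq[where m = m and n = n and \<epsilon> = \<epsilon> and D = ?D and t = m] unfolding V_def by blast
    moreover have "V m \<subseteq> R"
    proof
      fix i assume V: "i \<in> V m"
      have "0 < m" "burn \<epsilon> \<le> real m"
        using burn_le_screen_size burn_pos[OF n eps] by (cases m, auto simp: m_def)
      then have "thr \<epsilon> / 2 * real m \<le> score ?D m i" using V by (auto simp: V_def passes_def)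
      then have "i \<notin> S" using X by (auto simp: B2_def)
      then show "i \<in> R" using V by (auto simp: V_def R_def S_def)
    qed
    moreover have "length (fst (screen n \<epsilon> ?D m)) = card (set (fst (screen n \<epsilon> ?D m)))"
      using screen_sound[of n \<epsilon> ?D m] by (simp add: distinct_card)
    moreover have "card (V m) \<le> card R" if "V m \<subseteq> R"
      using that by (intro card_mono) (auto simp: R_def)
    ultimately have "set (selected n \<epsilon> ?D) = V m"
      using R_card by (auto simp: selected_def Let_def m_def[symmetric])
    moreover have "i \<in> V m"
      unfolding V_def
    proof (intro CollectI conjI allI impI i(1))
      fix u assume u: "0 < u \<and> u \<le> m"
      show "passes \<epsilon> ?D u i"
      proof (cases "real u < burn \<epsilon>")
        case False
        then have "u \<in> T" "i \<in> L" using u i by (auto simp: T_def L_def)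
        then have "\<not> score ?D u i < thr \<epsilon> / 2 * real u" using X by (auto simp: B1_def)
        then show ?thesis by (simp add: passes_def)
      qed (simp add: passes_def)
    qed
    ultimately show "i \<in> set (selected n \<epsilon> ?D)" by simp
  qed
qed

end

end

lemma borel_measurable_estimate:
  assumes "{m..} \<subseteq> I"
  shows "(\<lambda>X. estimate (labelled f X) m t S) \<in> borel_measurable (Pi\<^sub>M I (\<lambda>_. uniform n))"
  unfolding estimate_def fst_conv snd_conv
  using assms
  by (intro borel_measurable_divide borel_measurable_sum borel_measurable_const
      measurable_component_comp[where h = "\<lambda>x. character S x * f x"]) auto

lemma borel_measurable_hypothesis:
  "(\<lambda>X. learned n \<epsilon> (labelled f X) x)
    \<in> borel_measurable (iid_points n)"
proof (rule measurable_compose_countable[where g = "\<lambda>X. selected n \<epsilon> (labelled f X)"])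
  show "(\<lambda>X. hypothesis n \<epsilon> (labelled f X) xs x) \<in> borel_measurable (iid_points n)" for xs
    unfolding hypothesis_def iid_points_def
    by (intro borel_measurable_sum borel_measurable_times borel_measurable_const
        borel_measurable_estimate) simp
  show "(\<lambda>X. selected n \<epsilon> (labelled f X)) \<in> measurable (iid_points n) (count_space UNIV)"
    by (intro measurable_selected borel_measurable_score_iid)
qed

lemma norm2_event:
  assumes "\<And>x. x \<in> cube n \<Longrightarrow> (\<lambda>X. H X x) \<in> borel_measurable (iid_points n)"
  shows "{X. norm2 n (\<lambda>x. f x - H X x) \<le> \<epsilon>} \<in> sets (iid_points n)"
proof -
  have [measurable]: "(\<lambda>X. norm2 n (\<lambda>x. f x - H X x)) \<in> borel_measurable (iid_points n)"
    unfolding norm2_eq cube_avg_def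
    by (intro borel_measurable_sqrt[THEN measurable_compose[rotated]] borel_measurable_divide
        borel_measurable_sum borel_measurable_power borel_measurable_diff borel_measurable_const assms)
  have "{X \<in> space (iid_points n). norm2 n (\<lambda>x. f x - H X x) \<le> \<epsilon>} \<in> sets (iid_points n)"
    by measurable
  then show ?thesis by simp
qed

lemma deg_bound_ge: "0 < \<epsilon> \<Longrightarrow> 2 / \<epsilon> \<le> real (deg_bound \<epsilon>)"
  unfolding deg_bound_def by linarith

text \<open>The threshold is chosen to satisfy this equation: it makes the loss from discarded
  coordinates in \<open>fourier_weight_outside\<close> at most a quarter of \<epsilon>^2.\<close>

lemma sqrt_thr: "3 ^ deg_bound \<epsilon> * sqrt (thr \<epsilon>) = \<epsilon>\<^sup>2 / 4"
proof -
  let ?d = "deg_bound \<epsilon>"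
  have "(9::real) ^ ?d = (3 ^ ?d)\<^sup>2"
    by (simp add: power_even_eq[symmetric]) (simp add: power_mult)
  then have "thr \<epsilon> = (\<epsilon>\<^sup>2 / (4 * 3 ^ ?d))\<^sup>2"
    by (simp add: thr_def power2_eq_square)
  then have "sqrt (thr \<epsilon>) = \<epsilon>\<^sup>2 / (4 * 3 ^ ?d)"
    by (simp add: real_sqrt_abs)
  then show ?thesis by simp
qed

section \<open>Combining screening and fitting\<close>

context
  fixes n :: nat and \<epsilon> :: real and f :: "point \<Rightarrow> real"
  assumes n: "2 \<le> n" and eps: "0 < \<epsilon>" "\<epsilon> < 1"
    and XOS: "XOS n f" and range: "\<And>x. x \<in> cube n \<Longrightarrow> f x \<in> {0..1}"
begin

lemma hypothesis_error:
  assumes "set xs \<subseteq> {..<n}" "\<And>i. i < n \<Longrightarrow> thr \<epsilon> \<le> fourier n f {i} \<Longrightarrow> i \<in> set xs"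
    and "(\<Sum>S\<in>low_subsets (deg_bound \<epsilon>) (set xs). (estimate D (screen_size n \<epsilon>)
      (fit_size \<epsilon> (card (low_subsets (deg_bound \<epsilon>) (set xs)))) S - fourier n f S)\<^sup>2) < \<epsilon>\<^sup>2 / 4"
  shows "norm2 n (\<lambda>x. f x - hypothesis n \<epsilon> D xs x) \<le> \<epsilon>"
proof -
  let ?d = "deg_bound \<epsilon>"
  have tail: "(\<Sum>S\<in>Pow {..<n} - low_subsets (deg_bound \<epsilon>) (set xs). (fourier n f S)\<^sup>2) \<le>
      1 / (real ?d + 1)\<^sup>2 + 3 ^ ?d * sqrt (thr \<epsilon>)"
  proof (rule fourier_weight_outside[OF XOS range assms(1)])
    show "fourier n f {i} \<le> thr \<epsilon>" if "i < n" "i \<notin> set xs" for i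
      using assms(2)[OF that(1)] that(2) by linarith
  qed (use thr_pos[OF n eps] in auto)
  have "2 / \<epsilon> \<le> real ?d + 1" using deg_bound_ge[OF eps(1)] by simp
  then have "(2 / \<epsilon>)\<^sup>2 \<le> (real ?d + 1)\<^sup>2" using eps by (intro power_mono) auto
  then have "1 / (real ?d + 1)\<^sup>2 \<le> 1 / (2 / \<epsilon>)\<^sup>2"
    using eps by (intro divide_left_mono) auto
  then have deg: "1 / (real ?d + 1)\<^sup>2 \<le> \<epsilon>\<^sup>2 / 4" by (simp add: power_divide)
  have "cube_avg n (\<lambda>x. (f x - hypothesis n \<epsilon> D xs x)\<^sup>2) =
      (\<Sum>S\<in>low_subsets (deg_bound \<epsilon>) (set xs). (estimate D (screen_size n \<epsilon>)
        (fit_size \<epsilon> (card (low_subsets (deg_bound \<epsilon>) (set xs)))) S - fourier n f S)\<^sup>2) +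
      (\<Sum>S\<in>Pow {..<n} - low_subsets (deg_bound \<epsilon>) (set xs). (fourier n f S)\<^sup>2)"
    unfolding hypothesis_def using assms(1) by (intro cube_avg_square_error) auto
  also have "\<dots> \<le> \<epsilon>\<^sup>2" using assms(3) tail deg zero_le_power2[of \<epsilon>] unfolding sqrt_thr by linarith
  finally show ?thesis
    unfolding norm2_eq using eps by (intro real_le_lsqrt) (auto intro: cube_avg_nonneg)
qed

text \<open>The selected set is random but determined by the first \<open>m\<close> examples, while
  for a fixed \<open>J\<close> the failure of fitting depends on later ones. So each joint event has
  at most a tenth of the probability of selecting \<open>J\<close>, and since these selections are
  disjoint the sum over all \<open>J\<close> costs no factor. Altogether 3/20 + 1/10 = 1/4 <
  1/3.\<close>

lemma learning_success:
  "2 / 3 \<le> measure (iid_points n)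
    {X. norm2 n (\<lambda>x. f x - learned n \<epsilon> (labelled f X) x) \<le> \<epsilon>}"
proof -
  interpret prob_space "iid_points n" by (rule prob_space_iid_points)
  define sel where "sel X = set (selected n \<epsilon> (labelled f X))" for X
  define m where "m = screen_size n \<epsilon>"
  define late where "late J X \<longleftrightarrow> \<epsilon>\<^sup>2 / 4 \<le> (\<Sum>S\<in>low_subsets (deg_bound \<epsilon>) J. (estimate (labelled f X) m
      (fit_size \<epsilon> (card (low_subsets (deg_bound \<epsilon>) J))) S - fourier n f S)\<^sup>2)" for J X
  obtain B where B: "B \<in> events" "prob B \<le> 3 / 20"
    "\<And>X i. X \<notin> B \<Longrightarrow> i < n \<Longrightarrow> thr \<epsilon> \<le> fourier n f {i} \<Longrightarrow> i \<in> sel X"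
    using screening_success[OF n eps XOS range] unfolding sel_def by metis
  let ?G = "{X. norm2 n (\<lambda>x. f x - learned n \<epsilon> (labelled f X) x) \<le> \<epsilon>}"
  have G: "?G \<in> events" by (intro norm2_event borel_measurable_hypothesis)
  have sel_sub: "sel X \<in> Pow {..<n}" for X
    using screen_sound[of n \<epsilon> "labelled f X" m] by (auto simp: sel_def selected_def Let_def m_def)
  have sel_meas: "{X \<in> space (Pi\<^sub>M I (\<lambda>_. uniform n)). sel X = J} \<in> sets (Pi\<^sub>M I (\<lambda>_. uniform n))"
    if "{..<m} \<subseteq> I" for I J
  proof -
    have [measurable]: "(\<lambda>X. selected n \<epsilon> (labelled f X)) \<in>
        measurable (Pi\<^sub>M I (\<lambda>_. uniform n)) (count_space UNIV)"
      using that by (intro measurable_selected borel_measurable_score) (auto simp: m_def)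
    show ?thesis unfolding sel_def by measurable
  qed
  have late_meas: "{X \<in> space (Pi\<^sub>M I (\<lambda>_. uniform n)). late J X} \<in> sets (Pi\<^sub>M I (\<lambda>_. uniform n))"
    if "{m..} \<subseteq> I" for I J
  proof -
    note [measurable] = borel_measurable_estimate[OF that]
    show ?thesis unfolding late_def by measurable
  qed
  have sel_ev: "{X. sel X = J} \<in> events" for J
    using sel_meas[of UNIV J] by (simp add: iid_points_def space_PiM)
  have late_ev: "{X. late J X} \<in> events" for J
    using late_meas[of UNIV J] by (simp add: iid_points_def space_PiM)
  have both_ev: "{X. sel X = J \<and> late J X} \<in> events" for J
    using sets.Int[OF sel_ev late_ev] by (simp add: Collect_conj_eq)
  have both: "prob {X. sel X = J \<and> late J X} \<le> prob {X. sel X = J} * (1 / 10)" if "J \<in> Pow {..<n}" for J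
  proof -
    have indep: "prob {X. sel X = J \<and> late J X} = prob {X. sel X = J} * prob {X. late J X}"
    proof (rule prob_early_late[OF sel_meas late_meas])
      show "(sel (restrict X {..<m}) = J) = (sel X = J)" for X
        unfolding sel_def
        using selected_cong[of n \<epsilon> "labelled f (restrict X {..<m})" "labelled f X"] by (simp add: m_def)
      show "late J (restrict X {m..}) = late J X" for X
        by (simp add: late_def estimate_def)
    qed auto
    have "prob {X. late J X} \<le> 1 / 10"
      unfolding late_def using that eps finite_subset[of J "{..<n}"]
      by (intro fit_failure[OF range]) auto
    then show ?thesis unfolding indep by (intro mult_left_mono measure_nonneg)
  qed
  have "prob (UNIV - ?G) \<le> prob (B \<union> (\<Union>J\<in>Pow {..<n}. {X. sel X = J \<and> late J X}))"
  proof (rule finite_measure_mono)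
    show "UNIV - ?G \<subseteq> B \<union> (\<Union>J\<in>Pow {..<n}. {X. sel X = J \<and> late J X})"
    proof
      fix X assume X: "X \<in> UNIV - ?G"
      have "X \<in> B \<or> late (sel X) X"
      proof (rule ccontr)
        assume "\<not> (X \<in> B \<or> late (sel X) X)"
        then have "norm2 n (\<lambda>x. f x - learned n \<epsilon> (labelled f X) x) \<le> \<epsilon>"
          using sel_sub[of X] B(3)[of X]
          by (intro hypothesis_error) (auto simp: late_def sel_def m_def)
        then show False using X by simp
      qed
      then show "X \<in> B \<union> (\<Union>J\<in>Pow {..<n}. {X. sel X = J \<and> late J X})"
        using sel_sub[of X] by blast
    qed
    show "B \<union> (\<Union>J\<in>Pow {..<n}. {X. sel X = J \<and> late J X}) \<in> events"
      using B(1) both_ev by (intro sets.Un sets.finite_UN) auto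
  qed
  also have "\<dots> \<le> prob B + prob (\<Union>J\<in>Pow {..<n}. {X. sel X = J \<and> late J X})"
    using B(1) both_ev by (intro measure_Un_le sets.finite_UN) auto
  also have "prob (\<Union>J\<in>Pow {..<n}. {X. sel X = J \<and> late J X}) \<le>
      (\<Sum>J\<in>Pow {..<n}. prob {X. sel X = J \<and> late J X})"
    using both_ev by (intro measure_UNION_le) auto
  also have "\<dots> \<le> (\<Sum>J\<in>Pow {..<n}. prob {X. sel X = J} * (1 / 10))"
    by (intro sum_mono both)
  also have "\<dots> = prob (\<Union>J\<in>Pow {..<n}. {X. sel X = J}) / 10"
    using sel_ev
    by (subst finite_measure_finite_Union) (auto simp: disjoint_family_on_def sum_divide_distrib)
  also have "\<dots> \<le> 1 / 10" by simp
  finally have "prob (UNIV - ?G) \<le> 1 / 4" using B(2) by simp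
  moreover have "prob (UNIV - ?G) = 1 - prob ?G"
    using prob_compl[OF G] by simp
  ultimately show ?thesis by simp
qed

end

section \<open>One variable\<close>

text \<open>For \<open>n = 1\<close> the bound \<open>r powr (C / \<epsilon>)\<close> is \<open>1\<close>, so the program has to stop after a bounded number
  of steps however small \<open>\<epsilon>\<close> is.\<close>

definition slope :: "(nat \<Rightarrow> point \<times> real) \<Rightarrow> real" where
  "slope D = (if fst (D 1) 0 then snd (D 1) else if fst (D 0) 0 then snd (D 0) else 0)"

lemma com_small_correct:
  "reaches D com_small (start n \<epsilon>) 10
    (\<lambda>s. drawn s = 2 \<and> (\<forall>x. circuit_fun (emitted s) x = slope D * of_bool (x 0)))"
  by (rule reaches_straight)
    (simp_all add: com_small_def start_def circuit_fun_def circuit_vals_def wire_def slope_def)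

lemma cube_1_eqI: "x \<in> cube 1 \<Longrightarrow> y \<in> cube 1 \<Longrightarrow> x 0 = y 0 \<Longrightarrow> x = y"
proof
  fix i assume "x \<in> cube 1" "y \<in> cube 1" "x 0 = y 0"
  then show "x i = y i" by (cases i) (auto simp: cube_def)
qed

text \<open>In one variable the function is a multiple of \<open>x 0\<close>, so an example with the
  bit on reveals it exactly. Two draws miss such an example with probability 1/4; a single draw
  would miss it with probability 1/2.\<close>

lemma small_success:
  assumes XOS: "XOS 1 f" and "0 < \<epsilon>"
  shows "2 / 3 \<le> measure (iid_points 1)
    {X. norm2 1 (\<lambda>x. f x - slope (labelled f X) * of_bool (x 0)) \<le> \<epsilon>}"
proof -
  interpret prob_space "iid_points 1" by (rule prob_space_iid_points)
  let ?H = "\<lambda>X x. slope (labelled f X) * of_bool (x 0)"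
  let ?G = "{X. norm2 1 (\<lambda>x. f x - ?H X x) \<le> \<epsilon>}"
  have bit_meas: "Measurable.pred (iid_points 1) (\<lambda>X. X j 0)" for j
    unfolding iid_points_def by (rule measurable_component_comp) auto
  have slope_meas: "(\<lambda>X. slope (labelled f X)) \<in> borel_measurable (iid_points 1)"
    unfolding slope_def fst_conv snd_conv
    by (intro measurable_If borel_measurable_iid_points borel_measurable_const) (use bit_meas[unfolded pred_def] in simp_all)
  have G: "?G \<in> events"
    by (intro norm2_event borel_measurable_times slope_meas borel_measurable_const)
  have half: "prob {X. \<not> X j 0} = 1 / 2" for j
  proof -
    have ev: "{X. \<not> X j 0} \<in> events"
      using bit_meas[of j] pred_intros_logic(2)[OF bit_meas[of j]] unfolding pred_def by simp
    have "prob {X. \<not> X j 0} = expectation (\<lambda>X. indicat_real {X. \<not> X j 0} X)"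
      using ev by (simp add: emeasure_eq_measure)
    also have "\<dots> = expectation (\<lambda>X. (\<lambda>x. of_bool (\<not> x 0)) (X j))"
      by (intro Bochner_Integration.integral_cong) (auto simp: indicator_def)
    also have "\<dots> = cube_avg (Suc 0) (\<lambda>x. of_bool (\<not> x 0))"
      using integral_iid_points[where n = 1 and j = j and h = "\<lambda>x. of_bool (\<not> x 0)"] by simp
    also have "\<dots> = cube_avg 0 (\<lambda>_. 1 / 2)"
      unfolding cube_avg_Suc by (intro cube_avg_cong) (auto simp: cube_def)
    finally show ?thesis by simp
  qed
  have miss: "prob {X. \<not> X 0 0 \<and> \<not> X 1 0} = 1 / 4"
  proof -
    have "prob {X. \<not> X 0 0 \<and> \<not> X 1 0} = prob {X. \<not> X 0 0} * prob {X. \<not> X 1 0}"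
    proof (rule prob_early_late[where m = 1])
      show "{X \<in> space (Pi\<^sub>M {..<1::nat} (\<lambda>_. uniform 1)). \<not> X 0 0} \<in> sets (Pi\<^sub>M {..<1} (\<lambda>_. uniform 1))"
        using measurable_component_comp[of 0 "{..<1::nat}" "\<lambda>x. \<not> x 0" "count_space UNIV" 1]
        by (simp add: pred_def)
      show "{X \<in> space (Pi\<^sub>M {1::nat..} (\<lambda>_. uniform 1)). \<not> X 1 0} \<in> sets (Pi\<^sub>M {1..} (\<lambda>_. uniform 1))"
        using measurable_component_comp[of 1 "{1::nat..}" "\<lambda>x. \<not> x 0" "count_space UNIV" 1]
        by (simp add: pred_def)
    qed auto
    then show ?thesis unfolding half by simp
  qed
  have "prob (UNIV - ?G) \<le> prob {X. \<not> X 0 0 \<and> \<not> X 1 0}"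
  proof (rule finite_measure_mono_AE)
    show "AE X in iid_points 1. X \<in> UNIV - ?G \<longrightarrow> X \<in> {X. \<not> X 0 0 \<and> \<not> X 1 0}"
      using AE_iid_points[where n = 1 and j = 0] AE_iid_points[where n = 1 and j = 1]
    proof eventually_elim
      case (elim X)
      have "X \<in> ?G" if hit: "X 0 0 \<or> X 1 0"
      proof -
        have "f x = ?H X x" if x: "x \<in> cube 1" for x
        proof (cases "x 0")
          case True
          have "X 1 = x" if "X 1 0" by (rule cube_1_eqI[OF elim(2) x]) (use that True in simp)
          moreover have "X 0 = x" if "X 0 0" by (rule cube_1_eqI[OF elim(1) x]) (use that True in simp)
          ultimately show ?thesis using hit True by (auto simp: slope_def)
        next
          case False
          obtain v where "f x = (\<Sum>i<1. v i * of_bool (x i))"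
            using XOS_certificate[OF XOS x] by metis
          then show ?thesis using False by simp
        qed
        then have "norm2 1 (\<lambda>x. f x - ?H X x) = sqrt (cube_avg 1 (\<lambda>_. 0))"
          unfolding norm2_eq by (intro arg_cong[where f = sqrt] cube_avg_cong) simp
        then show ?thesis using assms(2) by simp
      qed
      then show ?case by blast
    qed
    show "{X. \<not> X 0 0 \<and> \<not> X 1 0} \<in> events"
    proof -
      have "Measurable.pred (iid_points 1) (\<lambda>X. \<not> X 0 0 \<and> \<not> X 1 0)"
        using bit_meas[of 0] bit_meas[of 1] by measurable
      then show ?thesis by (simp add: pred_def)
    qed
  qed
  then have "prob (UNIV - ?G) \<le> 1 / 4" by (simp only: miss)
  moreover have "prob (UNIV - ?G) = 1 - prob ?G"
    using prob_compl[OF G] by simp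
  ultimately show ?thesis by simp
qed

section \<open>The learner\<close>

text \<open>Execution is deterministic, so the existential in the success event is decided by the
  one halting run. The event becomes a statement about the function \<open>H\<close>, free of
  programs.\<close>

lemma reaches_runs:
  assumes "reaches (labelled f X) A (start n \<epsilon>) T
    (\<lambda>s. drawn s = m \<and> (\<forall>x. circuit_fun (emitted s) x = H x))"
  shows "(\<exists>t m h. runs A n \<epsilon> f X t m h \<and> norm2 n (\<lambda>x. f x - circuit_fun h x) \<le> \<delta>) \<longleftrightarrow>
      norm2 n (\<lambda>x. f x - H x) \<le> \<delta>"
    and "\<exists>t h. runs A n \<epsilon> f X t m h \<and> t \<le> T"
proof -
  obtain t s where s: "exec (labelled f X) A (start n \<epsilon>) t s" "t \<le> T" "drawn s = m"
    "\<And>x. circuit_fun (emitted s) x = H x"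
    using assms by (auto simp: reaches_def)
  then have "runs A n \<epsilon> f X u k h \<longleftrightarrow> u = t \<and> k = m \<and> h = emitted s" for u k h
    using exec_deterministic[OF s(1)] unfolding runs_def by blast
  then show "(\<exists>t m h. runs A n \<epsilon> f X t m h \<and> norm2 n (\<lambda>x. f x - circuit_fun h x) \<le> \<delta>) \<longleftrightarrow>
      norm2 n (\<lambda>x. f x - H x) \<le> \<delta>" "\<exists>t h. runs A n \<epsilon> f X t m h \<and> t \<le> T"
    using s by auto
qed

theorem theorem1p2:
  shows "\<exists>(A :: com) (C :: real). \<forall>(n :: nat) (f :: point \<Rightarrow> real) (\<epsilon> :: real).
    n \<ge> 1 \<and> XOS n f \<and> (\<forall>x\<in>cube n. f x \<in> {0..1}) \<and> \<epsilon> > 0 \<longrightarrow>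
    \<P>(X in iid_points n. \<exists>t m h. runs A n \<epsilon> f X t m h \<and>
        norm2 n (\<lambda>x. f x - circuit_fun h x) \<le> \<epsilon>) \<ge> 2 / 3 \<and>
    (let r = min (real n) (2 powr (1 / \<epsilon>)) in
      \<forall>X. (\<forall>j. X j \<in> cube n) \<longrightarrow>
        (\<exists>t m h. runs A n \<epsilon> f X t m h \<and>
          real t \<le> C * r powr (C / \<epsilon>) * real n \<and>
          real m \<le> C * r powr (C / \<epsilon>) * max 1 (log 2 (real n))))"
proof (intro exI[of _ learner] exI[of _ "200::real"] allI impI, elim conjE)
  fix n :: nat and f :: "point \<Rightarrow> real" and \<epsilon> :: real
  assume n: "1 \<le> n" and XOS: "XOS n f" and range: "\<forall>x\<in>cube n. f x \<in> {0..1}" and eps: "0 < \<epsilon>"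
  define r where "r = min (real n) (2 powr (1 / \<epsilon>))"
  let ?D = "labelled f"
  have r_ge: "1 \<le> r" using n eps ge_one_powr_ge_zero[of 2 "1 / \<epsilon>"] by (simp add: r_def)
  \<comment> \<open>What the three cases deliver in common: running time, number of draws and output
    function, each depending on the example sequence.\<close>
  have "\<exists>T m H. (\<forall>X. reaches (?D X) learner (start n \<epsilon>) (T X)
        (\<lambda>s. drawn s = m X \<and> (\<forall>x. circuit_fun (emitted s) x = H X x))) \<and>
      2 / 3 \<le> measure (iid_points n) {X. norm2 n (\<lambda>x. f x - H X x) \<le> \<epsilon>} \<and>
      (\<forall>X. real (T X) \<le> 200 * r powr (200 / \<epsilon>) * real n) \<and>
      (\<forall>X. real (m X) \<le> 200 * r powr (200 / \<epsilon>) * max 1 (log 2 (real n)))"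
  proof -
    interpret prob_space "iid_points n" by (rule prob_space_iid_points)
    \<comment> \<open>As \<open>r\<close> is at least 1, the coefficient 200 alone covers the two
      degenerate cases, whose running times are constant.\<close>
    have C: "200 \<le> 200 * r powr (200 / \<epsilon>)" using r_ge eps ge_one_powr_ge_zero[of r "200 / \<epsilon>"] by simp
    consider "n = 1" | "2 \<le> n" "1 \<le> \<epsilon>" | "2 \<le> n" "\<epsilon> < 1" using n by linarith
    then show ?thesis
    proof cases
      case 1
      have "reaches (?D X) learner (start n \<epsilon>) 11
        (\<lambda>s. drawn s = 2 \<and> (\<forall>x. circuit_fun (emitted s) x = slope (?D X) * of_bool (x 0)))" for X
        using reaches_Cond[of "NLess (nv ''n'') (N 2)" "start n \<epsilon>" "?D X" com_small 10, OF com_small_correct] 1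
        unfolding learner_def by (simp add: start_def)
      moreover have "2 / 3 \<le> prob {X. norm2 n (\<lambda>x. f x - slope (?D X) * of_bool (x 0)) \<le> \<epsilon>}"
        using small_success[of f \<epsilon>] XOS eps 1 by simp
      ultimately show ?thesis
        using C 1 by (intro exI[of _ "\<lambda>_. 11"] exI[of _ "\<lambda>_. 2"]
          exI[of _ "\<lambda>X x. slope (?D X) * of_bool (x 0)"]) simp
    next
      case 2
      have "reaches (?D X) learner (start n \<epsilon>) 3
        (\<lambda>s. drawn s = 0 \<and> (\<forall>x. circuit_fun (emitted s) x = 0))" for X
        unfolding learner_def
      proof (rule reaches_mono[OF reaches_Cond])
        show "reaches (?D X) (Cond (RLess (rv ''eps'') (rnum 1)) com_main Skip) (start n \<epsilon>) 2
          (\<lambda>s. drawn s = 0 \<and> (\<forall>x. circuit_fun (emitted s) x = 0))"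
          by (rule reaches_mono[OF reaches_Cond[where T = 1]])
            (use 2 in \<open>auto simp: start_def circuit_fun_def intro: reaches_straight\<close>)
      qed (use 2 in \<open>auto simp: start_def\<close>)
      moreover have "norm2 n (\<lambda>x. f x - 0) \<le> \<epsilon>"
      proof -
        have "cube_avg n (\<lambda>x. (f x - 0)\<^sup>2) \<le> cube_avg n (\<lambda>_. 1)"
          using range by (intro cube_avg_mono) (simp add: power_le_one)
        then have "norm2 n (\<lambda>x. f x - 0) \<le> 1" unfolding norm2_eq by simp
        then show ?thesis using 2 by linarith
      qed
      moreover have "real n * 200 \<le> real n * (200 * r powr (200 / \<epsilon>))"
        using C by (intro mult_left_mono) auto
      then have "3 \<le> real n * (200 * r powr (200 / \<epsilon>))" using 2 by linarith
      then have "3 \<le> 200 * r powr (200 / \<epsilon>) * real n" by (simp only: mult.commute)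
      ultimately show ?thesis
        using prob_space by (intro exI[of _ "\<lambda>_. 3"] exI[of _ "\<lambda>_. 0"] exI[of _ "\<lambda>_ _. 0"]) simp
    next
      case 3
      define z where "z = r powr (1 / \<epsilon>)"
      have z: "2 \<le> z" using z_ge(1)[OF 3(1) eps 3(2)] by (simp add: z_def r_def)
      \<comment> \<open>The exponent 200 leaves room above the 160 for time and the 121 for
        samples.\<close>
      have z_power: "r powr (200 / \<epsilon>) = z ^ 200"
        using powr_realpow[of z 200] z r_ge by (simp add: z_def powr_powr)
      have run: "reaches (?D X) learner (start n \<epsilon>) (main_cost n \<epsilon> (?D X) + 2)
        (\<lambda>s. drawn s = main_samples n \<epsilon> (?D X) \<and> (\<forall>x. circuit_fun (emitted s) x = learned n \<epsilon> (?D X) x))" for X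
        unfolding learner_def
      proof (rule reaches_mono[OF reaches_Cond])
        show "reaches (?D X) (Cond (RLess (rv ''eps'') (rnum 1)) com_main Skip) (start n \<epsilon>) (main_cost n \<epsilon> (?D X) + 1)
          (\<lambda>s. drawn s = main_samples n \<epsilon> (?D X) \<and> (\<forall>x. circuit_fun (emitted s) x = learned n \<epsilon> (?D X) x))"
          by (rule reaches_Cond[OF com_main_correct[OF eps]]) (use 3 in \<open>simp add: start_def\<close>)
      qed (use 3 in \<open>auto simp: start_def\<close>)
      have success: "2 / 3 \<le> prob {X. norm2 n (\<lambda>x. f x - learned n \<epsilon> (?D X) x) \<le> \<epsilon>}"
        by (rule learning_success[OF 3(1) eps 3(2) XOS bspec[OF range]])
      have time: "real (main_cost n \<epsilon> (?D X) + 2) \<le> 200 * r powr (200 / \<epsilon>) * real n" for X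
      proof -
        have "real (main_cost n \<epsilon> (?D X)) \<le> z ^ 160 * real n"
          using main_bounds(1)[OF 3(1) eps 3(2)] unfolding z_def r_def .
        also have "\<dots> \<le> z ^ 200 * real n" using z by (intro mult_right_mono power_increasing) auto
        finally have "real (main_cost n \<epsilon> (?D X)) \<le> z ^ 200 * real n" .
        moreover have "1 * 1 \<le> z ^ 200 * real n" using z n by (intro mult_mono one_le_power) auto
        ultimately show ?thesis unfolding z_power of_nat_add of_nat_numeral by linarith
      qed
      have samples: "real (main_samples n \<epsilon> (?D X)) \<le> 200 * r powr (200 / \<epsilon>) * max 1 (log 2 (real n))" for X
      proof -
        have "real (main_samples n \<epsilon> (?D X)) \<le> z ^ 121 * max 1 (log 2 (real n))"
          using main_bounds(2)[OF 3(1) eps 3(2)] unfolding z_def r_def .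
        also have "\<dots> \<le> (200 * z ^ 200) * max 1 (log 2 (real n))"
        proof (rule mult_right_mono)
          have "z ^ 121 \<le> z ^ 200" using z by (intro power_increasing) auto
          moreover have "0 \<le> z ^ 200" using z by simp
          ultimately show "z ^ 121 \<le> 200 * z ^ 200" by linarith
        qed simp
        finally show ?thesis unfolding z_power .
      qed
      show ?thesis
        by (rule exI[of _ "\<lambda>X. main_cost n \<epsilon> (?D X) + 2"], rule exI[of _ "\<lambda>X. main_samples n \<epsilon> (?D X)"],
            rule exI[of _ "\<lambda>X. learned n \<epsilon> (?D X)"])
          (intro conjI allI run success time samples)
    qed
  qed
  then obtain T m H where run: "\<And>X. reaches (?D X) learner (start n \<epsilon>) (T X)
        (\<lambda>s. drawn s = m X \<and> (\<forall>x. circuit_fun (emitted s) x = H X x))"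
    and success: "2 / 3 \<le> measure (iid_points n) {X. norm2 n (\<lambda>x. f x - H X x) \<le> \<epsilon>}"
    and time: "\<And>X. real (T X) \<le> 200 * r powr (200 / \<epsilon>) * real n"
    and samples: "\<And>X. real (m X) \<le> 200 * r powr (200 / \<epsilon>) * max 1 (log 2 (real n))"
    by blast
  have "(\<exists>t m h. runs learner n \<epsilon> f X t m h \<and> norm2 n (\<lambda>x. f x - circuit_fun h x) \<le> \<epsilon>) \<longleftrightarrow>
      norm2 n (\<lambda>x. f x - H X x) \<le> \<epsilon>" for X
    by (rule reaches_runs(1)[OF run])
  then have prob: "\<P>(X in iid_points n. \<exists>t m h. runs learner n \<epsilon> f X t m h \<and>
      norm2 n (\<lambda>x. f x - circuit_fun h x) \<le> \<epsilon>) \<ge> 2 / 3"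
    using success by simp
  have bounds: "\<exists>t m h. runs learner n \<epsilon> f X t m h \<and>
      real t \<le> 200 * r powr (200 / \<epsilon>) * real n \<and>
      real m \<le> 200 * r powr (200 / \<epsilon>) * max 1 (log 2 (real n))" for X
  proof -
    obtain t h where "runs learner n \<epsilon> f X t (m X) h" "t \<le> T X"
      using reaches_runs(2)[OF run[of X]] by blast
    moreover from this(2) have "real t \<le> 200 * r powr (200 / \<epsilon>) * real n"
      using time[of X] by linarith
    ultimately show ?thesis using samples[of X] by blast
  qed
  show "\<P>(X in iid_points n. \<exists>t m h. runs learner n \<epsilon> f X t m h \<and>
      norm2 n (\<lambda>x. f x - circuit_fun h x) \<le> \<epsilon>) \<ge> 2 / 3 \<and>
    (let r = min (real n) (2 powr (1 / \<epsilon>)) in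
      \<forall>X. (\<forall>j. X j \<in> cube n) \<longrightarrow>
        (\<exists>t m h. runs learner n \<epsilon> f X t m h \<and>
          real t \<le> 200 * r powr (200 / \<epsilon>) * real n \<and>
          real m \<le> 200 * r powr (200 / \<epsilon>) * max 1 (log 2 (real n))))"
    unfolding Let_def r_def[symmetric] by (intro conjI allI impI prob bounds)
qed

end
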